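(* Let $M$ be an orientable surface immersed in $(\mathbb{R}^3,\|\cdot\|)$ with Birkhoff-Gauss map $\eta:M\to\partial B$, and let $p\in M$. Denote by $C_M(p,r)$ the (Euclidean) length of the Euclidean geodesic circle of $M$ centered at $p$ with radius $r>0$, and by $C_{\partial B}(\eta(p),r)$ the (Euclidean) length of the Euclidean geodesic circle of $\partial B$ centered at $\eta(p)$ with radius $r$. Then the Minkowski Gaussian curvature of $M$ at $p$ is $$K(p)=\lim_{r\to 0^+}\frac{2\pi r-C_M(p,r)}{2\pi r-C_{\partial B}(\eta(p),r)}.$$
   Context: $\|\cdot\|$ is a smooth and strictly convex norm on $\mathbb{R}^3$ with unit sphere $\partial B=\{x:\|x\|=1\}$; the usual (Euclidean) Gaussian curvature of the surface $\partial B$ is assumed to vanish nowhere. A vector $v$ is Birkhoff orthogonal to a plane $P\subseteq\mathbb{R}^3$ (through the origin) if $\|v\|\le\|v+tw\|$ for all $w\in P$, $t\in\mathbb{R}$. For an immersion $f:M\to\mathbb{R}^3$ of an orientable smooth surface, $T_pM$ is identified with $f_*(T_pM)\subset\mathbb{R}^3$. The Birkhoff-Gauss map $\eta:M\to\partial B$ is a smooth map such that $\eta(p)$ is Birkhoff orthogonal to $T_pM$ for each $p$. Since $T_{\eta(p)}\partial B=T_pM$ as linear planes, $d\eta_p$ is an endomorphism of $T_pM$, and the Minkowski Gaussian curvature is $K(p)=\det(d\eta_p)$. A fixed Euclidean inner product on $\mathbb{R}^3$ (the standard one) induces Riemannian metrics on $M$ and $\partial B$. For small $r>0$, the Euclidean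 geodesic circle of center $p$ and radius $r$ consists of the points at Riemannian distance at most $r$ from $p$ in this metric; its length is the Riemannian length of its boundary curve (points at distance exactly $r$). *)

theory Defs
  imports "HOL-Analysis.Analysis"
begin

section \<open>Smooth maps between normed spaces\<close>

text \<open>\<open>Ck_on k S f\<close>: \<open>f\<close> is \<open>k\<close> times continuously differentiable on the \<^emph>\<open>open\<close> set \<open>S\<close>;
  all directional derivatives are again of class \<open>k - 1\<close>.\<close>

primrec Ck_on :: "nat \<Rightarrow> 'a::real_normed_vector set \<Rightarrow> ('a \<Rightarrow> 'b::real_normed_vector) \<Rightarrow> bool" where
  "Ck_on 0 S f \<longleftrightarrow> continuous_on S f"
| "Ck_on (Suc k) S f \<longleftrightarrow>
     (\<forall>x\<in>S. f differentiable (at x)) \<and>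
     (\<forall>v. Ck_on k S (\<lambda>x. frechet_derivative f (at x) v))"

definition smooth_on :: "'a::real_normed_vector set \<Rightarrow> ('a \<Rightarrow> 'b::real_normed_vector) \<Rightarrow> bool" where
  "smooth_on S f \<longleftrightarrow> (\<forall>k. Ck_on k S f)"


section \<open>Smooth surfaces\<close>

text \<open>A chart is a pair \<open>(U, \<phi>)\<close> of an open domain and a coordinate map; \<open>\<phi>\<close> is irrelevant
  outside \<open>U\<close>, and the inverse of the chart is \<open>inv_into U \<phi>\<close>, defined on the open set \<open>\<phi> ` U\<close>.\<close>

type_synonym 'a chart = "'a set \<times> ('a \<Rightarrow> real^2)"

definition chart_of :: "'a topology \<Rightarrow> 'a chart \<Rightarrow> bool" where
  "chart_of X = (\<lambda>(U, \<phi>). openin X U \<and> open (\<phi> ` U) \<and>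
     homeomorphic_map (subtopology X U) (top_of_set (\<phi> ` U)) \<phi>)"

definition smooth_atlas :: "'a topology \<Rightarrow> 'a chart set \<Rightarrow> bool" where
  "smooth_atlas X A \<longleftrightarrow>
     (\<forall>c\<in>A. chart_of X c) \<and> (\<Union>c\<in>A. fst c) = topspace X \<and>
     (\<forall>(U, \<phi>)\<in>A. \<forall>(V, \<psi>)\<in>A. smooth_on (\<phi> ` (U \<inter> V)) (\<psi> \<circ> inv_into U \<phi>))"

definition smooth_surface :: "'a topology \<Rightarrow> 'a chart set \<Rightarrow> bool" where
  "smooth_surface X A \<longleftrightarrow> Hausdorff_space X \<and> second_countable X \<and> smooth_atlas X A"

definition orientable_surface :: "'a topology \<Rightarrow> 'a chart set \<Rightarrow> bool" where
  "orientable_surface X A \<longleftrightarrow>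
     (\<exists>A'. smooth_atlas X A' \<and> smooth_atlas X (A \<union> A') \<and>
       (\<forall>(U, \<phi>)\<in>A'. \<forall>(V, \<psi>)\<in>A'. \<forall>x\<in>\<phi> ` (U \<inter> V).
          det (matrix (frechet_derivative (\<psi> \<circ> inv_into U \<phi>) (at x))) > 0))"

definition smooth_map :: "'a chart set \<Rightarrow> ('a \<Rightarrow> real^3) \<Rightarrow> bool" where
  "smooth_map A h \<longleftrightarrow> (\<forall>(U, \<phi>)\<in>A. smooth_on (\<phi> ` U) (h \<circ> inv_into U \<phi>))"

definition chart_deriv :: "'a chart \<Rightarrow> ('a \<Rightarrow> real^3) \<Rightarrow> 'a \<Rightarrow> real^2 \<Rightarrow> real^3" where
  "chart_deriv = (\<lambda>(U, \<phi>) h p. frechet_derivative (h \<circ> inv_into U \<phi>) (at (\<phi> p)))"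

definition immersion :: "'a chart set \<Rightarrow> ('a \<Rightarrow> real^3) \<Rightarrow> bool" where
  "immersion A f \<longleftrightarrow> smooth_map A f \<and> (\<forall>c\<in>A. \<forall>p\<in>fst c. inj (chart_deriv c f p))"

text \<open>The smooth structure of a regular surface \<open>S\<close> in space: the charts are the inverses of all
  regular parametrizations of open pieces of \<open>S\<close>.\<close>

definition regular_atlas :: "(real^3) set \<Rightarrow> (real^3) chart set" where
  "regular_atlas S = {(U, \<phi>). chart_of (top_of_set S) (U, \<phi>) \<and> smooth_on (\<phi> ` U) (inv_into U \<phi>) \<and>
     (\<forall>x\<in>\<phi> ` U. inj (frechet_derivative (inv_into U \<phi>) (at x)))}"


section \<open>Tangent planes and curvature\<close>

text \<open>\<open>tangent_plane A f p\<close> is the image of the tangent plane at \<open>p\<close> under the differential of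
  the immersion \<open>f\<close>, with which it is identified. Accordingly \<open>surf_differential A f h p\<close> is the
  differential at \<open>p\<close> of a map \<open>h\<close> on the surface, regarded as a map on that plane in space
  (only its values there matter).\<close>

definition tangent_plane :: "'a chart set \<Rightarrow> ('a \<Rightarrow> real^3) \<Rightarrow> 'a \<Rightarrow> (real^3) set" where
  "tangent_plane A f p = {chart_deriv c f p v |c v. c \<in> A \<and> p \<in> fst c}"

definition surf_differential ::
    "'a chart set \<Rightarrow> ('a \<Rightarrow> real^3) \<Rightarrow> ('a \<Rightarrow> real^3) \<Rightarrow> 'a \<Rightarrow> real^3 \<Rightarrow> real^3" where
  "surf_differential A f h p w =
     (THE z. \<exists>c\<in>A. p \<in> fst c \<and> (\<exists>v. w = chart_deriv c f p v \<and> z = chart_deriv c h p v))"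

text \<open>Determinant of an endomorphism \<open>L\<close> of a plane \<open>P\<close>, read off from its matrix in any basis
  of \<open>P\<close>.\<close>

definition plane_det :: "(real^3) set \<Rightarrow> (real^3 \<Rightarrow> real^3) \<Rightarrow> real" where
  "plane_det P L = (THE d. \<exists>b1 b2 a11 a12 a21 a22.
     b1 \<noteq> b2 \<and> independent {b1, b2} \<and> span {b1, b2} = P \<and>
     L b1 = a11 *\<^sub>R b1 + a21 *\<^sub>R b2 \<and> L b2 = a12 *\<^sub>R b1 + a22 *\<^sub>R b2 \<and>
     d = a11 * a22 - a12 * a21)"

definition gauss_map_curvature ::
    "'a chart set \<Rightarrow> ('a \<Rightarrow> real^3) \<Rightarrow> ('a \<Rightarrow> real^3) \<Rightarrow> 'a \<Rightarrow> real" where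
  "gauss_map_curvature A f \<nu> p = plane_det (tangent_plane A f p) (surf_differential A f \<nu> p)"


section \<open>Norms on three-space\<close>

definition is_norm :: "(real^3 \<Rightarrow> real) \<Rightarrow> bool" where
  "is_norm N \<longleftrightarrow> (\<forall>x. 0 \<le> N x) \<and> (\<forall>x. N x = 0 \<longleftrightarrow> x = 0) \<and>
     (\<forall>c x. N (c *\<^sub>R x) = \<bar>c\<bar> * N x) \<and> (\<forall>x y. N (x + y) \<le> N x + N y)"

definition smooth_norm :: "(real^3 \<Rightarrow> real) \<Rightarrow> bool" where
  "smooth_norm N \<longleftrightarrow> smooth_on (- {0}) N"

definition strictly_convex_norm :: "(real^3 \<Rightarrow> real) \<Rightarrow> bool" where
  "strictly_convex_norm N \<longleftrightarrow>
     (\<forall>x y. N x = 1 \<and> N y = 1 \<and> x \<noteq> y \<longrightarrow> (\<forall>z\<in>open_segment x y. N z < 1))"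

definition unit_sphere :: "(real^3 \<Rightarrow> real) \<Rightarrow> (real^3) set" where
  "unit_sphere N = {x. N x = 1}"

text \<open>The Euclidean Gauss map of the unit sphere: the outward unit normal.\<close>

definition sphere_normal :: "(real^3 \<Rightarrow> real) \<Rightarrow> real^3 \<Rightarrow> real^3" where
  "sphere_normal N x = (THE u. norm u = 1 \<and>
     (\<forall>w\<in>tangent_plane (regular_atlas (unit_sphere N)) id x. u \<bullet> w = 0) \<and> u \<bullet> x > 0)"

definition sphere_gauss_curvature :: "(real^3 \<Rightarrow> real) \<Rightarrow> real^3 \<Rightarrow> real" where
  "sphere_gauss_curvature N x =
     gauss_map_curvature (regular_atlas (unit_sphere N)) id (sphere_normal N) x"

definition birkhoff_orthogonal :: "(real^3 \<Rightarrow> real) \<Rightarrow> real^3 \<Rightarrow> (real^3) set \<Rightarrow> bool" where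
  "birkhoff_orthogonal N v P \<longleftrightarrow> (\<forall>w\<in>P. \<forall>t. N v \<le> N (v + t *\<^sub>R w))"

text \<open>Smoothness as a map into the unit sphere is smoothness as a map into space, the unit sphere
  being an embedded submanifold.\<close>

definition birkhoff_gauss_map ::
    "(real^3 \<Rightarrow> real) \<Rightarrow> 'a topology \<Rightarrow> 'a chart set \<Rightarrow> ('a \<Rightarrow> real^3) \<Rightarrow> ('a \<Rightarrow> real^3) \<Rightarrow> bool" where
  "birkhoff_gauss_map N X A f \<eta> \<longleftrightarrow> smooth_map A \<eta> \<and>
     (\<forall>p\<in>topspace X. \<eta> p \<in> unit_sphere N \<and> birkhoff_orthogonal N (\<eta> p) (tangent_plane A f p))"

definition minkowski_curvature ::
    "'a chart set \<Rightarrow> ('a \<Rightarrow> real^3) \<Rightarrow> ('a \<Rightarrow> real^3) \<Rightarrow> 'a \<Rightarrow> real" where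
  "minkowski_curvature A f \<eta> p = gauss_map_curvature A f \<eta> p"


section \<open>Riemannian length and distance of the induced metric\<close>

text \<open>Class C1 up to the (one-sided) end points. The stock notion
  \<open>piecewise_C1_differentiable_on\<close> allows unbounded derivatives at the break points, hence curves
  of infinite length, to which \<open>integral\<close> would assign length 0.\<close>

definition C1_on_interval :: "real \<Rightarrow> real \<Rightarrow> (real \<Rightarrow> 'b::real_normed_vector) \<Rightarrow> bool" where
  "C1_on_interval a b g \<longleftrightarrow> (\<exists>D. continuous_on {a..b} D \<and>
     (\<forall>t\<in>{a..b}. (g has_vector_derivative D t) (at t within {a..b})))"

text \<open>Piecewise C1 curves on \<open>{0..1}\<close> in a surface: the partition is also taken fine enough that
  each piece lies in the domain of a chart.\<close>

definition surface_curve :: "'a topology \<Rightarrow> 'a chart set \<Rightarrow> (real \<Rightarrow> 'a) \<Rightarrow> bool" where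
  "surface_curve X A \<gamma> \<longleftrightarrow> pathin X \<gamma> \<and>
     (\<exists>n (t::nat \<Rightarrow> real). t 0 = 0 \<and> t n = 1 \<and>
       (\<forall>i<n. t i < t (Suc i) \<and>
         (\<exists>(U, \<phi>)\<in>A. \<gamma> ` {t i..t (Suc i)} \<subseteq> U \<and> C1_on_interval (t i) (t (Suc i)) (\<phi> \<circ> \<gamma>))))"

text \<open>In the metric induced by \<open>f\<close> the speed of \<open>\<gamma>\<close> is the Euclidean norm of the image of its
  velocity under the differential of \<open>f\<close>, that is, of the velocity of \<open>f \<circ> \<gamma>\<close>.\<close>

definition curve_length :: "('a \<Rightarrow> real^3) \<Rightarrow> (real \<Rightarrow> 'a) \<Rightarrow> real" where
  "curve_length f \<gamma> = integral {0..1} (\<lambda>t. norm (vector_derivative (f \<circ> \<gamma>) (at t)))"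

text \<open>Extended-real valued, so that points in different components have distance \<open>\<infinity>\<close>.\<close>

definition riemannian_dist ::
    "'a topology \<Rightarrow> 'a chart set \<Rightarrow> ('a \<Rightarrow> real^3) \<Rightarrow> 'a \<Rightarrow> 'a \<Rightarrow> ereal" where
  "riemannian_dist X A f p q =
     (INF \<gamma>\<in>{\<gamma>. surface_curve X A \<gamma> \<and> \<gamma> 0 = p \<and> \<gamma> 1 = q}. ereal (curve_length f \<gamma>))"

text \<open>The boundary curve of the geodesic circle (disc) of center \<open>p\<close> and radius \<open>r\<close>, as a set.\<close>

definition geodesic_circle_boundary ::
    "'a topology \<Rightarrow> 'a chart set \<Rightarrow> ('a \<Rightarrow> real^3) \<Rightarrow> 'a \<Rightarrow> real \<Rightarrow> 'a set" where
  "geodesic_circle_boundary X A f p r = {q \<in> topspace X. riemannian_dist X A f p q = ereal r}"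

text \<open>The length of the boundary is that of a simple closed parametrization of it. This determines
  a value only if such a parametrization exists, as it does for all small \<open>r > 0\<close>.\<close>

definition geodesic_circle_length ::
    "'a topology \<Rightarrow> 'a chart set \<Rightarrow> ('a \<Rightarrow> real^3) \<Rightarrow> 'a \<Rightarrow> real \<Rightarrow> real" where
  "geodesic_circle_length X A f p r =
     (THE l. \<exists>\<gamma>. surface_curve X A \<gamma> \<and> \<gamma> 0 = \<gamma> 1 \<and> inj_on \<gamma> {0..<1} \<and>
        \<gamma> ` {0..1} = geodesic_circle_boundary X A f p r \<and> l = curve_length f \<gamma>)"

definition unit_sphere_circle_length :: "(real^3 \<Rightarrow> real) \<Rightarrow> real^3 \<Rightarrow> real \<Rightarrow> real" where
  "unit_sphere_circle_length N x r =
     geodesic_circle_length (top_of_set (unit_sphere N)) (regular_atlas (unit_sphere N)) id x r"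

end

theory Submission
  imports Defs
begin

text \<open>Both numerator and denominator are governed by the Bertrand--Diquet--Puiseux expansion
  \<open>2 \<pi> r - C(r) = \<pi> k r\<^sup>3 / 3 + o(r\<^sup>3)\<close>, where \<open>k\<close> is the Euclidean Gaussian curvature at the center.
  So the limit is the quotient of the Euclidean curvatures of \<open>M\<close> at \<open>p\<close> and of \<open>\<partial>B\<close> at \<open>\<eta> p\<close>.
  Birkhoff orthogonality says that \<open>\<eta>\<close> followed by the Euclidean normal of \<open>\<partial>B\<close> is, up to sign, the
  Euclidean normal of \<open>M\<close>; differentiating and taking determinants shows that this quotient is \<open>K p\<close>.

  For the expansion, geodesics issuing from the center are written as a flow near an equilibrium of
  the geodesic equation, which is \<open>C\<^sup>1\<close> in the initial velocity. The Gauss lemma identifies small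
  geodesic circles with images of round circles under the exponential map, and the length density
  \<open>j\<close> of such an image satisfies the Jacobi equation \<open>j'' = - k j\<close>, derived here in space from the
  normality of the acceleration.\<close>

text \<open>Curvature enters only at third order in the radius, yet the flow supplies no more than
  one continuous derivative in the initial velocity. The way out is that velocity and normal
  acceleration along a geodesic are smooth functions of the state: differentiating each once in the
  initial velocity and exchanging this with the time derivative yields two time derivatives of the
  variation field, which is all the Jacobi equation asks for. A second obstacle lies in the
  definitions: circles are level sets of an infimum over all piecewise C^1 curves, including those
  that leave the chart, and their length is a definite description over all simple closed
  parametrizations. Hence a lower bound on the length of arbitrary curves and the invariance of
  length under all such changes of parameter have to be proved. Curvature is handled as the factor
  \<open>k\<close> in \<open>dn v \<times> dn w = k (dF v \<times> dF w)\<close>, with cross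
  products of vectors in space: this is quadratic in the normal, so its sign cancels, and it is
  multiplicative along \<open>\<eta>\<close> followed by the normal of the sphere.\<close>

section \<open>Flows near an equilibrium\<close>

text \<open>A contraction factor \<open>1/2\<close> over the unit interval lets all error terms be absorbed in the supremum
  norm; Gronwall's inequality is not needed.\<close>

lemma half_absorb:
  fixes e :: "real \<Rightarrow> 'b::real_normed_vector"
  assumes c: "continuous_on {0..1} e"
    and b: "\<And>M t. (\<And>s. s \<in> {0..1} \<Longrightarrow> norm (e s) \<le> M) \<Longrightarrow> t \<in> {0..1} \<Longrightarrow> norm (e t) \<le> b + M / 2"
    and t: "t \<in> {0..1::real}"
  shows "norm (e t) \<le> 2 * b"
proof -
  have "\<exists>s\<in>{0..1}. \<forall>y\<in>{0..1}. norm (e y) \<le> norm (e s)"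
    by (rule continuous_attains_sup) (auto intro!: continuous_intros c)
  then obtain s where s: "s \<in> {0..1}" "\<And>y. y \<in> {0..1} \<Longrightarrow> norm (e y) \<le> norm (e s)" by blast
  have "norm (e s) \<le> b + norm (e s) / 2" using b[OF s(2) s(1)] by simp
  then show ?thesis using s(2)[OF t] by linarith
qed

lemma norm_integral_le_unit:
  fixes g :: "real \<Rightarrow> 'b::banach"
  assumes "continuous_on {0..1} g" "\<And>s. s \<in> {0..1} \<Longrightarrow> norm (g s) \<le> B" "t \<in> {0..1}"
  shows "norm (integral {0..t} g) \<le> B"
proof -
  have B: "0 \<le> B" using assms(2)[of 0] norm_ge_zero[of "g 0"] by (auto intro: order_trans simp del: norm_ge_zero)
  have "norm (integral {0..t} g) \<le> B * (t - 0)"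
    using assms by (intro integral_bound) (auto intro: continuous_on_subset[OF assms(1)])
  also have "\<dots> = B * t" using assms by simp
  also have "\<dots> \<le> B" using assms B by (simp add: mult_left_le)
  finally show ?thesis by simp
qed

text \<open>The Lipschitz constant 1/2 over a time interval of length one makes the integral
  operator a contraction outright, so a single application of Banach's fixed point theorem covers
  the whole interval.\<close>

lemma picard_half:
  fixes H :: "real \<Rightarrow> 'b::banach \<Rightarrow> 'b"
  assumes cH: "continuous_on ({0..1} \<times> UNIV) (\<lambda>(t,y). H t y)"
    and L: "\<And>t y z. t \<in> {0..1} \<Longrightarrow> norm (H t y - H t z) \<le> norm (y - z) / 2"
  obtains y where "continuous_on {0..1} y" "\<And>t. t \<in> {0..1} \<Longrightarrow> y t = y0 + integral {0..t} (\<lambda>s. H s (y s))"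
proof -
  \<comment> \<open>\<open>cl\<close> clamps time to the unit interval: the operator then acts on
    bounded continuous functions on the whole line, a complete space, and its values are constant
    outside the interval.\<close>
  define cl :: "real \<Rightarrow> real" where "cl = (\<lambda>t. max 0 (min 1 t))"
  have cl: "cl t \<in> {0..1}" for t by (auto simp: cl_def)
  have cl_id: "t \<in> {0..1} \<Longrightarrow> cl t = t" for t by (auto simp: cl_def)
  have ccl: "continuous_on UNIV cl" unfolding cl_def by (intro continuous_intros)
  define T where "T = (\<lambda>(y :: real \<Rightarrow> 'b) t. y0 + integral {0..cl t} (\<lambda>s. H s (y s)))"
  have cHy: "continuous_on {0..1} (\<lambda>s. H s (y s))" if "continuous_on {0..1} y" for y
    using that by (intro continuous_on_compose2[OF cH, of "{0..1}" "\<lambda>s. (s, y s)", simplified]) (auto intro!: continuous_intros)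
  have Tb: "T y \<in> bcontfun" if y: "continuous_on {0..1} y" for y
  proof -
    have ci: "continuous_on {0..1} (\<lambda>t. integral {0..t} (\<lambda>s. H s (y s)))"
      by (intro indefinite_integral_continuous_1 integrable_continuous_interval cHy y)
    have c: "continuous_on UNIV (T y)" unfolding T_def
      by (intro continuous_intros continuous_on_compose2[OF ci ccl]) (use cl in auto)
    have "bounded ((\<lambda>t. y0 + integral {0..t} (\<lambda>s. H s (y s))) ` {0..1})"
      by (intro compact_imp_bounded compact_continuous_image continuous_intros ci) auto
    then have "bounded (range (T y))"
      by (rule bounded_subset) (use cl in \<open>auto simp: T_def\<close>)
    with c show ?thesis by (simp add: bcontfun_def)
  qed
  define TT :: "(real \<Rightarrow>\<^sub>C 'b) \<Rightarrow> (real \<Rightarrow>\<^sub>C 'b)" where "TT = (\<lambda>y. Bcontfun (T (apply_bcontfun y)))"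
  have cy: "continuous_on S (apply_bcontfun y)" for S and y :: "real \<Rightarrow>\<^sub>C 'b"
    using continuous_on_apply_bcontfun continuous_on_subset by blast
  have TT: "apply_bcontfun (TT y) = T (apply_bcontfun y)" for y
    unfolding TT_def by (intro Bcontfun_inverse Tb cy)
  have "dist (TT y) (TT z) \<le> 1/2 * dist y z" for y z
  proof (rule dist_bound)
    fix t
    have "TT y t - TT z t = integral {0..cl t} (\<lambda>s. H s (y s) - H s (z s))"
      unfolding TT T_def using cl[of t]
      by (subst integral_diff) (auto intro!: integrable_continuous_interval continuous_on_subset[OF cHy[OF cy]])
    also have "norm \<dots> \<le> 1/2 * dist y z"
    proof (rule norm_integral_le_unit[OF _ _ cl])
      show "continuous_on {0..1} (\<lambda>s. H s (y s) - H s (z s))" by (intro continuous_intros cHy cy)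
      fix s :: real assume "s \<in> {0..1}"
      then show "norm (H s (y s) - H s (z s)) \<le> 1/2 * dist y z"
        using L[of s "y s" "z s"] dist_bounded[of y s z] by (simp add: dist_norm)
    qed
    finally show "dist (TT y t) (TT z t) \<le> 1/2 * dist y z" by (simp add: dist_norm)
  qed
  then obtain y where y: "TT y = y" using banach_fix_type[of "1/2" TT] by auto
  show ?thesis
  proof (rule that[of y])
    show "continuous_on {0..1} y" by (rule cy)
    fix t :: real assume "t \<in> {0..1}"
    then show "y t = y0 + integral {0..t} (\<lambda>s. H s (y s))"
      using TT[of y] unfolding y T_def by (metis cl_id)
  qed
qed

lemma integral_eq_imp_vderiv:
  fixes y :: "real \<Rightarrow> 'b::banach"
  assumes "\<And>t. t \<in> {0..1} \<Longrightarrow> y t = y0 + integral {0..t} g" "continuous_on {0..1} g" "t \<in> {0..1}"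
  shows "(y has_vector_derivative g t) (at t within {0..1})"
proof -
  have "((\<lambda>t. integral {0..t} g) has_vector_derivative g t) (at t within {0..1})"
    by (intro integral_has_vector_derivative assms)
  then have "((\<lambda>t. y0 + integral {0..t} g) has_vector_derivative g t) (at t within {0..1})"
    by (auto intro!: derivative_eq_intros)
  then show ?thesis
    by (rule has_vector_derivative_transform[rotated 2]) (use assms in auto)
qed

lemma vderiv_imp_integral_eq:
  fixes y :: "real \<Rightarrow> 'b::banach"
  assumes "\<And>t. t \<in> {0..1} \<Longrightarrow> (y has_vector_derivative g t) (at t within {0..1})" "t \<in> {0..1}"
  shows "y t = y 0 + integral {0..t} g"
proof -
  have "(g has_integral y t - y 0) {0..t}"
    using assms(2) by (intro fundamental_theorem_of_calculus has_vector_derivative_within_subset[OF assms(1)]) auto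
  then show ?thesis by (simp add: has_integral_iff)
qed

text \<open>Orbits are compared with the constant solution \<open>a\<close>: by
  \<open>half_absorb\<close> their distance to it at most doubles, so those from the half ball
  remain in the ball for unit time. \<open>Y\<close> solves the linearized equation along the orbit;
  boundedness, Lipschitz dependence, continuity and differentiability are each an integral
  inequality absorbed in the same way.\<close>

lemma flow_near_equilibrium:
  fixes G :: "'a::euclidean_space \<Rightarrow> 'a" and G' :: "'a \<Rightarrow> 'a \<Rightarrow>\<^sub>L 'a"
  assumes R: "R > 0"
    and dG: "\<And>z. z \<in> cball a R \<Longrightarrow> (G has_derivative blinfun_apply (G' z)) (at z)"
    and cG': "continuous_on (cball a R) G'"
    and nG': "\<And>z. z \<in> cball a R \<Longrightarrow> norm (G' z) \<le> 1/2"
    and Ga: "G a = 0"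
  obtains \<Phi> :: "real \<Rightarrow> 'a \<Rightarrow> 'a" and Y :: "real \<Rightarrow> 'a \<Rightarrow> 'a \<Rightarrow>\<^sub>L 'a" where
    "\<And>z. z \<in> ball a (R/2) \<Longrightarrow> \<Phi> 0 z = z"
    "\<And>t z. t \<in> {0..1} \<Longrightarrow> z \<in> ball a (R/2) \<Longrightarrow> dist a (\<Phi> t z) \<le> 2 * dist a z"
    "\<And>t z. t \<in> {0..1} \<Longrightarrow> z \<in> ball a (R/2) \<Longrightarrow>
        ((\<lambda>t. \<Phi> t z) has_vector_derivative G (\<Phi> t z)) (at t within {0..1})"
    "\<And>t z. t \<in> {0..1} \<Longrightarrow> z \<in> ball a (R/2) \<Longrightarrow> (\<Phi> t has_derivative blinfun_apply (Y t z)) (at z)"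
    "continuous_on ({0..1} \<times> ball a (R/2)) (\<lambda>(t,z). \<Phi> t z)"
    "continuous_on ({0..1} \<times> ball a (R/2)) (\<lambda>(t,z). Y t z)"
proof -
  let ?K = "cball a R" and ?B = "ball a (R/2)"
  have K: "convex ?K" "closed ?K" "?K \<noteq> {}" "compact ?K" using R by auto
  have Glip: "norm (G y - G z) \<le> norm (y - z) / 2" if "y \<in> ?K" "z \<in> ?K" for y z
  proof -
    have "norm (G y - G z) \<le> 1/2 * norm (y - z)"
      by (rule differentiable_bound[OF K(1) has_derivative_at_withinI[OF dG]])
        (use nG' that in \<open>auto simp: norm_blinfun.rep_eq[symmetric]\<close>)
    then show ?thesis by simp
  qed
  have contG: "continuous_on ?K G"
    by (rule has_derivative_continuous_on[OF has_derivative_at_withinI[OF dG]])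
  \<comment> \<open>Composition with the nearest-point projection, which is 1-Lipschitz, makes the
    field globally Lipschitz with constant 1/2 without changing it on the ball, where the orbits
    turn out to stay.\<close>
  define P where "P = closest_point ?K"
  have PK: "P z \<in> ?K" for z unfolding P_def by (rule closest_point_in_set[OF K(2,3)])
  have Pid: "P z = z" if "z \<in> ?K" for z unfolding P_def using closest_point_self[OF that] .
  have Plip: "norm (P y - P z) \<le> norm (y - z)" for y z
    using closest_point_lipschitz[OF K(1-3)] by (simp add: P_def dist_norm)
  have contP: "continuous_on S P" for S
    unfolding P_def by (rule continuous_on_closest_point[OF K(1-3)])
  have cGP: "continuous_on S (\<lambda>s. G (P (h s)))" if "continuous_on S h" for S and h :: "'c::topological_space \<Rightarrow> 'a"
    by (rule continuous_on_compose2[OF contG continuous_on_compose2[OF contP[of UNIV] that]]) (use PK in auto)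
  have "\<exists>y. continuous_on {0..1} y \<and> (\<forall>t\<in>{0..1::real}. y t = z + integral {0..t} (\<lambda>s. G (P (y s))))" for z
  proof (rule picard_half[of "\<lambda>t y. G (P y)" z])
    show "continuous_on ({0..1} \<times> UNIV) (\<lambda>(t::real, y). G (P y))"
      unfolding case_prod_unfold by (intro cGP continuous_intros)
    show "norm (G (P y) - G (P z)) \<le> norm (y - z) / 2" for y z
      using Glip[OF PK PK, of y z] Plip[of y z] by linarith
  qed blast
  then have "\<exists>\<Phi>0. \<forall>z. continuous_on {0..1} (\<Phi>0 z) \<and> (\<forall>t\<in>{0..1::real}. \<Phi>0 z t = z + integral {0..t} (\<lambda>s. G (P (\<Phi>0 z s))))"
    by (intro choice allI)
  then obtain \<Phi>0 where \<Phi>0: "\<And>z. continuous_on {0..1::real} (\<Phi>0 z)"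
    "\<And>z t. t \<in> {0..1} \<Longrightarrow> \<Phi>0 z t = z + integral {0..t} (\<lambda>s. G (P (\<Phi>0 z s)))" by blast
  have contGP: "continuous_on {0..1} (\<lambda>s. G (P (\<Phi>0 z s)))" for z
    by (intro cGP \<Phi>0)
  have dist\<Phi>0: "norm (\<Phi>0 z t - a) \<le> 2 * norm (z - a)" if "t \<in> {0..1}" for t z
  proof (rule half_absorb[OF _ _ that])
    show "continuous_on {0..1} (\<lambda>t. \<Phi>0 z t - a)" by (intro continuous_intros \<Phi>0)
    fix M and t :: real
    assume M: "\<And>s. s \<in> {0..1} \<Longrightarrow> norm (\<Phi>0 z s - a) \<le> M" and t: "t \<in> {0..1}"
    have "norm (integral {0..t} (\<lambda>s. G (P (\<Phi>0 z s)))) \<le> M/2"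
    proof (rule norm_integral_le_unit[OF contGP _ t])
      fix s :: real assume "s \<in> {0..1}"
      then show "norm (G (P (\<Phi>0 z s))) \<le> M / 2"
        using Glip[OF PK, of a "\<Phi>0 z s"] Plip[of "\<Phi>0 z s" a] M[of s] R by (simp add: Ga Pid)
    qed
    then show "norm (\<Phi>0 z t - a) \<le> norm (z - a) + M / 2"
      using norm_triangle_ineq[of "z - a" "integral {0..t} (\<lambda>s. G (P (\<Phi>0 z s)))"] \<Phi>0(2)[OF t, of z]
      by (simp add: algebra_simps)
  qed
  define \<Phi> where "\<Phi> = (\<lambda>t z. \<Phi>0 z t)"
  have \<Phi>d: "dist a (\<Phi> t z) \<le> 2 * dist a z" if "t \<in> {0..1}" for t z
    using dist\<Phi>0[OF that, of z] by (simp add: \<Phi>_def dist_norm norm_minus_commute)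
  have \<Phi>K: "\<Phi> t z \<in> ?K" if "t \<in> {0..1}" "z \<in> ?B" for t z
    using \<Phi>d[of t z] that by auto
  have c\<Phi>: "continuous_on {0..1} (\<lambda>t. \<Phi> t z)" for z using \<Phi>0 by (simp add: \<Phi>_def)
  have \<Phi>: "\<Phi> t z = z + integral {0..t} (\<lambda>s. G (\<Phi> s z))" if "t \<in> {0..1}" "z \<in> ?B" for t z
  proof -
    have "integral {0..t} (\<lambda>s. G (P (\<Phi> s z))) = integral {0..t} (\<lambda>s. G (\<Phi> s z))"
      by (rule integral_cong) (use that \<Phi>K Pid in auto)
    then show ?thesis using \<Phi>0(2)[OF that(1), of z] by (simp add: \<Phi>_def)
  qed
  have cG\<Phi>: "continuous_on {0..1} (\<lambda>t. G (\<Phi> t z))" if "z \<in> ?B" for z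
    by (intro continuous_on_compose2[OF contG c\<Phi>]) (use \<Phi>K that in blast)
  have cG'\<Phi>: "continuous_on {0..1} (\<lambda>t. G' (\<Phi> t z))" if "z \<in> ?B" for z
    by (intro continuous_on_compose2[OF cG' c\<Phi>]) (use \<Phi>K that in blast)
  have \<Phi>lip: "norm (\<Phi> t y - \<Phi> t z) \<le> 2 * norm (y - z)" if "t \<in> {0..1}" "y \<in> ?B" "z \<in> ?B" for t y z
  proof (rule half_absorb[OF _ _ that(1)])
    show "continuous_on {0..1} (\<lambda>t. \<Phi> t y - \<Phi> t z)" by (intro continuous_intros c\<Phi>)
    fix M and t :: real
    assume M: "\<And>s. s \<in> {0..1} \<Longrightarrow> norm (\<Phi> s y - \<Phi> s z) \<le> M" and t: "t \<in> {0..1}"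
    have "norm (integral {0..t} (\<lambda>s. G (\<Phi> s y) - G (\<Phi> s z))) \<le> M/2"
    proof (rule norm_integral_le_unit[OF _ _ t])
      show "continuous_on {0..1} (\<lambda>s. G (\<Phi> s y) - G (\<Phi> s z))" by (intro continuous_intros cG\<Phi> that)
      fix s :: real assume s: "s \<in> {0..1}"
      then show "norm (G (\<Phi> s y) - G (\<Phi> s z)) \<le> M / 2"
        using Glip[OF \<Phi>K[OF s that(2)] \<Phi>K[OF s that(3)]] M[of s] by simp
    qed
    moreover have "\<Phi> t y - \<Phi> t z = (y - z) + integral {0..t} (\<lambda>s. G (\<Phi> s y) - G (\<Phi> s z))"
      using t that by (subst integral_diff) (auto simp: \<Phi>[OF t] intro!: integrable_continuous_interval continuous_on_subset[OF cG\<Phi>])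
    ultimately show "norm (\<Phi> t y - \<Phi> t z) \<le> norm (y - z) + M / 2"
      using norm_triangle_ineq[of "y - z" "integral {0..t} (\<lambda>s. G (\<Phi> s y) - G (\<Phi> s z))"] by simp
  qed
  \<comment> \<open>The linearized equation along the orbit of \<open>z\<close>, started at the
    identity; in operator norm its right-hand side is again Lipschitz with constant 1/2.\<close>
  have "\<exists>y. z \<in> ?B \<longrightarrow> continuous_on {0..1} y \<and> (\<forall>t\<in>{0..1::real}. y t = id_blinfun + integral {0..t} (\<lambda>s. G' (\<Phi> s z) o\<^sub>L y s))" for z
  proof (cases "z \<in> ?B")
    case True
    show ?thesis
    proof (rule picard_half[of "\<lambda>t y. G' (\<Phi> t z) o\<^sub>L y" "id_blinfun"])
      show "continuous_on ({0..1} \<times> UNIV) (\<lambda>(t::real, y). G' (\<Phi> t z) o\<^sub>L y)"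
        by (auto simp: case_prod_unfold intro!: continuous_intros continuous_on_compose2[OF cG'\<Phi>[OF True]])
      show "norm ((G' (\<Phi> t z) o\<^sub>L y) - (G' (\<Phi> t z) o\<^sub>L y')) \<le> norm (y - y') / 2" if "t \<in> {0..1}" for t and y y' :: "'a \<Rightarrow>\<^sub>L 'a"
      proof -
        have "(G' (\<Phi> t z) o\<^sub>L y) - (G' (\<Phi> t z) o\<^sub>L y') = G' (\<Phi> t z) o\<^sub>L (y - y')"
          by (rule blinfun_eqI) (simp add: blinfun.bilinear_simps)
        then have "norm ((G' (\<Phi> t z) o\<^sub>L y) - (G' (\<Phi> t z) o\<^sub>L y')) \<le> norm (G' (\<Phi> t z)) * norm (y - y')"
          using norm_blinfun_compose[of "G' (\<Phi> t z)" "y - y'"] by simp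
        also have "\<dots> \<le> 1/2 * norm (y - y')" using nG'[OF \<Phi>K[OF that True]] by (intro mult_right_mono) auto
        finally show ?thesis by simp
      qed
    qed blast
  qed auto
  then have "\<exists>Y0. \<forall>z. z \<in> ?B \<longrightarrow> continuous_on {0..1} (Y0 z) \<and> (\<forall>t\<in>{0..1::real}. Y0 z t = id_blinfun + integral {0..t} (\<lambda>s. G' (\<Phi> s z) o\<^sub>L Y0 z s))"
    by (intro choice allI)
  then obtain Y0 where Y0: "\<And>z. z \<in> ?B \<Longrightarrow> continuous_on {0..1} (Y0 z)"
    "\<And>z t. z \<in> ?B \<Longrightarrow> t \<in> {0..1} \<Longrightarrow> Y0 z t = id_blinfun + integral {0..t} (\<lambda>s. G' (\<Phi> s z) o\<^sub>L Y0 z s)" by blast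
  have nY0: "norm (Y0 z t) \<le> 2" if "t \<in> {0..1}" "z \<in> ?B" for t z
  proof -
    have "norm (Y0 z t) \<le> 2 * 1"
    proof (rule half_absorb[OF _ _ that(1)])
      show "continuous_on {0..1} (Y0 z)" by (rule Y0(1)[OF that(2)])
      fix M and t :: real
      assume M: "\<And>s. s \<in> {0..1} \<Longrightarrow> norm (Y0 z s) \<le> M" and t: "t \<in> {0..1}"
      have "norm (integral {0..t} (\<lambda>s. G' (\<Phi> s z) o\<^sub>L Y0 z s)) \<le> M/2"
      proof (rule norm_integral_le_unit[OF _ _ t])
        show "continuous_on {0..1} (\<lambda>s. G' (\<Phi> s z) o\<^sub>L Y0 z s)" by (intro continuous_intros cG'\<Phi> Y0 that)
        fix s :: real assume s: "s \<in> {0..1}"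
        have "norm (G' (\<Phi> s z) o\<^sub>L Y0 z s) \<le> norm (G' (\<Phi> s z)) * norm (Y0 z s)" by (rule norm_blinfun_compose)
        also have "\<dots> \<le> 1/2 * M" using nG'[OF \<Phi>K[OF s that(2)]] M[OF s] by (intro mult_mono) auto
        finally show "norm (G' (\<Phi> s z) o\<^sub>L Y0 z s) \<le> M / 2" by simp
      qed
      then show "norm (Y0 z t) \<le> 1 + M / 2"
        using norm_triangle_ineq[of "id_blinfun::'a \<Rightarrow>\<^sub>L 'a" "integral {0..t} (\<lambda>s. G' (\<Phi> s z) o\<^sub>L Y0 z s)"] Y0(2)[OF that(2) t]
          norm_blinfun_id_le[where 'a='a] by simp
    qed
    then show ?thesis by simp
  qed
  have uc: "uniformly_continuous_on ?K G'" by (rule compact_uniformly_continuous[OF cG' K(4)])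
  \<comment> \<open>Of the allowance \<open>e\<close>, one factor 2 is spent on the absorption and
    one on the bound for \<open>norm (Y0 z s)\<close>, whence \<open>e/4\<close>; the radius
    \<open>d/2\<close> appears because the flow at most doubles distances.\<close>
  have cY: "\<exists>d>0. \<forall>y\<in>?B. norm (y - z) < d \<longrightarrow> (\<forall>t\<in>{0..1}. norm (Y0 y t - Y0 z t) \<le> e)" if z: "z \<in> ?B" and e: "e > 0" for z e
  proof -
    obtain d where d: "d > 0" "\<And>u v. u \<in> ?K \<Longrightarrow> v \<in> ?K \<Longrightarrow> dist v u < d \<Longrightarrow> dist (G' v) (G' u) < e/4"
      using uniformly_continuous_onE[OF uc, of "e/4"] e by auto
    have "norm (Y0 y t - Y0 z t) \<le> e" if y: "y \<in> ?B" "norm (y - z) < d/2" and t: "t \<in> {0..1}" for y t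
    proof -
      have "norm (Y0 y t - Y0 z t) \<le> 2 * (e/2)"
      proof (rule half_absorb[OF _ _ t])
        show "continuous_on {0..1} (\<lambda>t. Y0 y t - Y0 z t)" by (intro continuous_intros Y0 y z)
        fix M and t :: real
        assume M: "\<And>s. s \<in> {0..1} \<Longrightarrow> norm (Y0 y s - Y0 z s) \<le> M" and t: "t \<in> {0..1}"
        have c: "continuous_on {0..1} (\<lambda>s. (G' (\<Phi> s y) o\<^sub>L Y0 y s))" "continuous_on {0..1} (\<lambda>s. (G' (\<Phi> s z) o\<^sub>L Y0 z s))"
          by (intro continuous_intros cG'\<Phi> Y0 y z)+
        have "Y0 y t - Y0 z t = integral {0..t} (\<lambda>s. (G' (\<Phi> s y) o\<^sub>L Y0 y s) - (G' (\<Phi> s z) o\<^sub>L Y0 z s))"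
          using t by (subst integral_diff) (auto simp: Y0(2)[OF y(1) t] Y0(2)[OF z t] intro!: integrable_continuous_interval continuous_on_subset[OF c(1)] continuous_on_subset[OF c(2)])
        also have "norm \<dots> \<le> e/2 + M/2"
        proof (rule norm_integral_le_unit[OF _ _ t])
          show "continuous_on {0..1} (\<lambda>s. (G' (\<Phi> s y) o\<^sub>L Y0 y s) - (G' (\<Phi> s z) o\<^sub>L Y0 z s))" by (intro continuous_intros c)
          fix s :: real assume s: "s \<in> {0..1}"
          have eq: "(G' (\<Phi> s y) o\<^sub>L Y0 y s) - (G' (\<Phi> s z) o\<^sub>L Y0 z s) = (G' (\<Phi> s y) o\<^sub>L (Y0 y s - Y0 z s)) + ((G' (\<Phi> s y) - G' (\<Phi> s z)) o\<^sub>L Y0 z s)"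
            by (rule blinfun_eqI) (simp add: blinfun.bilinear_simps)
          have "norm (G' (\<Phi> s y) o\<^sub>L (Y0 y s - Y0 z s)) \<le> norm (G' (\<Phi> s y)) * norm (Y0 y s - Y0 z s)" by (rule norm_blinfun_compose)
          also have "\<dots> \<le> 1/2 * M" using nG'[OF \<Phi>K[OF s y(1)]] M[OF s] by (intro mult_mono) auto
          finally have 1: "norm (G' (\<Phi> s y) o\<^sub>L (Y0 y s - Y0 z s)) \<le> M/2" by simp
          have "dist (G' (\<Phi> s y)) (G' (\<Phi> s z)) < e/4"
            by (rule d(2)) (use \<Phi>K[OF s] y z \<Phi>lip[OF s y(1) z] in \<open>auto simp: dist_norm norm_minus_commute\<close>)
          then have dd: "norm (G' (\<Phi> s y) - G' (\<Phi> s z)) \<le> e/4" by (simp add: dist_norm)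
          have "norm ((G' (\<Phi> s y) - G' (\<Phi> s z)) o\<^sub>L Y0 z s) \<le> norm (G' (\<Phi> s y) - G' (\<Phi> s z)) * norm (Y0 z s)" by (rule norm_blinfun_compose)
          also have "\<dots> \<le> e/4 * 2" using dd nY0[OF s z] e by (intro mult_mono) auto
          finally show "norm ((G' (\<Phi> s y) o\<^sub>L Y0 y s) - (G' (\<Phi> s z) o\<^sub>L Y0 z s)) \<le> e/2 + M/2"
            unfolding eq using 1 by (intro norm_triangle_le) simp
        qed
        finally show "norm (Y0 y t - Y0 z t) \<le> e/2 + M/2" .
      qed
      then show ?thesis by simp
    qed
    then show ?thesis using d(1) by (intro exI[of _ "d/2"]) auto
  qed
  \<comment> \<open>The remainder solves the linearized equation up to the linearization error of
    \<open>G\<close>, which is at most \<open>e/4\<close> times a distance of at most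
    \<open>2 * norm (y - z)\<close>; absorption doubles the resulting \<open>e/2\<close>.\<close>
  have der: "(\<Phi> t has_derivative blinfun_apply (Y0 z t)) (at z)" if t: "t \<in> {0..1}" and z: "z \<in> ?B" for t z
    unfolding has_derivative_within_alt
  proof (intro conjI allI impI)
    show "bounded_linear (blinfun_apply (Y0 z t))" by (rule blinfun.bounded_linear_right)
    fix e :: real assume e: "e > 0"
    obtain d where d: "d > 0" "\<And>u v. u \<in> ?K \<Longrightarrow> v \<in> ?K \<Longrightarrow> dist v u < d \<Longrightarrow> dist (G' v) (G' u) < e/4"
      using uniformly_continuous_onE[OF uc, of "e/4"] e by auto
    obtain d2 where d2: "d2 > 0" "ball z d2 \<subseteq> ?B"
      using z open_ball open_contains_ball by metis
    have main: "norm (\<Phi> t y - \<Phi> t z - blinfun_apply (Y0 z t) (y - z)) \<le> e * norm (y - z)"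
      if y: "norm (y - z) < min (d/2) d2" for y
    proof -
      have "y \<in> ball z d2" using y by (simp add: dist_norm norm_minus_commute)
      then have yB: "y \<in> ?B" using d2(2) by blast
      have "norm (\<Phi> t y - \<Phi> t z - blinfun_apply (Y0 z t) (y - z)) \<le> 2 * (e/2 * norm (y - z))"
      proof (rule half_absorb[OF _ _ t])
        show "continuous_on {0..1} (\<lambda>t. \<Phi> t y - \<Phi> t z - blinfun_apply (Y0 z t) (y - z))" by (intro continuous_intros c\<Phi> Y0 z)
        fix M and t :: real
        assume M: "\<And>s. s \<in> {0..1} \<Longrightarrow> norm (\<Phi> s y - \<Phi> s z - blinfun_apply (Y0 z s) (y - z)) \<le> M" and t: "t \<in> {0..1}"
        have c: "continuous_on {0..1} (\<lambda>s. G (\<Phi> s y))" "continuous_on {0..1} (\<lambda>s. G (\<Phi> s z))"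
          "continuous_on {0..1} (\<lambda>s. G' (\<Phi> s z) o\<^sub>L Y0 z s)" "continuous_on {0..1} (\<lambda>s. blinfun_apply (G' (\<Phi> s z) o\<^sub>L Y0 z s) (y - z))"
          by (intro continuous_intros cG'\<Phi> cG\<Phi> Y0 yB z)+
        note i = integrable_continuous_interval[OF continuous_on_subset]
        have ii: "(\<lambda>s. G (\<Phi> s y)) integrable_on {0..t}" "(\<lambda>s. G (\<Phi> s z)) integrable_on {0..t}"
          "(\<lambda>s. blinfun_apply (G' (\<Phi> s z) o\<^sub>L Y0 z s) (y - z)) integrable_on {0..t}"
          using t by (auto intro!: i[OF c(1)] i[OF c(2)] i[OF c(4)] simp del: blinfun_apply_blinfun_compose)
        have ib: "integral {0..t} (\<lambda>s. blinfun_apply (G' (\<Phi> s z) o\<^sub>L Y0 z s) (y - z)) = blinfun_apply (integral {0..t} (\<lambda>s. G' (\<Phi> s z) o\<^sub>L Y0 z s)) (y - z)"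
          using t by (intro blinfun_apply_integral[symmetric] i[OF c(3)]) auto
        have "\<Phi> t y - \<Phi> t z - blinfun_apply (Y0 z t) (y - z) = integral {0..t} (\<lambda>s. G (\<Phi> s y) - G (\<Phi> s z) - blinfun_apply (G' (\<Phi> s z) o\<^sub>L Y0 z s) (y - z))"
          unfolding \<Phi>[OF t yB] \<Phi>[OF t z] Y0(2)[OF z t] blinfun.add_left ib[symmetric] id_blinfun.rep_eq
          using integral_diff[OF integrable_diff[OF ii(1,2)] ii(3)] integral_diff[OF ii(1,2)] by simp
        also have "norm \<dots> \<le> e/2 * norm (y - z) + M/2"
        proof (rule norm_integral_le_unit[OF _ _ t])
          show "continuous_on {0..1} (\<lambda>s. G (\<Phi> s y) - G (\<Phi> s z) - blinfun_apply (G' (\<Phi> s z) o\<^sub>L Y0 z s) (y - z))" by (intro continuous_intros c)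
          fix s :: real assume s: "s \<in> {0..1}"
          let ?u = "\<Phi> s y" and ?v = "\<Phi> s z"
          have uv: "?u \<in> ?K" "?v \<in> ?K" using \<Phi>K[OF s] yB z by auto
          have near: "norm (?u - ?v) < d" using \<Phi>lip[OF s yB z] y by simp
          have seg: "closed_segment ?v ?u \<subseteq> ?K" using uv K(1) by (simp add: closed_segment_subset)
          have "norm (G ?u - G ?v - blinfun_apply (G' ?v) (?u - ?v)) \<le> norm (?u - ?v) * (e/4)"
          proof (rule differentiable_bound_linearization[of ?v ?u "closed_segment ?v ?u" G "\<lambda>x. blinfun_apply (G' x)" ?v "e/4"])
            show "?v + t *\<^sub>R (?u - ?v) \<in> closed_segment ?v ?u" if "t \<in> {0..1}" for t
              using that by (auto simp: in_segment algebra_simps intro!: exI[of _ t])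
            show "(G has_derivative blinfun_apply (G' x)) (at x within closed_segment ?v ?u)" if "x \<in> closed_segment ?v ?u" for x
              by (rule has_derivative_at_withinI[OF dG]) (use that seg in blast)
            show "onorm (blinfun_apply (G' x) - blinfun_apply (G' ?v)) \<le> e/4" if "x \<in> closed_segment ?v ?u" for x
            proof -
              have "dist (G' x) (G' ?v) < e/4"
                by (rule d(2)) (use uv seg that near dist_in_closed_segment[OF that] in \<open>auto simp: dist_norm norm_minus_commute\<close>)
              then show ?thesis by (simp add: dist_norm norm_blinfun.rep_eq minus_blinfun.rep_eq fun_diff_def)
            qed
          qed auto
          also have "\<dots> \<le> (2 * norm (y - z)) * (e/4)" using \<Phi>lip[OF s yB z] e by (intro mult_right_mono) auto
          finally have 1: "norm (G ?u - G ?v - blinfun_apply (G' ?v) (?u - ?v)) \<le> e/2 * norm (y - z)" by simp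
          have "norm (blinfun_apply (G' ?v) (?u - ?v - blinfun_apply (Y0 z s) (y - z))) \<le> norm (G' ?v) * norm (?u - ?v - blinfun_apply (Y0 z s) (y - z))"
            by (rule norm_blinfun)
          also have "\<dots> \<le> 1/2 * M" using nG'[OF uv(2)] M[OF s] by (intro mult_mono) auto
          finally have 2: "norm (blinfun_apply (G' ?v) (?u - ?v - blinfun_apply (Y0 z s) (y - z))) \<le> M/2" by simp
          have "G ?u - G ?v - blinfun_apply (G' ?v o\<^sub>L Y0 z s) (y - z) = (G ?u - G ?v - blinfun_apply (G' ?v) (?u - ?v)) + blinfun_apply (G' ?v) (?u - ?v - blinfun_apply (Y0 z s) (y - z))"
            by (simp add: blinfun.bilinear_simps)
          then show "norm (G ?u - G ?v - blinfun_apply (G' ?v o\<^sub>L Y0 z s) (y - z)) \<le> e/2 * norm (y - z) + M/2"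
            by (simp only:) (rule norm_triangle_le[OF add_mono[OF 1 2]])
        qed
        finally show "norm (\<Phi> t y - \<Phi> t z - blinfun_apply (Y0 z t) (y - z)) \<le> e/2 * norm (y - z) + M/2" .
      qed
      then show ?thesis by simp
    qed
    then show "\<exists>d>0. \<forall>y\<in>UNIV. norm (y - z) < d \<longrightarrow> norm (\<Phi> t y - \<Phi> t z - blinfun_apply (Y0 z t) (y - z)) \<le> e * norm (y - z)"
      using d(1) d2(1) by (intro exI[of _ "min (d/2) d2"]) auto
  qed
  \<comment> \<open>Continuity in time at each point, together with continuity in the point
    uniformly in time, gives joint continuity; it is applied to the flow and to its
    derivative.\<close>
  have joint: "continuous_on ({0..1::real} \<times> ?B) (\<lambda>(t,z). h t z)"
    if c1: "\<And>z. z \<in> ?B \<Longrightarrow> continuous_on {0..1::real} (\<lambda>t. h t z)"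
      and c2: "\<And>z e. z \<in> ?B \<Longrightarrow> e > 0 \<Longrightarrow> \<exists>d>0. \<forall>y\<in>?B. norm (y - z) < d \<longrightarrow> (\<forall>t\<in>{0..1}. norm (h t y - h t z) \<le> e)"
    for h :: "real \<Rightarrow> 'a \<Rightarrow> 'c::real_normed_vector"
    unfolding continuous_on_iff
  proof (intro ballI allI impI)
    fix p :: "real \<times> 'a" and e :: real assume p: "p \<in> {0..1} \<times> ?B" and e: "e > 0"
    obtain t z where tz: "p = (t, z)" by force
    with p have t: "t \<in> {0..1}" and z: "z \<in> ?B" by auto
    obtain d1 where d1: "d1 > 0" "\<And>s. s \<in> {0..1} \<Longrightarrow> dist s t < d1 \<Longrightarrow> dist (h s z) (h t z) < e/2"
      by (rule continuous_onE[OF c1[OF z] t half_gt_zero[OF e]]) (use less_imp_le in blast)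
    obtain d2 where d2: "d2 > 0" "\<And>y s. y\<in>?B \<Longrightarrow> norm (y - z) < d2 \<Longrightarrow> s \<in> {0..1} \<Longrightarrow> norm (h s y - h s z) \<le> e/2"
      using c2[OF z half_gt_zero[OF e]] by blast
    show "\<exists>d>0. \<forall>x'\<in>{0..1} \<times> ?B. dist x' p < d \<longrightarrow> dist (case x' of (t, z) \<Rightarrow> h t z) (case p of (t, z) \<Rightarrow> h t z) < e"
    proof (intro exI[of _ "min d1 d2"] conjI ballI impI)
      fix q assume q: "q \<in> {0..1} \<times> ?B" "dist q p < min d1 d2"
      obtain s y where sy: "q = (s, y)" by force
      have "dist s t < d1" "dist y z < d2"
        using q dist_fst_le[of q p] dist_snd_le[of q p] by (auto simp: sy tz)
      then have "dist (h s z) (h t z) < e/2" "dist (h s y) (h s z) \<le> e/2"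
        using d1(2)[of s] d2(2)[of y s] q(1) by (auto simp: sy dist_norm)
      then show "dist (case q of (t, z) \<Rightarrow> h t z) (case p of (t, z) \<Rightarrow> h t z) < e"
        using dist_triangle[of "h s y" "h t z" "h s z"] by (simp add: sy tz)
    qed (use d1 d2 in auto)
  qed
  show ?thesis
  proof (rule that[of \<Phi> "\<lambda>t z. Y0 z t"])
    show "\<Phi> 0 z = z" if "z \<in> ?B" for z using \<Phi>[of 0 z] that by simp
    show "((\<lambda>t. \<Phi> t z) has_vector_derivative G (\<Phi> t z)) (at t within {0..1})" if "t \<in> {0..1}" "z \<in> ?B" for t z
      by (rule integral_eq_imp_vderiv[OF \<Phi>[OF _ that(2)] cG\<Phi>[OF that(2)] that(1)])
    show "continuous_on ({0..1} \<times> ?B) (\<lambda>(t,z). \<Phi> t z)"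
    proof (rule joint)
      show "\<exists>d>0. \<forall>y\<in>?B. norm (y - z) < d \<longrightarrow> (\<forall>t\<in>{0..1}. norm (\<Phi> t y - \<Phi> t z) \<le> e)" if "z \<in> ?B" "e > 0" for z e
        using \<Phi>lip that by (intro exI[of _ "e/2"]) fastforce
    qed (rule c\<Phi>)
    show "continuous_on ({0..1} \<times> ?B) (\<lambda>(t,z). Y0 z t)"
      by (rule joint) (use Y0 cY in auto)
  qed (use \<Phi>d der in auto)
qed

section \<open>Calculus of smooth maps\<close>

lemma Ck_on_cong_imp:
  assumes "open S" "\<And>x. x \<in> S \<Longrightarrow> f x = g x" "Ck_on k S f"
  shows "Ck_on k S g"
  using assms(2,3)
proof (induction k arbitrary: f g)
  case 0
  then show ?case by (simp cong: continuous_on_cong)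
next
  case (Suc k)
  have d: "g differentiable (at x)" and e: "frechet_derivative g (at x) = frechet_derivative f (at x)" if "x \<in> S" for x
  proof -
    have f: "(f has_derivative frechet_derivative f (at x)) (at x)"
      using Suc.prems(2) that by (simp add: frechet_derivative_works)
    have "(g has_derivative frechet_derivative f (at x)) (at x)"
      by (rule has_derivative_transform_within_open[OF f assms(1) that Suc.prems(1)])
    then show "g differentiable (at x)" "frechet_derivative g (at x) = frechet_derivative f (at x)"
      by (auto simp: differentiable_def frechet_derivative_at[symmetric])
  qed
  have "Ck_on k S (\<lambda>x. frechet_derivative g (at x) v)" for v
    by (rule Suc.IH[of "\<lambda>x. frechet_derivative f (at x) v"]) (use e Suc.prems(2) in auto)
  with d show ?case by simp
qed

text \<open>Admits any convenient formula for the derivative in place of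
  \<open>frechet_derivative\<close>: on an open set the two agree, and with them all further
  derivatives.\<close>

lemma Ck_on_SucI:
  assumes "open S" "\<And>x. x \<in> S \<Longrightarrow> (f has_derivative f' x) (at x)" "\<And>v. Ck_on k S (\<lambda>x. f' x v)"
  shows "Ck_on (Suc k) S f"
proof -
  have "Ck_on k S (\<lambda>x. frechet_derivative f (at x) v)" for v
    by (rule Ck_on_cong_imp[OF assms(1) _ assms(3)[of v]]) (simp add: frechet_derivative_at[OF assms(2), symmetric])
  with assms(2) show ?thesis by (auto simp: differentiable_def)
qed

lemma Ck_on_subset: "Ck_on k S f \<Longrightarrow> T \<subseteq> S \<Longrightarrow> Ck_on k T f"
  by (induction k arbitrary: f) (auto intro: continuous_on_subset)

lemma Ck_on_has_derivative:
  "Ck_on (Suc k) S f \<Longrightarrow> x \<in> S \<Longrightarrow> (f has_derivative frechet_derivative f (at x)) (at x)"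
  by (simp add: frechet_derivative_works)

lemma Ck_on_SucD: "Ck_on (Suc k) S f \<Longrightarrow> Ck_on k S f"
proof (induction k arbitrary: f)
  case 0
  then show ?case
    by (auto intro!: continuous_at_imp_continuous_on differentiable_imp_continuous_within)
qed auto

lemma Ck_on_const: "Ck_on k S (\<lambda>x. c)"
proof (induction k arbitrary: c)
  case (Suc k)
  show ?case using Suc by simp
qed auto

lemma Ck_on_linear_comp:
  assumes "open S" "bounded_linear h" "Ck_on k S f" shows "Ck_on k S (\<lambda>x. h (f x))"
  using assms(3)
proof (induction k arbitrary: f)
  case 0
  then show ?case using bounded_linear.continuous_on[OF assms(2)] by auto
next
  case (Suc k)
  show ?case
    by (rule Ck_on_SucI[OF assms(1) bounded_linear.has_derivative[OF assms(2) Ck_on_has_derivative[OF Suc.prems]]])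
      (use Suc in auto)
qed

lemma Ck_on_ident: assumes "open S" shows "Ck_on k S (\<lambda>x. x)"
proof (cases k)
  case 0
  then show ?thesis by simp
next
  case (Suc m)
  have "Ck_on (Suc m) S (\<lambda>x. x)"
    by (rule Ck_on_SucI[OF assms, where f'="\<lambda>x v. v"]) (auto intro: Ck_on_const)
  then show ?thesis using Suc by simp
qed

lemma Ck_on_add:
  assumes "open S" "Ck_on k S f" "Ck_on k S g" shows "Ck_on k S (\<lambda>x. f x + g x)"
  using assms(2,3)
proof (induction k arbitrary: f g)
  case 0
  then show ?case by (auto intro: continuous_on_add)
next
  case (Suc k)
  show ?case
    by (rule Ck_on_SucI[OF assms(1) has_derivative_add[OF Ck_on_has_derivative[OF Suc.prems(1)] Ck_on_has_derivative[OF Suc.prems(2)]]])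
      (use Suc in auto)
qed

lemma Ck_on_bilinear:
  assumes "open S" "bounded_bilinear h" "Ck_on k S f" "Ck_on k S g"
  shows "Ck_on k S (\<lambda>x. h (f x) (g x))"
  using assms(3,4)
proof (induction k arbitrary: f g)
  case 0
  then show ?case using bounded_bilinear.continuous_on[OF assms(2)] by auto
next
  case (Suc k)
  have "Ck_on k S (\<lambda>x. h (f x) (frechet_derivative g (at x) v) + h (frechet_derivative f (at x) v) (g x))" for v
    using Suc.IH[of f "\<lambda>x. frechet_derivative g (at x) v"] Suc.IH[of "\<lambda>x. frechet_derivative f (at x) v" g]
      Suc.prems Ck_on_SucD[OF Suc.prems(1)] Ck_on_SucD[OF Suc.prems(2)]
    by (intro Ck_on_add[OF assms(1)]) auto
  then show ?case
    by (intro Ck_on_SucI[OF assms(1) bounded_bilinear.FDERIV[OF assms(2) Ck_on_has_derivative[OF Suc.prems(1)] Ck_on_has_derivative[OF Suc.prems(2)]]])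
qed

lemma Ck_on_sum:
  assumes "open S" "finite I" "\<And>i. i \<in> I \<Longrightarrow> Ck_on k S (f i)" shows "Ck_on k S (\<lambda>x. \<Sum>i\<in>I. f i x)"
  using assms(2,3)
  by (induction I rule: finite_induct) (auto intro: Ck_on_const Ck_on_add[OF assms(1)])

text \<open>The recursion speaks of derivatives in a fixed direction, whereas the chain rule
  evaluates the outer derivative in a moving one. Expanding the inner derivative in a basis of the
  intermediate Euclidean space leaves a finite sum of products with fixed directions, to which the
  induction applies.\<close>

lemma Ck_on_compose:
  fixes f :: "'a::real_normed_vector \<Rightarrow> 'b::euclidean_space" and g :: "'b \<Rightarrow> 'c::real_normed_vector"
  assumes "open S" "f ` S \<subseteq> T" "Ck_on k S f" "Ck_on k T g"
  shows "Ck_on k S (\<lambda>x. g (f x))"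
  using assms(3,4)
proof (induction k arbitrary: g)
  case 0
  then show ?case using assms(2) continuous_on_compose2[of T g S f] by simp
next
  case (Suc k)
  have "((\<lambda>x. g (f x)) has_derivative (\<lambda>v. \<Sum>b\<in>Basis. (frechet_derivative f (at x) v \<bullet> b) *\<^sub>R frechet_derivative g (at (f x)) b)) (at x)"
    if x: "x \<in> S" for x
  proof -
    have g: "(g has_derivative frechet_derivative g (at (f x))) (at (f x))"
      using Ck_on_has_derivative[OF Suc.prems(2)] assms(2) x by blast
    then have l: "linear (frechet_derivative g (at (f x)))" by (rule has_derivative_linear)
    have rep: "frechet_derivative g (at (f x)) w = (\<Sum>b\<in>Basis. (w \<bullet> b) *\<^sub>R frechet_derivative g (at (f x)) b)" for w
    proof -
      have "frechet_derivative g (at (f x)) (\<Sum>b\<in>Basis. (w \<bullet> b) *\<^sub>R b) = (\<Sum>b\<in>Basis. (w \<bullet> b) *\<^sub>R frechet_derivative g (at (f x)) b)"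
        by (simp add: linear_sum[OF l] linear_scale[OF l])
      then show ?thesis by (simp add: euclidean_representation)
    qed
    have "((\<lambda>x. g (f x)) has_derivative (\<lambda>v. frechet_derivative g (at (f x)) (frechet_derivative f (at x) v))) (at x)"
      by (rule has_derivative_compose[OF Ck_on_has_derivative[OF Suc.prems(1) x] g])
    then show ?thesis by (subst (asm) rep)
  qed
  moreover have "Ck_on k S (\<lambda>x. \<Sum>b\<in>Basis. (frechet_derivative f (at x) v \<bullet> b) *\<^sub>R frechet_derivative g (at (f x)) b)" for v
  proof (intro Ck_on_sum[OF assms(1)] Ck_on_bilinear[OF assms(1) bounded_bilinear_scaleR])
    fix b :: 'b
    show "Ck_on k S (\<lambda>x. frechet_derivative f (at x) v \<bullet> b)"
      by (rule Ck_on_linear_comp[OF assms(1) bounded_linear_inner_left]) (use Suc.prems(1) in simp)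
    show "Ck_on k S (\<lambda>x. frechet_derivative g (at (f x)) b)"
      using Suc.IH[of "\<lambda>y. frechet_derivative g (at y) b"] Suc.prems Ck_on_SucD by auto
  qed auto
  ultimately show ?case by (rule Ck_on_SucI[OF assms(1)])
qed

text \<open>The derivative is the square of the function itself times minus the derivative of
  \<open>f\<close>, so the induction closes on the function under study.\<close>

lemma Ck_on_inverse:
  fixes f :: "'a::real_normed_vector \<Rightarrow> real"
  assumes "open S" "\<And>x. x \<in> S \<Longrightarrow> f x \<noteq> 0" "Ck_on k S f" shows "Ck_on k S (\<lambda>x. inverse (f x))"
  using assms(3)
proof (induction k)
  case 0
  then show ?case using assms by (auto intro: continuous_on_inverse)
next
  case (Suc k)
  have "((\<lambda>x. inverse (f x)) has_derivative (\<lambda>v. (inverse (f x) * inverse (f x)) * (- frechet_derivative f (at x) v))) (at x)" if "x \<in> S" for x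
    using that Ck_on_has_derivative[OF Suc.prems that]
    by (auto intro!: derivative_eq_intros simp: assms(2))
  moreover have "Ck_on k S (\<lambda>x. (inverse (f x) * inverse (f x)) * (- frechet_derivative f (at x) v))" for v
    using Suc Ck_on_SucD[OF Suc.prems]
    by (intro Ck_on_bilinear[OF assms(1) bounded_bilinear_mult] Ck_on_linear_comp[OF assms(1) bounded_linear_minus[OF bounded_linear_ident]]) auto
  ultimately show ?case by (rule Ck_on_SucI[OF assms(1)])
qed

text \<open>Here the derivative is the cube of the function times a multiple of the derivative of
  \<open>f\<close>, and the induction closes again. This is the factor by which vectors are
  normalized.\<close>

lemma Ck_on_inverse_sqrt:
  fixes f :: "'a::real_normed_vector \<Rightarrow> real"
  assumes "open S" "\<And>x. x \<in> S \<Longrightarrow> f x > 0" "Ck_on k S f" shows "Ck_on k S (\<lambda>x. inverse (sqrt (f x)))"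
  using assms(3)
proof (induction k)
  case 0
  then show ?case using assms(2) by (auto intro!: continuous_intros) (metis less_irrefl)
next
  case (Suc k)
  have "((\<lambda>x. inverse (sqrt (f x))) has_derivative (\<lambda>v. (inverse (sqrt (f x)) * (inverse (sqrt (f x)) * inverse (sqrt (f x)))) * ((- 1/2) * frechet_derivative f (at x) v))) (at x)" if "x \<in> S" for x
    using that Ck_on_has_derivative[OF Suc.prems that] assms(2)[OF that]
    by (auto intro!: derivative_eq_intros simp: field_simps)
  moreover have "Ck_on k S (\<lambda>x. (inverse (sqrt (f x)) * (inverse (sqrt (f x)) * inverse (sqrt (f x)))) * ((- 1/2) * frechet_derivative f (at x) v))" for v
    using Suc Ck_on_SucD[OF Suc.prems]
    by (intro Ck_on_bilinear[OF assms(1) bounded_bilinear_mult] Ck_on_const) auto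
  ultimately show ?case by (rule Ck_on_SucI[OF assms(1)])
qed

lemma smooth_on_subset: "smooth_on S f \<Longrightarrow> T \<subseteq> S \<Longrightarrow> smooth_on T f"
  unfolding smooth_on_def using Ck_on_subset by blast

lemma smooth_on_const: "smooth_on S (\<lambda>x. c)"
  by (simp add: smooth_on_def Ck_on_const)

lemma smooth_on_ident: "open S \<Longrightarrow> smooth_on S (\<lambda>x. x)"
  by (simp add: smooth_on_def Ck_on_ident)

lemma smooth_on_linear_comp: "open S \<Longrightarrow> bounded_linear h \<Longrightarrow> smooth_on S f \<Longrightarrow> smooth_on S (\<lambda>x. h (f x))"
  by (simp add: smooth_on_def Ck_on_linear_comp)

lemma smooth_on_add: "open S \<Longrightarrow> smooth_on S f \<Longrightarrow> smooth_on S g \<Longrightarrow> smooth_on S (\<lambda>x. f x + g x)"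
  by (simp add: smooth_on_def Ck_on_add)

lemma smooth_on_diff: "open S \<Longrightarrow> smooth_on S f \<Longrightarrow> smooth_on S g \<Longrightarrow> smooth_on S (\<lambda>x. f x - g x)"
  using smooth_on_add[of S f "\<lambda>x. - g x"] smooth_on_linear_comp[of S uminus g] bounded_linear_minus[OF bounded_linear_ident]
  by auto

lemma smooth_on_bilinear:
  "open S \<Longrightarrow> bounded_bilinear h \<Longrightarrow> smooth_on S f \<Longrightarrow> smooth_on S g \<Longrightarrow> smooth_on S (\<lambda>x. h (f x) (g x))"
  by (simp add: smooth_on_def Ck_on_bilinear)

lemmas smooth_on_mult = smooth_on_bilinear[OF _ bounded_bilinear_mult]
lemmas smooth_on_scaleR = smooth_on_bilinear[OF _ bounded_bilinear_scaleR]
lemmas smooth_on_inner = smooth_on_bilinear[OF _ bounded_bilinear_inner]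

lemma smooth_on_sum:
  "open S \<Longrightarrow> finite I \<Longrightarrow> (\<And>i. i \<in> I \<Longrightarrow> smooth_on S (f i)) \<Longrightarrow> smooth_on S (\<lambda>x. \<Sum>i\<in>I. f i x)"
  by (simp add: smooth_on_def Ck_on_sum)

lemma smooth_on_compose:
  fixes f :: "'a::real_normed_vector \<Rightarrow> 'b::euclidean_space"
  shows "open S \<Longrightarrow> f ` S \<subseteq> T \<Longrightarrow> smooth_on S f \<Longrightarrow> smooth_on T g \<Longrightarrow> smooth_on S (\<lambda>x. g (f x))"
  by (simp add: smooth_on_def Ck_on_compose)

lemma smooth_on_inverse:
  fixes f :: "'a::real_normed_vector \<Rightarrow> real"
  shows "open S \<Longrightarrow> (\<And>x. x \<in> S \<Longrightarrow> f x \<noteq> 0) \<Longrightarrow> smooth_on S f \<Longrightarrow> smooth_on S (\<lambda>x. inverse (f x))"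
  by (simp add: smooth_on_def Ck_on_inverse)

lemma smooth_on_inverse_sqrt:
  fixes f :: "'a::real_normed_vector \<Rightarrow> real"
  shows "open S \<Longrightarrow> (\<And>x. x \<in> S \<Longrightarrow> f x > 0) \<Longrightarrow> smooth_on S f \<Longrightarrow> smooth_on S (\<lambda>x. inverse (sqrt (f x)))"
  by (simp add: smooth_on_def Ck_on_inverse_sqrt)

lemma smooth_on_Pair:
  assumes S: "open S" "smooth_on S f" "smooth_on S g" shows "smooth_on S (\<lambda>x. (f x, g x))"
proof -
  have "smooth_on S (\<lambda>x. (f x, 0) + (0, g x))"
    by (intro smooth_on_add S(1) smooth_on_linear_comp[OF S(1) _ S(2), of "\<lambda>y. (y, 0)"]
        smooth_on_linear_comp[OF S(1) _ S(3), of "\<lambda>y. (0, y)"] bounded_linear_Pair bounded_linear_ident bounded_linear_zero)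
  then show ?thesis by simp
qed

lemma smooth_on_frechet_derivative: "smooth_on S f \<Longrightarrow> smooth_on S (\<lambda>x. frechet_derivative f (at x) v)"
  unfolding smooth_on_def by (metis Ck_on.simps(2))

lemma smooth_on_has_derivative:
  "smooth_on S f \<Longrightarrow> x \<in> S \<Longrightarrow> (f has_derivative frechet_derivative f (at x)) (at x)"
  unfolding smooth_on_def by (metis Ck_on_has_derivative)

lemma smooth_on_continuous: "smooth_on S f \<Longrightarrow> continuous_on S f"
  unfolding smooth_on_def by (metis Ck_on.simps(1))

text \<open>Passes from directional derivatives to a continuous operator-valued derivative, the form
  that the flow and the inverse function theorem work with; finitely many directions determine the
  operator.\<close>

lemma smooth_on_C1:
  fixes f :: "'a::euclidean_space \<Rightarrow> 'b::real_normed_vector"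
  assumes "smooth_on S f"
  obtains f' :: "'a \<Rightarrow> 'a \<Rightarrow>\<^sub>L 'b" where "continuous_on S f'"
    "\<And>x. x \<in> S \<Longrightarrow> blinfun_apply (f' x) = frechet_derivative f (at x)"
    "\<And>x. x \<in> S \<Longrightarrow> (f has_derivative blinfun_apply (f' x)) (at x)"
proof -
  define f' where "f' = (\<lambda>x. Blinfun (frechet_derivative f (at x)))"
  have ap: "blinfun_apply (f' x) = frechet_derivative f (at x)" if "x \<in> S" for x
    unfolding f'_def
    by (rule bounded_linear_Blinfun_apply[OF has_derivative_bounded_linear[OF smooth_on_has_derivative[OF assms that]]])
  have "continuous_on S f'"
  proof (rule continuous_on_blinfun_componentwise)
    fix i :: 'a
    have "continuous_on S (\<lambda>x. frechet_derivative f (at x) i)"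
      by (rule smooth_on_continuous[OF smooth_on_frechet_derivative[OF assms]])
    then show "continuous_on S (\<lambda>x. blinfun_apply (f' x) i)"
      by (rule continuous_on_eq) (simp add: ap)
  qed
  then show ?thesis by (rule that) (use ap smooth_on_has_derivative[OF assms] in auto)
qed

section \<open>Geodesics of a parametrized surface\<close>

lemma bounded_bilinear_cross3: "bounded_bilinear cross3"
  using bilinear_cross bilinear_conv_bounded_bilinear by blast

text \<open>By Lagrange's identity \<open>n \<times> (a \<times> b)\<close> vanishes, as
  \<open>a\<close> and \<open>b\<close> are orthogonal to \<open>n\<close>; a second product with
  the unit vector \<open>n\<close> isolates the part of \<open>a \<times> b\<close> orthogonal to
  \<open>n\<close>, which is therefore zero.\<close>

lemma cross3_parallel:
  fixes n a b :: "real^3"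
  assumes "n \<bullet> n = 1" "a \<bullet> n = 0" "b \<bullet> n = 0"
  shows "cross3 a b = (cross3 a b \<bullet> n) *\<^sub>R n"
proof -
  have "cross3 n (cross3 a b) = 0" using assms by (simp add: Lagrange inner_commute)
  then have "cross3 n (cross3 n (cross3 a b)) = 0" by simp
  then show ?thesis using assms(1) unfolding Lagrange[of n n "cross3 a b"] by (simp add: inner_commute)
qed

text \<open>\<open>T\<close> and \<open>W\<close> stand for velocity and acceleration of a geodesic,
  \<open>Y\<close>, \<open>S\<close> and \<open>V\<close> for the variations of position, velocity
  and acceleration, \<open>nt\<close> and \<open>nh\<close> for the derivatives of the normal
  \<open>n\<close> in time and in the direction of the variation. The conclusions evaluate the time
  derivatives of \<open>Y \<bullet> (n \<times> T)\<close> and of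
  \<open>S \<bullet> (n \<times> T)\<close>; together they are the Jacobi equation.\<close>

lemma jacobi_algebra:
  fixes n T Y S W V nt nh :: "real^3"
  assumes "T \<bullet> n = 0" "Y \<bullet> n = 0" and nn: "n \<bullet> n = 1" and W: "W = (W \<bullet> n) *\<^sub>R n"
    and V: "V \<bullet> cross3 n T = - (W \<bullet> cross3 nh T)" and S: "S \<bullet> n = - (T \<bullet> nh)" and Wn: "W \<bullet> n = - (T \<bullet> nt)"
    and "nt \<bullet> n = 0" "nh \<bullet> n = 0" and K: "cross3 nt nh = K *\<^sub>R cross3 T Y"
  shows "S \<bullet> cross3 n T + Y \<bullet> (cross3 nt T + cross3 n W) = S \<bullet> cross3 n T"
    and "V \<bullet> cross3 n T + S \<bullet> (cross3 nt T + cross3 n W) = - ((T \<bullet> T) * K * (Y \<bullet> cross3 n T))"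
proof -
  have nW: "cross3 n W = 0" by (subst W) (simp add: cross_mult_right)
  define c where "c = cross3 nt T \<bullet> n"
  have ntT: "cross3 nt T = c *\<^sub>R n" unfolding c_def by (rule cross3_parallel) (use assms in auto)
  show "S \<bullet> cross3 n T + Y \<bullet> (cross3 nt T + cross3 n W) = S \<bullet> cross3 n T"
    using assms(2) by (simp add: nW ntT)
  define j where "j = Y \<bullet> cross3 n T"
  have "cross3 T Y = (cross3 T Y \<bullet> n) *\<^sub>R n" by (rule cross3_parallel) (use assms in auto)
  moreover have "cross3 T Y \<bullet> n = j" unfolding j_def by (simp add: cross3_simps)
  ultimately have TY: "cross3 T Y = j *\<^sub>R n" by simp
  have 1: "V \<bullet> cross3 n T = (T \<bullet> nt) * (n \<bullet> cross3 nh T)"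
    unfolding V by (subst W) (simp add: Wn)
  have 2: "S \<bullet> (cross3 nt T + cross3 n W) = - ((n \<bullet> cross3 nt T) * (T \<bullet> nh))"
    by (simp add: nW ntT S nn)
  have "V \<bullet> cross3 n T + S \<bullet> (cross3 nt T + cross3 n W) = n \<bullet> cross3 ((T \<bullet> nt) *\<^sub>R nh - (T \<bullet> nh) *\<^sub>R nt) T"
    unfolding 1 2 by (simp add: Cross3.left_diff_distrib cross_mult_left inner_diff_right)
  \<comment> \<open>Lagrange's identity gathers \<open>nt\<close> and \<open>nh\<close> into their
    cross product, through which the curvature enters.\<close>
  also have "(T \<bullet> nt) *\<^sub>R nh - (T \<bullet> nh) *\<^sub>R nt = cross3 T (cross3 nh nt)" by (simp add: Lagrange)
  also have "cross3 nh nt = - (K * j) *\<^sub>R n" using K TY cross_skew[of nh nt] by simp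
  also have "cross3 (cross3 T (- (K * j) *\<^sub>R n)) T = - (K * j) *\<^sub>R (- cross3 T (cross3 T n))"
    using cross_skew[of "cross3 T n" T] by (simp add: cross_mult_right cross_mult_left)
  also have "\<dots> = - (K * j * (T \<bullet> T)) *\<^sub>R n" by (simp add: Lagrange assms(1))
  finally show "V \<bullet> cross3 n T + S \<bullet> (cross3 nt T + cross3 n W) = - ((T \<bullet> T) * K * (Y \<bullet> cross3 n T))"
    by (simp add: nn j_def)
qed

text \<open>The integral equation that recovers \<open>\<alpha>\<close> from \<open>\<beta>\<close>
  is differentiated under the integral sign; the result is an integral equation for
  \<open>\<alpha>v\<close>, which can be differentiated in time. First derivatives in
  \<open>v\<close> suffice for this.\<close>

lemma mixed_partial:
  fixes \<alpha> \<beta> :: "real \<Rightarrow> 'a::euclidean_space \<Rightarrow> 'c::euclidean_space" and \<alpha>v \<beta>v :: "real \<Rightarrow> 'a \<Rightarrow> 'a \<Rightarrow>\<^sub>L 'c"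
  assumes B: "open B" "convex B" and v: "v \<in> B" and t: "t \<in> {0..1}"
    and dt: "\<And>t v. t \<in> {0..1} \<Longrightarrow> v \<in> B \<Longrightarrow> ((\<lambda>t. \<alpha> t v) has_vector_derivative \<beta> t v) (at t within {0..1})"
    and a: "\<And>t v. t \<in> {0..1} \<Longrightarrow> v \<in> B \<Longrightarrow> (\<alpha> t has_derivative blinfun_apply (\<alpha>v t v)) (at v)"
    and b: "\<And>t v. t \<in> {0..1} \<Longrightarrow> v \<in> B \<Longrightarrow> (\<beta> t has_derivative blinfun_apply (\<beta>v t v)) (at v)"
    and c: "continuous_on ({0..1} \<times> B) (\<lambda>(t,v). \<beta> t v)" and cv: "continuous_on ({0..1} \<times> B) (\<lambda>(t,v). \<beta>v t v)"
  shows "((\<lambda>t. blinfun_apply (\<alpha>v t v) h) has_vector_derivative blinfun_apply (\<beta>v t v) h) (at t within {0..1})"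
proof -
  have cb: "continuous_on {0..1} (\<lambda>s. \<beta> s v)" if "v \<in> B" for v
  proof -
    have "continuous_on {0..1} (\<lambda>s. (\<lambda>(t,v). \<beta> t v) (s, v))"
      by (rule continuous_on_compose2[OF c]) (use that in \<open>auto intro!: continuous_intros\<close>)
    then show ?thesis by simp
  qed
  have cbv: "continuous_on {0..1} (\<lambda>s. \<beta>v s v)"
  proof -
    have "continuous_on {0..1} (\<lambda>s. (\<lambda>(t,v). \<beta>v t v) (s, v))"
      by (rule continuous_on_compose2[OF cv]) (use v in \<open>auto intro!: continuous_intros\<close>)
    then show ?thesis by simp
  qed
  have eq: "\<alpha>v s v = \<alpha>v 0 v + integral {0..s} (\<lambda>s. \<beta>v s v)" if s: "s \<in> {0..1}" for s
  proof -
    have "((\<lambda>v. integral (cbox 0 s) (\<lambda>t. \<beta> t v)) has_derivative blinfun_apply (integral (cbox 0 s) (\<lambda>s. \<beta>v s v))) (at v within B)"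
    proof (rule leibniz_rule[OF _ _ _ v B(2)])
      show "((\<lambda>v. \<beta> t v) has_derivative blinfun_apply (\<beta>v t x)) (at x within B)" if "x \<in> B" "t \<in> cbox 0 s" for x t
        by (rule has_derivative_at_withinI[OF b]) (use that s in auto)
      show "(\<lambda>t. \<beta> t x) integrable_on cbox 0 s" if "x \<in> B" for x
        using s by (auto intro!: integrable_continuous_interval continuous_on_subset[OF cb[OF that]])
      show "continuous_on (B \<times> cbox 0 s) (\<lambda>(x, t). \<beta>v t x)"
      proof -
        have "continuous_on (B \<times> cbox 0 s) (\<lambda>q. (\<lambda>(t,v). \<beta>v t v) (snd q, fst q))"
          by (rule continuous_on_compose2[OF cv]) (use s in \<open>auto intro!: continuous_intros\<close>)
        then show ?thesis by (simp add: case_prod_unfold)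
      qed
    qed
    then have "((\<lambda>v. integral {0..s} (\<lambda>t. \<beta> t v)) has_derivative blinfun_apply (integral {0..s} (\<lambda>s. \<beta>v s v))) (at v)"
      using at_within_open[OF v B(1)] by simp
    then have "((\<lambda>v. \<alpha> 0 v + integral {0..s} (\<lambda>t. \<beta> t v)) has_derivative (\<lambda>h. blinfun_apply (\<alpha>v 0 v) h + blinfun_apply (integral {0..s} (\<lambda>s. \<beta>v s v)) h)) (at v)"
      by (intro has_derivative_add a) (use v in auto)
    then have "(\<alpha> s has_derivative (\<lambda>h. blinfun_apply (\<alpha>v 0 v) h + blinfun_apply (integral {0..s} (\<lambda>s. \<beta>v s v)) h)) (at v)"
      by (rule has_derivative_transform_within_open[OF _ B(1) v]) (rule vderiv_imp_integral_eq[OF dt s, symmetric])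
    from has_derivative_unique[OF this a[OF s v]] show ?thesis
      by (intro blinfun_eqI) (simp add: blinfun.bilinear_simps fun_eq_iff)
  qed
  have "((\<lambda>t. \<alpha>v t v) has_vector_derivative \<beta>v t v) (at t within {0..1})"
    by (rule integral_eq_imp_vderiv[OF eq cbv t])
  then show ?thesis
    by (rule bounded_linear.has_vector_derivative[OF blinfun.bounded_linear_left])
qed

lemma has_vector_derivative_compose:
  assumes "(c has_vector_derivative c') (at t within S)" "(h has_derivative h') (at (c t))"
  shows "((\<lambda>t. h (c t)) has_vector_derivative h' c') (at t within S)"
proof -
  have "((\<lambda>t. h (c t)) has_derivative (\<lambda>s. h' (s *\<^sub>R c'))) (at t within S)"
    by (rule has_derivative_compose[OF assms(1)[unfolded has_vector_derivative_def] assms(2)])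
  then show ?thesis unfolding has_vector_derivative_def
    by (simp add: linear_scale[OF has_derivative_linear[OF assms(2)]])
qed

lemma unit_derivative_orth:
  assumes "open D" "x \<in> D" "\<And>y. y \<in> D \<Longrightarrow> n y \<bullet> n y = 1" "(n has_derivative n') (at x)"
  shows "n' v \<bullet> n x = 0"
proof -
  have "((\<lambda>y. n y \<bullet> n y) has_derivative (\<lambda>h. n x \<bullet> n' h + n' h \<bullet> n x)) (at x)"
    by (rule has_derivative_inner[OF assms(4,4)])
  moreover have "((\<lambda>y. n y \<bullet> n y) has_derivative (\<lambda>h. 0)) (at x)"
    by (rule has_derivative_transform_within_open[OF has_derivative_const[of 1] assms(1,2)]) (simp add: assms(3))
  ultimately have "(\<lambda>h. n x \<bullet> n' h + n' h \<bullet> n x) = (\<lambda>h. 0)" by (rule has_derivative_unique)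
  from fun_cong[OF this, of v] show ?thesis by (simp add: inner_commute)
qed

lemma linear_real2:
  fixes f :: "real^2 \<Rightarrow> 'b::real_vector"
  assumes "linear f" shows "f v = (v$1) *\<^sub>R f (axis 1 1) + (v$2) *\<^sub>R f (axis 2 1)"
proof -
  have "v = (v$1) *\<^sub>R axis 1 1 + (v$2) *\<^sub>R axis 2 1"
    by (simp add: vec_eq_iff forall_2 axis_def)
  then have "f v = f ((v$1) *\<^sub>R axis 1 1 + (v$2) *\<^sub>R axis 2 1)" by simp
  then show ?thesis by (simp add: linear_add[OF assms] linear_scale[OF assms])
qed

lemma cross3_linear_image:
  fixes l :: "real^2 \<Rightarrow> real^3"
  assumes "linear l"
  shows "cross3 (l u) (l v) = (u$1 * v$2 - u$2 * v$1) *\<^sub>R cross3 (l (axis 1 1)) (l (axis 2 1))"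
  by (subst linear_real2[OF assms, of u], subst linear_real2[OF assms, of v]) (simp add: cross3_simps)

section \<open>First fundamental form, unit normal and geodesic field of a parametrization\<close>

locale param_surface =
  fixes F :: "real^2 \<Rightarrow> real^3" and D :: "(real^2) set"
  assumes openD: "open D" and smF: "smooth_on D F"
    and injF: "\<And>x. x \<in> D \<Longrightarrow> inj (frechet_derivative F (at x))"
begin

text \<open>A state \<open>z = (x, p)\<close> consists of a parameter point and a velocity. There \<open>acc z\<close> is the second
  derivative \<open>D\<^sup>2F(x)(p, p)\<close>, and \<open>Gam z\<close> solves, by Cramer's rule, for the coefficients \<open>\<Gamma>(x)(p, p)\<close> of its
  tangential part, so that the geodesic equation reads \<open>x' = p\<close>, \<open>p' = - Gam (x, p)\<close>.\<close>

definition "F1 x = frechet_derivative F (at x) (axis 1 1)"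
definition "F2 x = frechet_derivative F (at x) (axis 2 1)"
definition "DF x (v :: real^2) = (v$1) *\<^sub>R F1 x + (v$2) *\<^sub>R F2 x"
text \<open>The determinant of the first fundamental form.\<close>

definition "gdet x = (F1 x \<bullet> F1 x) * (F2 x \<bullet> F2 x) - (F1 x \<bullet> F2 x) * (F1 x \<bullet> F2 x)"
definition "nrm x = inverse (sqrt (gdet x)) *\<^sub>R cross3 (F1 x) (F2 x)"
definition "acc (z :: (real^2) \<times> (real^2)) = (snd z $ 1) *\<^sub>R ((snd z $ 1) *\<^sub>R frechet_derivative F1 (at (fst z)) (axis 1 1) + (snd z $ 2) *\<^sub>R frechet_derivative F1 (at (fst z)) (axis 2 1))
   + (snd z $ 2) *\<^sub>R ((snd z $ 1) *\<^sub>R frechet_derivative F2 (at (fst z)) (axis 1 1) + (snd z $ 2) *\<^sub>R frechet_derivative F2 (at (fst z)) (axis 2 1))"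
definition "Gam (z :: (real^2) \<times> (real^2)) = (inverse (gdet (fst z)) * ((F2 (fst z) \<bullet> F2 (fst z)) * (acc z \<bullet> F1 (fst z)) - (F1 (fst z) \<bullet> F2 (fst z)) * (acc z \<bullet> F2 (fst z)))) *\<^sub>R (axis 1 1 :: real^2)
   + (inverse (gdet (fst z)) * ((F1 (fst z) \<bullet> F1 (fst z)) * (acc z \<bullet> F2 (fst z)) - (F1 (fst z) \<bullet> F2 (fst z)) * (acc z \<bullet> F1 (fst z)))) *\<^sub>R (axis 2 1 :: real^2)"

lemma DF: "x \<in> D \<Longrightarrow> frechet_derivative F (at x) = DF x"
  unfolding DF_def F1_def F2_def
  by (intro ext linear_real2 has_derivative_linear[OF smooth_on_has_derivative[OF smF]])

lemma F_has_derivative: "x \<in> D \<Longrightarrow> (F has_derivative DF x) (at x)"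
  using smooth_on_has_derivative[OF smF] DF by metis

lemma linear_DF: "x \<in> D \<Longrightarrow> linear (DF x)"
  using F_has_derivative has_derivative_linear by blast

lemma DF_axis: "DF x (axis 1 1) = F1 x" "DF x (axis 2 1) = F2 x"
  by (simp_all add: DF_def axis_def)

lemma DF_eq_0: "x \<in> D \<Longrightarrow> DF x v = 0 \<Longrightarrow> v = 0"
  using injF[of x] DF linear_DF linear_injective_0 by metis

lemma smooth_F12: "smooth_on D F1" "smooth_on D F2"
  using smooth_on_frechet_derivative[OF smF] by (simp_all add: F1_def[abs_def] F2_def[abs_def])

lemma gdet_eq: "gdet x = cross3 (F1 x) (F2 x) \<bullet> cross3 (F1 x) (F2 x)"
  using norm_cross_dot[of "F1 x" "F2 x"] unfolding gdet_def dot_square_norm power_mult_distrib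
  by (simp add: power2_eq_square)

lemma gdet_pos: assumes "x \<in> D" shows "gdet x > 0"
proof (rule ccontr)
  assume "\<not> gdet x > 0"
  then have g: "gdet x = 0" using gdet_eq[of x] inner_ge_zero[of "cross3 (F1 x) (F2 x)"] by simp
  \<comment> \<open>\<open>DF x ?v\<close> is the part of \<open>F1 x\<close> orthogonal to
    \<open>F2 x\<close>, scaled by \<open>F2 x \<bullet> F2 x\<close>; its square is that scale
    times \<open>gdet x\<close>.\<close>
  let ?v = "vector [F2 x \<bullet> F2 x, - (F1 x \<bullet> F2 x)] :: real^2"
  have "DF x ?v \<bullet> DF x ?v = (F2 x \<bullet> F2 x) * gdet x"
    unfolding DF_def gdet_def by (simp add: inner_add_left inner_add_right inner_commute[of "F2 x" "F1 x"] algebra_simps)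
  then have "DF x ?v = 0" using g by simp
  then have "?v = 0" by (rule DF_eq_0[OF assms])
  then have "?v $ 1 = 0" by simp
  then have "F2 x = 0" by simp
  then have "DF x (axis 2 1) = 0" by (simp add: DF_axis)
  then have "axis 2 1 = (0 :: real^2)" by (rule DF_eq_0[OF assms])
  then show False by simp
qed

lemma nrm_simps:
  assumes "x \<in> D" shows "nrm x \<bullet> nrm x = 1" "DF x v \<bullet> nrm x = 0" "nrm x \<bullet> DF x v = 0"
proof -
  show "nrm x \<bullet> nrm x = 1"
    using gdet_pos[OF assms] by (simp add: nrm_def gdet_eq[symmetric] field_simps)
  show "DF x v \<bullet> nrm x = 0" "nrm x \<bullet> DF x v = 0"
    by (simp_all add: nrm_def DF_def inner_add_left inner_add_right dot_cross_self inner_commute)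
qed

text \<open>For \<open>w\<close> orthogonal to the unnormalized normal \<open>m\<close>, two cross
  products with \<open>m\<close> return \<open>- (m \<bullet> m) w\<close>, while Lagrange's
  identity expands the same vector in \<open>F1\<close> and \<open>F2\<close>. The coefficients so
  found are those of Cramer's rule.\<close>

lemma orth_nrm_imp_DF: assumes "x \<in> D" "w \<bullet> nrm x = 0" obtains v where "w = DF x v"
proof -
  let ?m = "cross3 (F1 x) (F2 x)"
  have wm: "w \<bullet> ?m = 0" using assms gdet_pos[OF assms(1)] by (simp add: nrm_def)
  have "gdet x *\<^sub>R w = (?m \<bullet> ?m) *\<^sub>R w - (w \<bullet> ?m) *\<^sub>R ?m" by (simp add: wm gdet_eq)
  also have "\<dots> = - cross3 ?m (cross3 ?m w)" by (simp add: Lagrange inner_commute)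
  also have "cross3 ?m w = (w \<bullet> F1 x) *\<^sub>R F2 x - (w \<bullet> F2 x) *\<^sub>R F1 x"
    using cross_skew[of ?m w] by (simp add: Lagrange)
  also have "cross3 ?m \<dots> = (w \<bullet> F1 x) *\<^sub>R cross3 ?m (F2 x) - (w \<bullet> F2 x) *\<^sub>R cross3 ?m (F1 x)"
    by (simp add: Cross3.right_diff_distrib cross_mult_right)
  also have "cross3 ?m (F2 x) = (F1 x \<bullet> F2 x) *\<^sub>R F2 x - (F2 x \<bullet> F2 x) *\<^sub>R F1 x"
    using cross_skew[of ?m "F2 x"] by (simp add: Lagrange inner_commute)
  also have "cross3 ?m (F1 x) = (F1 x \<bullet> F1 x) *\<^sub>R F2 x - (F1 x \<bullet> F2 x) *\<^sub>R F1 x"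
    using cross_skew[of ?m "F1 x"] by (simp add: Lagrange inner_commute)
  finally have ab: "gdet x *\<^sub>R w = - ((w \<bullet> F1 x) *\<^sub>R ((F1 x \<bullet> F2 x) *\<^sub>R F2 x - (F2 x \<bullet> F2 x) *\<^sub>R F1 x)
    - (w \<bullet> F2 x) *\<^sub>R ((F1 x \<bullet> F1 x) *\<^sub>R F2 x - (F1 x \<bullet> F2 x) *\<^sub>R F1 x))" .
  have "w = inverse (gdet x) *\<^sub>R (gdet x *\<^sub>R w)" using gdet_pos[OF assms(1)] by simp
  also have "\<dots> = DF x (vector [inverse (gdet x) * ((w \<bullet> F1 x) * (F2 x \<bullet> F2 x) - (w \<bullet> F2 x) * (F1 x \<bullet> F2 x)),
      inverse (gdet x) * ((w \<bullet> F2 x) * (F1 x \<bullet> F1 x) - (w \<bullet> F1 x) * (F1 x \<bullet> F2 x))])"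
    unfolding ab by (simp add: DF_def algebra_simps)
  finally show ?thesis by (rule that)
qed

lemma smooth_gdet: "smooth_on D gdet"
  unfolding gdet_def[abs_def]
  by (intro smooth_on_diff[OF openD] smooth_on_mult[OF openD] smooth_on_inner[OF openD] smooth_F12)

lemma smooth_nrm: "smooth_on D nrm"
  unfolding nrm_def[abs_def]
  by (intro smooth_on_scaleR[OF openD] smooth_on_inverse_sqrt[OF openD] smooth_on_bilinear[OF openD bounded_bilinear_cross3]
      smooth_F12 gdet_pos smooth_gdet)

lemma open_state: "open (D \<times> (UNIV :: (real^2) set))" using openD by (simp add: open_Times)

lemma smooth_fst: "smooth_on D f \<Longrightarrow> smooth_on (D \<times> (UNIV :: (real^2) set)) (\<lambda>z. f (fst z))"
  by (rule smooth_on_compose[OF open_state, of fst D])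
    (auto intro: smooth_on_linear_comp[OF open_state bounded_linear_fst smooth_on_ident[OF open_state]])

lemma smooth_snd: "smooth_on (D \<times> (UNIV :: (real^2) set)) (\<lambda>z. snd z $ i)"
  by (rule smooth_on_linear_comp[OF open_state bounded_linear_vec_nth])
    (rule smooth_on_linear_comp[OF open_state bounded_linear_snd smooth_on_ident[OF open_state]])

lemma smooth_acc: "smooth_on (D \<times> UNIV) acc"
  unfolding acc_def[abs_def]
  by (intro smooth_on_add[OF open_state] smooth_on_scaleR[OF open_state] smooth_snd
     smooth_fst[of "\<lambda>x. frechet_derivative F1 (at x) v" for v] smooth_fst[of "\<lambda>x. frechet_derivative F2 (at x) v" for v]
     smooth_on_frechet_derivative smooth_F12)

lemma smooth_Gam: "smooth_on (D \<times> UNIV) Gam"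
  unfolding Gam_def[abs_def]
  by (intro smooth_on_add[OF open_state] smooth_on_diff[OF open_state] smooth_on_mult[OF open_state] smooth_on_scaleR[OF open_state] smooth_on_inner[OF open_state] smooth_on_const smooth_acc
    smooth_fst smooth_F12 smooth_on_inverse[OF openD] smooth_gdet) (simp_all add: less_imp_neq[OF gdet_pos, symmetric])

lemma smooth_vel: "smooth_on (D \<times> UNIV) (\<lambda>z. DF (fst z) (snd z))"
  unfolding DF_def by (intro smooth_on_add[OF open_state] smooth_on_scaleR[OF open_state] smooth_snd smooth_fst smooth_F12)

text \<open>The part of D^2F(p, p) normal to the surface: along a geodesic this is the full
  acceleration of the curve in space.\<close>

definition "nacc z = acc z - DF (fst z) (Gam z)"

lemma smooth_nacc: "smooth_on (D \<times> UNIV) nacc"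
  unfolding nacc_def[abs_def] DF_def
  by (intro smooth_on_add[OF open_state] smooth_on_diff[OF open_state] smooth_on_scaleR[OF open_state] smooth_fst smooth_F12 smooth_acc
     smooth_on_linear_comp[OF open_state bounded_linear_vec_nth smooth_Gam])

lemma nacc_orth: assumes "fst z \<in> D" shows "nacc z \<bullet> DF (fst z) v = 0"
proof -
  let ?a = "acc z \<bullet> F1 (fst z)" and ?b = "acc z \<bullet> F2 (fst z)" and ?i = "inverse (gdet (fst z))"
  let ?E = "F1 (fst z) \<bullet> F1 (fst z)" and ?F = "F1 (fst z) \<bullet> F2 (fst z)" and ?G = "F2 (fst z) \<bullet> F2 (fst z)"
  have i: "?i * (?E * ?G - ?F * ?F) = 1" using gdet_pos[OF assms] by (simp add: gdet_def)
  have 1: "Gam z $ 1 = ?i * (?G * ?a - ?F * ?b)" "Gam z $ 2 = ?i * (?E * ?b - ?F * ?a)"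
    by (simp_all add: Gam_def axis_def)
  have "nacc z \<bullet> F1 (fst z) = ?a - (?i * (?E * ?G - ?F * ?F)) * ?a"
    unfolding nacc_def DF_def 1 by (simp add: inner_diff_left inner_add_left inner_commute[of "F2 (fst z)" "F1 (fst z)"] algebra_simps)
  moreover have "nacc z \<bullet> F2 (fst z) = ?b - (?i * (?E * ?G - ?F * ?F)) * ?b"
    unfolding nacc_def DF_def 1 by (simp add: inner_diff_left inner_add_left inner_commute[of "F2 (fst z)" "F1 (fst z)"] algebra_simps)
  ultimately show ?thesis unfolding i by (simp add: DF_def inner_add_right)
qed

lemma orth_DF_imp_nrm:
  assumes "x \<in> D" "\<And>v. w \<bullet> DF x v = 0" shows "w = (w \<bullet> nrm x) *\<^sub>R nrm x"
proof -
  let ?w = "w - (w \<bullet> nrm x) *\<^sub>R nrm x"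
  have "?w \<bullet> nrm x = 0" using nrm_simps(1)[OF assms(1)] by (simp add: inner_diff_left)
  then obtain v where v: "?w = DF x v" using orth_nrm_imp_DF[OF assms(1)] by blast
  have "?w \<bullet> ?w = ?w \<bullet> DF x v" using v by simp
  also have "\<dots> = 0" using assms(2) nrm_simps[OF assms(1)] by (simp add: inner_diff_left)
  finally show ?thesis by simp
qed

lemma nacc_normal: "fst z \<in> D \<Longrightarrow> nacc z = (nacc z \<bullet> nrm (fst z)) *\<^sub>R nrm (fst z)"
  by (rule orth_DF_imp_nrm[OF _ nacc_orth])

lemma acc_scale: "acc (x, e *\<^sub>R q) = e\<^sup>2 *\<^sub>R acc (x, q)"
  by (simp add: acc_def algebra_simps power2_eq_square)

text \<open>Quadratic homogeneity in the velocity: a geodesic traversed at another constant speed is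
  again a geodesic, so the unit time of the flow can stand for any time scale.\<close>

lemma Gam_scale: "Gam (x, e *\<^sub>R q) = e\<^sup>2 *\<^sub>R Gam (x, q)"
  by (simp add: Gam_def acc_scale algebra_simps)

text \<open>At zero velocity the geodesic field vanishes, so \<open>(x0, 0)\<close> is an
  equilibrium. Multiplying the field by a small \<open>e\<close> brings its derivative below 1/2
  nearby; by quadratic homogeneity, rescaling the velocity component by \<open>e\<close> turns the
  orbits of the slowed field back into geodesics.\<close>

lemma geodesics:
  fixes A :: "real^2 \<Rightarrow> real^2"
  assumes x0: "x0 \<in> D" and A: "linear A"
  obtains \<delta> C and z :: "real \<Rightarrow> real^2 \<Rightarrow> (real^2) \<times> (real^2)" and zv :: "real \<Rightarrow> real^2 \<Rightarrow> ((real^2) \<Rightarrow>\<^sub>L ((real^2) \<times> (real^2)))" where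
    "\<delta> > 0" "\<And>v. v \<in> ball 0 \<delta> \<Longrightarrow> z 0 v = (x0, A v)"
    "\<And>t v. t \<in> {0..1} \<Longrightarrow> v \<in> ball 0 \<delta> \<Longrightarrow> fst (z t v) \<in> D"
    "\<And>t v. t \<in> {0..1} \<Longrightarrow> v \<in> ball 0 \<delta> \<Longrightarrow> dist x0 (fst (z t v)) \<le> C * norm v"
    "\<And>t v. t \<in> {0..1} \<Longrightarrow> v \<in> ball 0 \<delta> \<Longrightarrow> ((\<lambda>t. z t v) has_vector_derivative (snd (z t v), - Gam (z t v))) (at t within {0..1})"
    "\<And>t v. t \<in> {0..1} \<Longrightarrow> v \<in> ball 0 \<delta> \<Longrightarrow> (z t has_derivative blinfun_apply (zv t v)) (at v)"
    "continuous_on ({0..1} \<times> ball 0 \<delta>) (\<lambda>(t,v). z t v)"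
    "continuous_on ({0..1} \<times> ball 0 \<delta>) (\<lambda>(t,v). zv t v)"
proof -
  let ?DU = "D \<times> (UNIV :: (real^2) set)" and ?a = "(x0, 0 :: real^2)"
  define G1 where "G1 = (\<lambda>z :: (real^2) \<times> (real^2). (snd z, - Gam z))"
  have smG: "smooth_on ?DU G1" unfolding G1_def
    by (intro smooth_on_Pair[OF open_state] smooth_on_linear_comp[OF open_state bounded_linear_snd smooth_on_ident[OF open_state]]
        smooth_on_linear_comp[OF open_state bounded_linear_minus[OF bounded_linear_ident] smooth_Gam])
  obtain G1' where G1': "continuous_on ?DU G1'" "\<And>x. x \<in> ?DU \<Longrightarrow> (G1 has_derivative blinfun_apply (G1' x)) (at x)"
    using smooth_on_C1[OF smG] by metis
  \<comment> \<open>The resulting bound 1/4 at the equilibrium lies strictly below 1/2, so by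
    continuity the bound 1/2 persists on a ball around it.\<close>
  define e where "e = 1 / (4 * (norm (G1' ?a) + 1))"
  have e: "e > 0" "e * norm (G1' ?a) < 1/2"
  proof -
    have p: "norm (G1' ?a) + 1 > 0" using norm_ge_zero[of "G1' ?a"] by linarith
    then show "e > 0" by (simp add: e_def)
    have "e * norm (G1' ?a) \<le> e * (norm (G1' ?a) + 1)" using \<open>e > 0\<close> by simp
    also have "\<dots> = 1/4" using p by (simp add: e_def)
    finally show "e * norm (G1' ?a) < 1/2" by simp
  qed
  define G where "G = (\<lambda>z. e *\<^sub>R G1 z)"
  define G' where "G' = (\<lambda>z. e *\<^sub>R G1' z)"
  have cG': "continuous_on ?DU G'" unfolding G'_def by (intro continuous_intros G1')
  have aD: "?a \<in> ?DU" using x0 by simp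
  have "open (?DU \<inter> (\<lambda>z. norm (G' z)) -` {..<1/2})"
    by (rule continuous_open_preimage[OF continuous_on_norm[OF cG'] open_state open_lessThan])
  moreover have "?a \<in> ?DU \<inter> (\<lambda>z. norm (G' z)) -` {..<1/2}" using aD e by (simp add: G'_def)
  ultimately obtain R where R: "R > 0" "cball ?a R \<subseteq> ?DU \<inter> (\<lambda>z. norm (G' z)) -` {..<1/2}"
    using open_contains_cball by metis
  have RD: "cball ?a R \<subseteq> ?DU" and RG: "\<And>z. z \<in> cball ?a R \<Longrightarrow> norm (G' z) \<le> 1/2" using R(2) by force+
  have dG: "(G has_derivative blinfun_apply (G' z)) (at z)" if "z \<in> cball ?a R" for z
  proof -
    have "((\<lambda>z. e *\<^sub>R G1 z) has_derivative (\<lambda>v. e *\<^sub>R blinfun_apply (G1' z) v)) (at z)"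
      by (rule has_derivative_scaleR_right[OF G1'(2)]) (use that RD in blast)
    then show ?thesis by (simp add: G_def G'_def scaleR_blinfun.rep_eq)
  qed
  have Ga: "G ?a = 0" by (simp add: G_def G1_def Gam_def acc_def zero_prod_def)
  obtain \<Phi> Y where \<Phi>: "\<And>z. z \<in> ball ?a (R/2) \<Longrightarrow> \<Phi> 0 z = z"
    "\<And>t z. t \<in> {0..1} \<Longrightarrow> z \<in> ball ?a (R/2) \<Longrightarrow> dist ?a (\<Phi> t z) \<le> 2 * dist ?a z"
    "\<And>t z. t \<in> {0..1} \<Longrightarrow> z \<in> ball ?a (R/2) \<Longrightarrow>
        ((\<lambda>t. \<Phi> t z) has_vector_derivative G (\<Phi> t z)) (at t within {0..1})"
    "\<And>t z. t \<in> {0..1} \<Longrightarrow> z \<in> ball ?a (R/2) \<Longrightarrow> (\<Phi> t has_derivative blinfun_apply (Y t z)) (at z)"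
    "continuous_on ({0..1} \<times> ball ?a (R/2)) (\<lambda>(t,z). \<Phi> t z)"
    "continuous_on ({0..1} \<times> ball ?a (R/2)) (\<lambda>(t,z). Y t z)"
    by (rule flow_near_equilibrium[OF R(1) dG continuous_on_subset[OF cG' RD] RG Ga]) blast+
  \<comment> \<open>Velocities enter the slowed flow divided by \<open>e\<close> and leave it
    multiplied by \<open>e\<close>, so that \<open>z 0 v\<close> has velocity exactly
    \<open>A v\<close>; \<open>\<delta>\<close> is chosen for \<open>L\<close> to land in the half
    ball.\<close>
  define L where "L = (\<lambda>v. (x0, (1/e) *\<^sub>R A v))"
  define b where "b = onorm A + 1"
  have bA: "bounded_linear A" using A by (simp add: linear_conv_bounded_linear)
  have b: "b > 0" "norm (A v) \<le> b * norm v" for v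
  proof -
    show "b > 0" unfolding b_def using onorm_pos_le[OF bA] by linarith
    have "norm (A v) \<le> onorm A * norm v" by (rule onorm[OF bA])
    also have "\<dots> \<le> b * norm v" unfolding b_def by (intro mult_right_mono) auto
    finally show "norm (A v) \<le> b * norm v" .
  qed
  define \<delta> where "\<delta> = R/2 * e / b"
  have \<delta>: "\<delta> > 0" unfolding \<delta>_def using R(1) e(1) b(1) by simp
  have dL: "dist ?a (L v) \<le> (b/e) * norm v" for v
    using b(2)[of v] e(1) by (simp add: L_def dist_prod_def dist_norm divide_right_mono)
  have LB: "L v \<in> ball ?a (R/2)" if "v \<in> ball 0 \<delta>" for v
  proof -
    have "(b/e) * norm v < (b/e) * \<delta>" using that b(1) e(1) by (intro mult_strict_left_mono) auto
    also have "\<dots> = R/2" unfolding \<delta>_def using b(1) e(1) by simp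
    finally have lt: "(b/e) * norm v < R/2" .
    show ?thesis using le_less_trans[OF dL lt] by (simp only: mem_ball)
  qed
  define LL where "LL = Blinfun (\<lambda>v. (0 :: real^2, (1/e) *\<^sub>R A v))"
  have LLa: "blinfun_apply LL = (\<lambda>v. (0, (1/e) *\<^sub>R A v))" unfolding LL_def
    by (intro bounded_linear_Blinfun_apply bounded_linear_Pair bounded_linear_zero bounded_linear_scaleR_right bounded_linear_compose[OF bounded_linear_scaleR_right bA])
  have dLd: "(L has_derivative blinfun_apply LL) (at v)" for v
    unfolding L_def LLa
    by (intro has_derivative_Pair has_derivative_const has_derivative_scaleR_right bounded_linear_imp_has_derivative bA)
  have contL: "continuous_on S L" for S
    by (rule has_derivative_continuous_on[OF has_derivative_at_withinI[OF dLd]])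
  have blS: "bounded_linear (\<lambda>y :: (real^2) \<times> (real^2). (fst y, e *\<^sub>R snd y))"
    by (intro bounded_linear_Pair bounded_linear_fst bounded_linear_compose[OF bounded_linear_scaleR_right bounded_linear_snd])
  define SS where "SS = Blinfun (\<lambda>y :: (real^2) \<times> (real^2). (fst y, e *\<^sub>R snd y))"
  have SSa: "blinfun_apply SS = (\<lambda>y. (fst y, e *\<^sub>R snd y))" unfolding SS_def
    by (rule bounded_linear_Blinfun_apply[OF blS])
  define z where "z = (\<lambda>t v. (fst (\<Phi> t (L v)), e *\<^sub>R snd (\<Phi> t (L v))))"
  define zv where "zv = (\<lambda>t v. SS o\<^sub>L Y t (L v) o\<^sub>L LL)"
  have zS: "z t v = blinfun_apply SS (\<Phi> t (L v))" for t v by (simp add: z_def SSa)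
  have cLp: "continuous_on ({0..1::real} \<times> ball 0 \<delta>) (\<lambda>q. (fst q, L (snd q)))"
    by (intro continuous_intros continuous_on_compose2[OF contL[of UNIV]]) auto
  have Lp: "(\<lambda>q. (fst q, L (snd q))) ` ({0..1::real} \<times> ball 0 \<delta>) \<subseteq> {0..1} \<times> ball ?a (R/2)" using LB by auto
  have in01: "\<Phi> t (L v) \<in> cball ?a R" if "t \<in> {0..1}" "v \<in> ball 0 \<delta>" for t v
    using \<Phi>(2)[OF that(1) LB[OF that(2)]] LB[OF that(2)] by simp
  have C: "dist x0 (fst (z t v)) \<le> (2 * (b/e)) * norm v" if "t \<in> {0..1}" "v \<in> ball 0 \<delta>" for t v
  proof -
    have "dist (fst ?a) (fst (\<Phi> t (L v))) \<le> dist ?a (\<Phi> t (L v))" by (rule dist_fst_le)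
    also have "\<dots> \<le> 2 * dist ?a (L v)" by (rule \<Phi>(2)[OF that(1) LB[OF that(2)]])
    also have "\<dots> \<le> 2 * ((b/e) * norm v)" by (rule mult_left_mono[OF dL]) simp
    finally show ?thesis by (simp add: z_def mult.assoc)
  qed
  show ?thesis
  proof (rule that[OF \<delta>, of z "2 * (b/e)" zv])
    show "z 0 v = (x0, A v)" if "v \<in> ball 0 \<delta>" for v
      using \<Phi>(1)[OF LB[OF that]] e(1) by (simp add: z_def L_def)
    show "fst (z t v) \<in> D" if "t \<in> {0..1}" "v \<in> ball 0 \<delta>" for t v
    proof -
      have "\<Phi> t (L v) \<in> ?DU" using in01[OF that] RD by blast
      then show ?thesis by (simp add: z_def mem_Times_iff)
    qed
    show "((\<lambda>t. z t v) has_vector_derivative (snd (z t v), - Gam (z t v))) (at t within {0..1})" if "t \<in> {0..1}" "v \<in> ball 0 \<delta>" for t v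
    proof -
      have "((\<lambda>t. blinfun_apply SS (\<Phi> t (L v))) has_vector_derivative blinfun_apply SS (G (\<Phi> t (L v)))) (at t within {0..1})"
        by (rule bounded_linear.has_vector_derivative[OF blinfun.bounded_linear_right \<Phi>(3)[OF that(1) LB[OF that(2)]]])
      moreover have "blinfun_apply SS (G (\<Phi> t (L v))) = (snd (z t v), - Gam (z t v))"
        using Gam_scale[of "fst (\<Phi> t (L v))" e "snd (\<Phi> t (L v))"] by (simp add: SSa G_def G1_def z_def power2_eq_square)
      ultimately show ?thesis by (simp add: zS)
    qed
    show "(z t has_derivative blinfun_apply (zv t v)) (at v)" if "t \<in> {0..1}" "v \<in> ball 0 \<delta>" for t v
    proof -
      have "((\<lambda>v. blinfun_apply SS (\<Phi> t (L v))) has_derivative (\<lambda>h. blinfun_apply SS (blinfun_apply (Y t (L v)) (blinfun_apply LL h)))) (at v)"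
        by (rule bounded_linear.has_derivative[OF blinfun.bounded_linear_right has_derivative_compose[OF dLd \<Phi>(4)[OF that(1) LB[OF that(2)]]]])
      moreover have "(\<lambda>h. blinfun_apply SS (blinfun_apply (Y t (L v)) (blinfun_apply LL h))) = blinfun_apply (zv t v)"
        by (simp add: zv_def fun_eq_iff)
      moreover have "(\<lambda>v. blinfun_apply SS (\<Phi> t (L v))) = z t" by (simp add: zS fun_eq_iff)
      ultimately show ?thesis by simp
    qed
    have "continuous_on ({0..1} \<times> ball 0 \<delta>) (\<lambda>q. (\<lambda>(t,z). \<Phi> t z) (fst q, L (snd q)))"
      by (rule continuous_on_compose2[OF \<Phi>(5) cLp Lp])
    then have "continuous_on ({0..1} \<times> ball 0 \<delta>) (\<lambda>q. blinfun_apply SS ((\<lambda>(t,z). \<Phi> t z) (fst q, L (snd q))))"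
      by (intro continuous_intros)
    then show "continuous_on ({0..1} \<times> ball 0 \<delta>) (\<lambda>(t,v). z t v)" by (simp add: zS case_prod_unfold)
    have "continuous_on ({0..1} \<times> ball 0 \<delta>) (\<lambda>q. (\<lambda>(t,z). Y t z) (fst q, L (snd q)))"
      by (rule continuous_on_compose2[OF \<Phi>(6) cLp Lp])
    then have "continuous_on ({0..1} \<times> ball 0 \<delta>) (\<lambda>q. SS o\<^sub>L ((\<lambda>(t,z). Y t z) (fst q, L (snd q))) o\<^sub>L LL)"
      by (intro continuous_intros)
    then show "continuous_on ({0..1} \<times> ball 0 \<delta>) (\<lambda>(t,v). zv t v)" by (simp add: zv_def case_prod_unfold)
  qed (use C in auto)
qed

end

section \<open>Jacobi fields and the geodesic polar map\<close>

text \<open>With \<open>B = 0\<close> this also serves to show that quantities along a geodesic are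
  conserved.\<close>

lemma unit_interval_deriv_bound:
  fixes g :: "real \<Rightarrow> real"
  assumes "\<And>t. t \<in> {0..1} \<Longrightarrow> (g has_vector_derivative g1 t) (at t within {0..1})"
    and "\<And>t. t \<in> {0..1} \<Longrightarrow> \<bar>g1 t\<bar> \<le> B" and t: "t \<in> {0..1}"
  shows "\<bar>g t - g 0\<bar> \<le> B"
proof -
  have "norm (g t - g 0) \<le> B * norm (t - 0)"
  proof (rule differentiable_bound[of "{0..1}" g "\<lambda>t h. h *\<^sub>R g1 t"])
    show "(g has_derivative (\<lambda>h. h *\<^sub>R g1 x)) (at x within {0..1})" if "x \<in> {0..1}" for x
      using assms(1)[OF that] by (simp add: has_vector_derivative_def)
    show "onorm (\<lambda>h. h *\<^sub>R g1 x) \<le> B" if "x \<in> {0..1}" for x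
    proof (rule onorm_le)
      fix h :: real
      have "\<bar>g1 x\<bar> * \<bar>h\<bar> \<le> B * \<bar>h\<bar>" by (rule mult_right_mono[OF assms(2)[OF that]]) simp
      then show "norm (h *\<^sub>R g1 x) \<le> B * norm h" by (simp add: abs_mult mult.commute[of "\<bar>h\<bar>"])
    qed
  qed (use t in auto)
  also have "\<dots> \<le> B * 1"
    using t assms(2)[OF t] abs_ge_zero[of "g1 t"] by (intro mult_left_mono) (auto simp del: abs_ge_zero)
  finally show ?thesis by simp
qed

text \<open>Comparison with constant curvature \<open>k0\<close>, where the solution begins as the
  initial slope times \<open>t - k0 * r^2 * t^3 / 6\<close>. Time runs over the unit interval, hence
  the factor \<open>r^2\<close> in front of the curvature; the slope \<open>r^2\<close> arises
  because \<open>j\<close> pairs a velocity with a variation, both of length \<open>r\<close>. One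
  part of the error comes from the oscillation of the curvature, the other from replacing
  \<open>j\<close> by its linear part.\<close>

lemma jacobi_estimate:
  fixes j j1 k :: "real \<Rightarrow> real"
  assumes j: "\<And>t. t \<in> {0..1} \<Longrightarrow> (j has_vector_derivative j1 t) (at t within {0..1})"
    and j1: "\<And>t. t \<in> {0..1} \<Longrightarrow> (j1 has_vector_derivative - (r\<^sup>2 * k t * j t)) (at t within {0..1})"
    and init: "j 0 = 0" "\<bar>j1 0\<bar> = r\<^sup>2"
    and k: "\<And>t. t \<in> {0..1} \<Longrightarrow> \<bar>k t - k0\<bar> \<le> e" and M: "\<bar>k0\<bar> \<le> M" and e: "e \<le> 1"
    and r: "(M + 1) * r\<^sup>2 \<le> 1/2"
  shows "\<bar>\<bar>j 1\<bar> - (r\<^sup>2 - k0 * r^4 / 6)\<bar> \<le> r^4 * (2 * e + 2 * M * (M + 1) * r\<^sup>2)"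
proof -
  have e0: "e \<ge> 0" using k[of 0] abs_ge_zero[of "k 0 - k0"] by (auto simp del: abs_ge_zero)
  have M0: "M \<ge> 0" using M by linarith
  have kB: "\<bar>k t\<bar> \<le> M + 1" if "t \<in> {0..1}" for t using k[OF that] M e by linarith
  have cj: "continuous_on {0..1} (\<lambda>t. \<bar>j t\<bar>)"
    by (intro continuous_on_rabs continuous_on_vector_derivative[of _ _ j1] j)
  have "\<exists>s\<in>{0..1}. \<forall>y\<in>{0..1}. \<bar>j y\<bar> \<le> \<bar>j s\<bar>"
    by (rule continuous_attains_sup[OF _ _ cj]) auto
  then obtain s where s: "s \<in> {0..1}" "\<And>y. y \<in> {0..1} \<Longrightarrow> \<bar>j y\<bar> \<le> \<bar>j s\<bar>" by blast
  \<comment> \<open>The maximum of \<open>\<bar>j\<bar>\<close> is not yet controlled. Smallness of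
    \<open>r\<close> makes the change of \<open>j1\<close> at most half of it, so integrating once
    and absorbing bounds it by \<open>2 * r^2\<close>; the second form of the bound retains the
    factor \<open>r^2\<close> needed afterwards.\<close>
  have j1b: "\<bar>j1 t - j1 0\<bar> \<le> \<bar>j s\<bar> / 2" and j1b': "\<bar>j1 t - j1 0\<bar> \<le> r\<^sup>2 * ((M+1) * \<bar>j s\<bar>)" if t: "t \<in> {0..1}" for t
  proof -
    have "\<bar>j1 t - j1 0\<bar> \<le> r\<^sup>2 * ((M+1) * \<bar>j s\<bar>)"
    proof (rule unit_interval_deriv_bound[OF j1 _ t])
      fix t :: real assume t: "t \<in> {0..1}"
      have "\<bar>k t\<bar> * \<bar>j t\<bar> \<le> (M+1) * \<bar>j s\<bar>" by (rule mult_mono[OF kB[OF t] s(2)[OF t]]) (use M0 in auto)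
      then show "\<bar>- (r\<^sup>2 * k t * j t)\<bar> \<le> r\<^sup>2 * ((M+1) * \<bar>j s\<bar>)"
        by (simp add: abs_mult mult.assoc mult_left_mono)
    qed
    then show "\<bar>j1 t - j1 0\<bar> \<le> r\<^sup>2 * ((M+1) * \<bar>j s\<bar>)" .
    also have "\<dots> = ((M+1) * r\<^sup>2) * \<bar>j s\<bar>" by (simp add: algebra_simps)
    also have "\<dots> \<le> 1/2 * \<bar>j s\<bar>" by (rule mult_right_mono[OF r]) simp
    finally show "\<bar>j1 t - j1 0\<bar> \<le> \<bar>j s\<bar> / 2" by simp
  qed
  have jlin: "\<bar>j t - j1 0 * t\<bar> \<le> b" if t: "t \<in> {0..1}" and b: "\<And>t. t \<in> {0..1} \<Longrightarrow> \<bar>j1 t - j1 0\<bar> \<le> b" for t b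
  proof -
    have "\<bar>(j t - j1 0 * t) - (j 0 - j1 0 * 0)\<bar> \<le> b"
      by (rule unit_interval_deriv_bound[OF _ b t]) (auto intro!: derivative_eq_intros j)
    then show ?thesis using init by simp
  qed
  have "\<bar>j s\<bar> \<le> \<bar>j1 0 * s\<bar> + \<bar>j s\<bar> / 2" using jlin[OF s(1) j1b] by linarith
  also have "\<bar>j1 0 * s\<bar> \<le> r\<^sup>2" using s(1) init(2) by (simp add: abs_mult mult_left_le)
  finally have js: "\<bar>j s\<bar> \<le> 2 * r\<^sup>2" by simp
  have jb: "\<bar>j t\<bar> \<le> 2 * r\<^sup>2" if "t \<in> {0..1}" for t using s(2)[OF that] js by linarith
  have jlin2: "\<bar>j t - j1 0 * t\<bar> \<le> 2 * (M+1) * r^4" if t: "t \<in> {0..1}" for t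
  proof -
    have "\<bar>j t - j1 0 * t\<bar> \<le> r\<^sup>2 * ((M+1) * \<bar>j s\<bar>)" by (rule jlin[OF t j1b'])
    also have "\<dots> \<le> r\<^sup>2 * ((M+1) * (2 * r\<^sup>2))" using js M0 by (intro mult_left_mono) auto
    also have "\<dots> = 2 * (M+1) * r^4" by (simp add: power2_eq_square power4_eq_xxxx)
    finally show ?thesis .
  qed
  define b where "b = r^4 * (2 * e + 2 * M * (M + 1) * r\<^sup>2)"
  \<comment> \<open>The deviation from the cubic polynomial. It vanishes at 0 together with its
    derivative \<open>g1\<close>, so a bound on its second derivative bounds its value at 1.\<close>
  define g where "g = (\<lambda>t. j t - j1 0 * (t - k0 * r\<^sup>2 * t^3 / 6))"
  define g1 where "g1 = (\<lambda>t. j1 t - j1 0 * (1 - k0 * r\<^sup>2 * t\<^sup>2 / 2))"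
  have g: "(g has_vector_derivative g1 t) (at t within {0..1})" if "t \<in> {0..1}" for t
    unfolding g_def g1_def using j[OF that] unfolding has_real_derivative_iff_has_vector_derivative[symmetric]
    by (auto intro!: derivative_eq_intros simp: power2_eq_square)
  have g1: "(g1 has_vector_derivative - (r\<^sup>2 * k t * j t) + j1 0 * k0 * r\<^sup>2 * t) (at t within {0..1})" if "t \<in> {0..1}" for t
    unfolding g1_def using j1[OF that] unfolding has_real_derivative_iff_has_vector_derivative[symmetric]
    by (auto intro!: derivative_eq_intros simp: power2_eq_square)
  have g2: "\<bar>- (r\<^sup>2 * k t * j t) + j1 0 * k0 * r\<^sup>2 * t\<bar> \<le> b" if t: "t \<in> {0..1}" for t
  proof -
    have eq: "- (r\<^sup>2 * k t * j t) + j1 0 * k0 * r\<^sup>2 * t = - (r\<^sup>2 * ((k t - k0) * j t + k0 * (j t - j1 0 * t)))"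
      by (simp add: algebra_simps)
    have "\<bar>(k t - k0) * j t\<bar> \<le> e * (2 * r\<^sup>2)" unfolding abs_mult by (rule mult_mono[OF k[OF t] jb[OF t] e0]) simp
    moreover have "\<bar>k0 * (j t - j1 0 * t)\<bar> \<le> M * (2 * (M+1) * r^4)" unfolding abs_mult by (rule mult_mono[OF M jlin2[OF t] M0]) simp
    ultimately have "\<bar>(k t - k0) * j t + k0 * (j t - j1 0 * t)\<bar> \<le> e * (2 * r\<^sup>2) + M * (2 * (M+1) * r^4)"
      using abs_triangle_ineq[of "(k t - k0) * j t" "k0 * (j t - j1 0 * t)"] by linarith
    then have "r\<^sup>2 * \<bar>(k t - k0) * j t + k0 * (j t - j1 0 * t)\<bar> \<le> r\<^sup>2 * (e * (2 * r\<^sup>2) + M * (2 * (M+1) * r^4))"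
      by (rule mult_left_mono) simp
    also have "\<dots> = b" unfolding b_def by (simp add: algebra_simps power2_eq_square power4_eq_xxxx)
    finally show ?thesis unfolding eq by (simp add: abs_mult)
  qed
  have "\<bar>g1 t\<bar> \<le> b" if "t \<in> {0..1}" for t
    using unit_interval_deriv_bound[OF g1 g2 that] by (simp add: g1_def)
  from unit_interval_deriv_bound[OF g this, of 1] have "\<bar>g 1\<bar> \<le> b" by (simp add: g_def init)
  then have 1: "\<bar>j 1 - j1 0 * (1 - k0 * r\<^sup>2 / 6)\<bar> \<le> b" by (simp add: g_def)
  have "k0 * r\<^sup>2 \<le> (M + 1) * r\<^sup>2" using M by (intro mult_right_mono) auto
  then have "1 - k0 * r\<^sup>2 / 6 \<ge> 0" using r by simp
  then have "\<bar>j1 0 * (1 - k0 * r\<^sup>2 / 6)\<bar> = r\<^sup>2 - k0 * r^4 / 6"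
    unfolding abs_mult init(2) by (subst abs_of_nonneg) (simp_all add: algebra_simps power2_eq_square power4_eq_xxxx)
  then show ?thesis using 1 unfolding b_def by linarith
qed

section \<open>Gauss curvature and the exponential map in the parameter domain\<close>

context param_surface begin

text \<open>The ratio of the oriented area elements of the normal and of the surface,
  \<open>F1 x \<times> F2 x\<close> being \<open>sqrt (gdet x)\<close> times the unit normal; it
  equals the determinant of the differential of the Gauss map.\<close>

definition "gcurv x = (cross3 (frechet_derivative nrm (at x) (axis 1 1)) (frechet_derivative nrm (at x) (axis 2 1)) \<bullet> nrm x) * inverse (sqrt (gdet x))"

lemma nrm_has_derivative: "x \<in> D \<Longrightarrow> (nrm has_derivative frechet_derivative nrm (at x)) (at x)"
  by (rule smooth_on_has_derivative[OF smooth_nrm])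

lemma Dnrm_orth: "x \<in> D \<Longrightarrow> frechet_derivative nrm (at x) v \<bullet> nrm x = 0"
  using unit_derivative_orth[OF openD _ nrm_simps(1) nrm_has_derivative] by blast

lemma nrm_F: assumes "x \<in> D" shows "cross3 (F1 x) (F2 x) = sqrt (gdet x) *\<^sub>R nrm x"
  using gdet_pos[OF assms] by (simp add: nrm_def)

text \<open>On the coordinate vectors this is the definition of \<open>gcurv\<close>; passing to
  \<open>v\<close> and \<open>w\<close> multiplies both cross products by the same
  determinant.\<close>

lemma cross_Dnrm:
  assumes "x \<in> D"
  shows "cross3 (frechet_derivative nrm (at x) v) (frechet_derivative nrm (at x) w) = gcurv x *\<^sub>R cross3 (DF x v) (DF x w)"
proof -
  let ?N = "frechet_derivative nrm (at x)"
  have l: "linear ?N" using nrm_has_derivative[OF assms] has_derivative_linear by blast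
  have "cross3 (?N (axis 1 1)) (?N (axis 2 1)) = (cross3 (?N (axis 1 1)) (?N (axis 2 1)) \<bullet> nrm x) *\<^sub>R nrm x"
    by (rule cross3_parallel) (use Dnrm_orth[OF assms] nrm_simps[OF assms] in auto)
  also have "\<dots> = gcurv x *\<^sub>R cross3 (F1 x) (F2 x)"
    using gdet_pos[OF assms] by (simp add: gcurv_def nrm_F[OF assms])
  finally have e: "cross3 (?N (axis 1 1)) (?N (axis 2 1)) = gcurv x *\<^sub>R cross3 (F1 x) (F2 x)" .
  show ?thesis
    using e by (simp add: cross3_linear_image[OF l, of v w] cross3_linear_image[OF linear_DF[OF assms], of v w] DF_axis)
qed

lemma gcurv_unique:
  assumes "x \<in> D" "cross3 (frechet_derivative nrm (at x) (axis 1 1)) (frechet_derivative nrm (at x) (axis 2 1)) = k *\<^sub>R cross3 (F1 x) (F2 x)"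
  shows "gcurv x = k"
proof -
  have "cross3 (F1 x) (F2 x) \<noteq> 0" using gdet_pos[OF assms(1)] by (auto simp: gdet_eq)
  moreover have "gcurv x *\<^sub>R cross3 (F1 x) (F2 x) = k *\<^sub>R cross3 (F1 x) (F2 x)"
    using cross_Dnrm[OF assms(1), of "axis 1 1" "axis 2 1"] unfolding assms(2) DF_axis by (rule sym)
  ultimately show ?thesis by (metis scaleR_cancel_right)
qed

lemma continuous_gcurv: "continuous_on D gcurv"
proof -
  have "smooth_on D gcurv" unfolding gcurv_def[abs_def]
    by (intro smooth_on_mult[OF openD] smooth_on_inner[OF openD] smooth_on_bilinear[OF openD bounded_bilinear_cross3]
       smooth_on_frechet_derivative smooth_nrm smooth_on_inverse_sqrt[OF openD] gdet_pos smooth_gdet)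
  then show ?thesis by (rule smooth_on_continuous)
qed

text \<open>Within the tangent plane the cross product with the unit normal is a quarter turn, so it
  moves \<open>T\<close> into the line of \<open>Y\<close>. This recovers the length of a variation
  field from its product with \<open>n \<times> T\<close>.\<close>

lemma abs_triple:
  assumes x: "x \<in> D" and T: "T \<bullet> nrm x = 0" and Y: "Y \<bullet> nrm x = 0" and TY: "T \<bullet> Y = 0"
  shows "\<bar>Y \<bullet> cross3 (nrm x) T\<bar> = norm T * norm Y"
proof -
  have n1: "norm (nrm x) = 1" using nrm_simps(1)[OF x] by (simp add: norm_eq_sqrt_inner)
  have "cross3 T Y = (cross3 T Y \<bullet> nrm x) *\<^sub>R nrm x" by (rule cross3_parallel) (use nrm_simps[OF x] T Y in auto)
  then have "norm (cross3 T Y) = norm ((cross3 T Y \<bullet> nrm x) *\<^sub>R nrm x)" by simp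
  also have "\<dots> = \<bar>cross3 T Y \<bullet> nrm x\<bar>" using n1 by simp
  also have "cross3 T Y \<bullet> nrm x = Y \<bullet> cross3 (nrm x) T" by (simp add: cross3_simps)
  finally have "norm (cross3 T Y) = \<bar>Y \<bullet> cross3 (nrm x) T\<bar>" .
  moreover have "(norm (cross3 T Y))\<^sup>2 = (norm T * norm Y)\<^sup>2" using norm_cross_dot[of T Y] TY by simp
  then have "norm (cross3 T Y) = norm T * norm Y" by (rule power2_eq_imp_eq) auto
  ultimately show ?thesis by simp
qed

text \<open>\<open>A\<close> identifies the plane isometrically with the tangent plane, so
  \<open>E\<close> is the exponential map in parameters and \<open>\<tau> v\<close> the velocity in
  space at time one. The Gauss lemma comes from the conservation of speed, the final expansion from
  the Jacobi equation for a variation \<open>h\<close> orthogonal to \<open>v\<close>; choosing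
  \<open>h\<close> as long as \<open>v\<close> makes it the velocity of a round circle parametrized
  by angle.\<close>

lemma geodesic_polar:
  fixes A :: "real^2 \<Rightarrow> real^2"
  assumes x0: "x0 \<in> D" and A: "linear A" and iso: "\<And>v. norm (DF x0 (A v)) = norm v"
  obtains \<delta> and E :: "real^2 \<Rightarrow> real^2" and E' :: "real^2 \<Rightarrow> ((real^2) \<Rightarrow>\<^sub>L (real^2))"
    and X P :: "real \<Rightarrow> real^2 \<Rightarrow> real^2" and \<tau> :: "real^2 \<Rightarrow> real^3" where
    "\<delta> > 0" "continuous_on (ball 0 \<delta>) E'" "\<And>v. v \<in> ball 0 \<delta> \<Longrightarrow> (E has_derivative blinfun_apply (E' v)) (at v)"
    "\<And>v. v \<in> ball 0 \<delta> \<Longrightarrow> E v \<in> D" "E 0 = x0"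
    "\<And>v. v \<in> ball 0 \<delta> \<Longrightarrow> X 0 v = x0" "\<And>v. X 1 v = E v"
    "\<And>t v. t \<in> {0..1::real} \<Longrightarrow> v \<in> ball 0 \<delta> \<Longrightarrow> X t v \<in> D"
    "\<And>t v. t \<in> {0..1} \<Longrightarrow> v \<in> ball 0 \<delta> \<Longrightarrow> ((\<lambda>t. X t v) has_vector_derivative P t v) (at t within {0..1})"
    "\<And>v. v \<in> ball 0 \<delta> \<Longrightarrow> continuous_on {0..1} (\<lambda>t. P t v)"
    "\<And>t v. t \<in> {0..1} \<Longrightarrow> v \<in> ball 0 \<delta> \<Longrightarrow> norm (DF (X t v) (P t v)) = norm v"
    "\<And>v. v \<in> ball 0 \<delta> \<Longrightarrow> norm (\<tau> v) = norm v"
    "\<And>v h. v \<in> ball 0 \<delta> \<Longrightarrow> \<tau> v \<bullet> DF (E v) (blinfun_apply (E' v) h) = v \<bullet> h"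
    "\<And>\<eta>. \<eta> > 0 \<Longrightarrow> \<exists>\<rho>>0. \<forall>v\<in>ball 0 \<delta>. \<forall>h. 0 < norm v \<and> norm v < \<rho> \<and> v \<bullet> h = 0 \<and> norm h = norm v \<longrightarrow>
       \<bar>norm (DF (E v) (blinfun_apply (E' v) h)) - (norm v - gcurv x0 * norm v ^ 3 / 6)\<bar> \<le> \<eta> * norm v ^ 3"
proof -
  obtain \<delta> C z zv where \<delta>: "\<delta> > 0" and z0: "\<And>v. v \<in> ball 0 \<delta> \<Longrightarrow> z 0 v = (x0, A v)"
    and zD: "\<And>t v. t \<in> {0..1} \<Longrightarrow> v \<in> ball 0 \<delta> \<Longrightarrow> fst (z t v) \<in> D"
    and zC: "\<And>t v. t \<in> {0..1} \<Longrightarrow> v \<in> ball 0 \<delta> \<Longrightarrow> dist x0 (fst (z t v)) \<le> C * norm v"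
    and zt: "\<And>t v. t \<in> {0..1} \<Longrightarrow> v \<in> ball 0 \<delta> \<Longrightarrow> ((\<lambda>t. z t v) has_vector_derivative (snd (z t v), - Gam (z t v))) (at t within {0..1})"
    and zv: "\<And>t v. t \<in> {0..1} \<Longrightarrow> v \<in> ball 0 \<delta> \<Longrightarrow> (z t has_derivative blinfun_apply (zv t v)) (at v)"
    and cz: "continuous_on ({0..1} \<times> ball 0 \<delta>) (\<lambda>(t,v). z t v)"
    and czv: "continuous_on ({0..1} \<times> ball 0 \<delta>) (\<lambda>(t,v). zv t v)"
    by (rule geodesics[OF x0 A]) blast
  let ?B = "ball (0::real^2) \<delta>" and ?I = "{0..1::real}"
  have cz': "continuous_on (?I \<times> ?B) (\<lambda>q. z (fst q) (snd q))" and czv': "continuous_on (?I \<times> ?B) (\<lambda>q. zv (fst q) (snd q))"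
    using cz czv by (simp_all add: case_prod_unfold)
  have zS: "z t v \<in> D \<times> UNIV" if "t \<in> ?I" "v \<in> ?B" for t v using zD[OF that] by (simp add: mem_Times_iff)
  \<comment> \<open>Position, velocity and normal acceleration in space are smooth functions of the
    state, so they inherit its C^1 dependence on the initial velocity.\<close>
  have comp: "\<exists>sv. (\<forall>t\<in>?I. \<forall>v\<in>?B. ((\<lambda>v. \<sigma> (z t v)) has_derivative blinfun_apply (sv t v)) (at v)) \<and>
       continuous_on (?I \<times> ?B) (\<lambda>(t,v). sv t v) \<and> continuous_on (?I \<times> ?B) (\<lambda>(t,v). \<sigma> (z t v))"
    if sm: "smooth_on (D \<times> UNIV) \<sigma>" for \<sigma> :: "(real^2) \<times> (real^2) \<Rightarrow> real^3"
  proof -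
    obtain \<sigma>' where s: "continuous_on (D \<times> UNIV) \<sigma>'" "\<And>x. x \<in> D \<times> UNIV \<Longrightarrow> (\<sigma> has_derivative blinfun_apply (\<sigma>' x)) (at x)"
      using smooth_on_C1[OF sm] by metis
    have im: "(\<lambda>q. z (fst q) (snd q)) ` (?I \<times> ?B) \<subseteq> D \<times> UNIV"
    proof (rule image_subsetI)
      fix q assume "q \<in> ?I \<times> ?B"
      then have "fst q \<in> ?I" "snd q \<in> ?B" by (auto simp: mem_Times_iff)
      then show "z (fst q) (snd q) \<in> D \<times> UNIV" by (rule zS)
    qed
    have 1: "((\<lambda>v. \<sigma> (z t v)) has_derivative blinfun_apply (\<sigma>' (z t v) o\<^sub>L zv t v)) (at v)" if "t \<in> ?I" "v \<in> ?B" for t v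
      using has_derivative_compose[OF zv[OF that] s(2)[OF zS[OF that]]] by (simp add: blinfun_compose.rep_eq o_def)
    have "continuous_on (?I \<times> ?B) (\<lambda>q. \<sigma>' (z (fst q) (snd q)))" by (rule continuous_on_compose2[OF s(1) cz' im])
    then have 2: "continuous_on (?I \<times> ?B) (\<lambda>(t,v). \<sigma>' (z t v) o\<^sub>L zv t v)"
      unfolding case_prod_unfold by (intro continuous_intros czv')
    have "continuous_on (?I \<times> ?B) (\<lambda>q. \<sigma> (z (fst q) (snd q)))"
      by (rule continuous_on_compose2[OF smooth_on_continuous[OF sm] cz' im])
    then have 3: "continuous_on (?I \<times> ?B) (\<lambda>(t,v). \<sigma> (z t v))" by (simp add: case_prod_unfold)
    show ?thesis using 1 2 3 by (intro exI[of _ "\<lambda>t v. \<sigma>' (z t v) o\<^sub>L zv t v"]) simp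
  qed
  define x where "x = (\<lambda>t v. fst (z t v))"
  define p where "p = (\<lambda>t v. snd (z t v))"
  define T where "T = (\<lambda>t v. DF (x t v) (p t v))"
  define W where "W = (\<lambda>t v. nacc (z t v))"
  define n where "n = (\<lambda>t v. nrm (x t v))"
  define xv where "xv = (\<lambda>t v h. fst (blinfun_apply (zv t v) h))"
  have xD: "x t v \<in> D" if "t \<in> ?I" "v \<in> ?B" for t v using zD[OF that] by (simp add: x_def)
  obtain Tv where Tv: "\<And>t v. t \<in> ?I \<Longrightarrow> v \<in> ?B \<Longrightarrow> (T t has_derivative blinfun_apply (Tv t v)) (at v)"
    "continuous_on (?I \<times> ?B) (\<lambda>(t,v). Tv t v)" "continuous_on (?I \<times> ?B) (\<lambda>(t,v). T t v)"
    using comp[OF smooth_vel] unfolding T_def x_def p_def by blast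
  obtain Wv where Wv: "\<And>t v. t \<in> ?I \<Longrightarrow> v \<in> ?B \<Longrightarrow> (W t has_derivative blinfun_apply (Wv t v)) (at v)"
    "continuous_on (?I \<times> ?B) (\<lambda>(t,v). Wv t v)" "continuous_on (?I \<times> ?B) (\<lambda>(t,v). W t v)"
    using comp[OF smooth_nacc] unfolding W_def by blast
  obtain cv where cv: "\<And>t v. t \<in> ?I \<Longrightarrow> v \<in> ?B \<Longrightarrow> ((\<lambda>v. F (x t v)) has_derivative blinfun_apply (cv t v)) (at v)"
    "continuous_on (?I \<times> ?B) (\<lambda>(t,v). cv t v)"
    using comp[OF smooth_fst[OF smF]] unfolding x_def by blast
  have xvd: "(x t has_derivative xv t v) (at v)" if "t \<in> ?I" "v \<in> ?B" for t v
    using bounded_linear.has_derivative[OF bounded_linear_fst zv[OF that]] by (simp add: x_def[abs_def] xv_def[abs_def])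
  have cvDF: "blinfun_apply (cv t v) h = DF (x t v) (xv t v h)" if "t \<in> ?I" "v \<in> ?B" for t v h
    using has_derivative_unique[OF cv(1)[OF that] has_derivative_compose[OF xvd[OF that] F_has_derivative[OF xD[OF that]]]]
    by metis
  have nv: "(n t has_derivative (\<lambda>h. frechet_derivative nrm (at (x t v)) (xv t v h))) (at v)" if "t \<in> ?I" "v \<in> ?B" for t v
    using has_derivative_compose[OF xvd[OF that] nrm_has_derivative[OF xD[OF that]]] by (simp add: n_def[abs_def])
  have xt: "((\<lambda>t. x t v) has_vector_derivative p t v) (at t within ?I)" if "t \<in> ?I" "v \<in> ?B" for t v
    using bounded_linear.has_vector_derivative[OF bounded_linear_fst zt[OF that]] by (simp add: x_def p_def)
  have pt: "((\<lambda>t. p t v) has_vector_derivative - Gam (z t v)) (at t within ?I)" if "t \<in> ?I" "v \<in> ?B" for t v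
    using bounded_linear.has_vector_derivative[OF bounded_linear_snd zt[OF that]] by (simp add: p_def)
  have ct: "((\<lambda>t. F (x t v)) has_vector_derivative T t v) (at t within ?I)" if "t \<in> ?I" "v \<in> ?B" for t v
    unfolding T_def by (rule has_vector_derivative_compose[OF xt[OF that] F_has_derivative[OF xD[OF that]]])
  have nt: "((\<lambda>t. n t v) has_vector_derivative frechet_derivative nrm (at (x t v)) (p t v)) (at t within ?I)" if "t \<in> ?I" "v \<in> ?B" for t v
    unfolding n_def by (rule has_vector_derivative_compose[OF xt[OF that] nrm_has_derivative[OF xD[OF that]]])
  \<comment> \<open>In the derivative of the velocity in space, the term \<open>- Gam\<close>
    removes exactly the tangential part of \<open>acc\<close>, leaving the normal
    acceleration.\<close>
  have Tt: "((\<lambda>t. T t v) has_vector_derivative W t v) (at t within ?I)" if tv: "t \<in> ?I" "v \<in> ?B" for t v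
  proof -
    note d1 = smooth_on_has_derivative[OF smooth_F12(1) xD[OF tv]] and d2 = smooth_on_has_derivative[OF smooth_F12(2) xD[OF tv]]
    have c: "((\<lambda>t. p t v $ i) has_real_derivative - (Gam (z t v) $ i)) (at t within ?I)" for i
      using bounded_linear.has_vector_derivative[OF bounded_linear_vec_nth pt[OF tv]]
      by (simp add: has_real_derivative_iff_has_vector_derivative)
    have "((\<lambda>t. (p t v $ 1) *\<^sub>R F1 (x t v) + (p t v $ 2) *\<^sub>R F2 (x t v)) has_vector_derivative
       ((p t v $ 1) *\<^sub>R frechet_derivative F1 (at (x t v)) (p t v) + (- (Gam (z t v) $ 1)) *\<^sub>R F1 (x t v))
       + ((p t v $ 2) *\<^sub>R frechet_derivative F2 (at (x t v)) (p t v) + (- (Gam (z t v) $ 2)) *\<^sub>R F2 (x t v))) (at t within ?I)"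
      by (intro has_vector_derivative_add has_vector_derivative_scaleR c has_vector_derivative_compose[OF xt[OF tv] d1] has_vector_derivative_compose[OF xt[OF tv] d2])
    moreover have "frechet_derivative F1 (at (x t v)) (p t v) = (p t v$1) *\<^sub>R frechet_derivative F1 (at (x t v)) (axis 1 1) + (p t v$2) *\<^sub>R frechet_derivative F1 (at (x t v)) (axis 2 1)"
      by (rule linear_real2[OF has_derivative_linear[OF d1]])
    moreover have "frechet_derivative F2 (at (x t v)) (p t v) = (p t v$1) *\<^sub>R frechet_derivative F2 (at (x t v)) (axis 1 1) + (p t v$2) *\<^sub>R frechet_derivative F2 (at (x t v)) (axis 2 1)"
      by (rule linear_real2[OF has_derivative_linear[OF d2]])
    ultimately show ?thesis
      unfolding T_def DF_def W_def nacc_def acc_def x_def p_def by (simp add: algebra_simps)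
  qed
  \<comment> \<open>The variation field \<open>cv\<close> has as time derivative the variation
    \<open>Tv\<close> of the velocity, and this has the variation \<open>Wv\<close> of the
    acceleration: two time derivatives obtained by two exchanges.\<close>
  have Yt: "((\<lambda>t. blinfun_apply (cv t v) h) has_vector_derivative blinfun_apply (Tv t v) h) (at t within ?I)" if "t \<in> ?I" "v \<in> ?B" for t v h
    by (rule mixed_partial[OF open_ball convex_ball that(2,1) ct cv(1) Tv(1) Tv(3) Tv(2)])
  have St: "((\<lambda>t. blinfun_apply (Tv t v) h) has_vector_derivative blinfun_apply (Wv t v) h) (at t within ?I)" if "t \<in> ?I" "v \<in> ?B" for t v h
    by (rule mixed_partial[OF open_ball convex_ball that(2,1) Tt Tv(1) Wv(1) Wv(3) Wv(2)])
  have Tn: "T t v \<bullet> n t v = 0" if "t \<in> ?I" "v \<in> ?B" for t v using nrm_simps(2)[OF xD[OF that]] by (simp add: T_def n_def)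
  have Wn: "W t v = (W t v \<bullet> n t v) *\<^sub>R n t v" if "t \<in> ?I" "v \<in> ?B" for t v
    using nacc_normal[OF zD[OF that]] by (simp add: W_def n_def x_def)
  have nn: "n t v \<bullet> n t v = 1" if "t \<in> ?I" "v \<in> ?B" for t v using nrm_simps(1)[OF xD[OF that]] by (simp add: n_def)
  have Yn: "blinfun_apply (cv t v) h \<bullet> n t v = 0" if "t \<in> ?I" "v \<in> ?B" for t v h
    using nrm_simps(2)[OF xD[OF that]] by (simp add: cvDF[OF that] n_def)
  \<comment> \<open>Used to differentiate identities that hold for all initial velocities:
    orthogonality of \<open>T\<close> and \<open>n\<close>, constant speed, the common starting
    point, and the normality of \<open>W\<close>.\<close>
  have constv: "g' h = 0" if "v \<in> ?B" "(g has_derivative g') (at v)" "\<And>v. v \<in> ?B \<Longrightarrow> g v = c" for g g' and v h :: "real^2" and c :: "'z::real_normed_vector"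
  proof -
    have "(g has_derivative (\<lambda>h. 0)) (at v)"
      by (rule has_derivative_transform_within_open[OF has_derivative_const[of c] open_ball that(1)]) (simp add: that(3))
    from has_derivative_unique[OF that(2) this] show ?thesis by simp
  qed
  have Sn: "blinfun_apply (Tv t v) h \<bullet> n t v = - (T t v \<bullet> frechet_derivative nrm (at (x t v)) (xv t v h))" if tv: "t \<in> ?I" "v \<in> ?B" for t v h
    using constv[OF tv(2) has_derivative_inner[OF Tv(1)[OF tv] nv[OF tv]], of 0 h] Tn[OF tv(1)] by simp
  have nh0: "frechet_derivative nrm (at (x t v)) w \<bullet> n t v = 0" if "t \<in> ?I" "v \<in> ?B" for t v w
    using Dnrm_orth[OF xD[OF that]] by (simp add: n_def)
  have Wnt: "W t v \<bullet> n t v = - (T t v \<bullet> frechet_derivative nrm (at (x t v)) (p t v))" if tv: "t \<in> ?I" "v \<in> ?B" for t v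
  proof -
    have 1: "((\<lambda>t. T t v \<bullet> n t v) has_vector_derivative (T t v \<bullet> frechet_derivative nrm (at (x t v)) (p t v) + W t v \<bullet> n t v)) (at t within ?I)"
      by (rule bounded_bilinear.has_vector_derivative[OF bounded_bilinear_inner Tt[OF tv] nt[OF tv]])
    have 2: "((\<lambda>t. T t v \<bullet> n t v) has_vector_derivative 0) (at t within ?I)"
      by (rule has_vector_derivative_transform[OF tv(1) _ has_vector_derivative_const[of 0]]) (use Tn tv in simp)
    have "T t v \<bullet> frechet_derivative nrm (at (x t v)) (p t v) + W t v \<bullet> n t v = 0"
      by (rule vector_derivative_unique_within_closed_interval[of 0 1 t]) (use 1 2 tv(1) in auto)
    then show ?thesis by simp
  qed
  have TT: "T t v \<bullet> T t v = v \<bullet> v" if tv: "t \<in> ?I" "v \<in> ?B" for t v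
  proof -
    have "\<bar>T t v \<bullet> T t v - T 0 v \<bullet> T 0 v\<bar> \<le> 0"
    proof (rule unit_interval_deriv_bound[OF _ _ tv(1)])
      fix t assume t: "t \<in> ?I"
      show "((\<lambda>t. T t v \<bullet> T t v) has_vector_derivative (T t v \<bullet> W t v + W t v \<bullet> T t v)) (at t within ?I)"
        by (rule bounded_bilinear.has_vector_derivative[OF bounded_bilinear_inner Tt[OF t tv(2)] Tt[OF t tv(2)]])
      have "W t v \<bullet> T t v = 0" by (subst Wn[OF t tv(2)]) (use Tn[OF t tv(2)] in \<open>simp add: inner_commute\<close>)
      then show "\<bar>T t v \<bullet> W t v + W t v \<bullet> T t v\<bar> \<le> 0" by (simp add: inner_commute)
    qed
    moreover have "T 0 v \<bullet> T 0 v = v \<bullet> v"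
      using iso[of v] z0[OF tv(2)] by (simp add: T_def x_def p_def dot_square_norm)
    ultimately show ?thesis by simp
  qed
  have TS: "T t v \<bullet> blinfun_apply (Tv t v) h = v \<bullet> h" if tv: "t \<in> ?I" "v \<in> ?B" for t v h
  proof -
    have d: "((\<lambda>v. T t v \<bullet> T t v - v \<bullet> v) has_derivative (\<lambda>h. (T t v \<bullet> blinfun_apply (Tv t v) h + blinfun_apply (Tv t v) h \<bullet> T t v) - (v \<bullet> h + h \<bullet> v))) (at v)"
      by (intro has_derivative_diff has_derivative_inner Tv(1)[OF tv] has_derivative_ident)
    from constv[OF tv(2) d, of 0 h] TT[OF tv(1)] show ?thesis by (simp add: inner_commute)
  qed
  have Y0: "blinfun_apply (cv 0 v) h = 0" if v: "v \<in> ?B" for v h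
    by (rule constv[OF v cv(1)[OF _ v]]) (use z0 in \<open>auto simp: x_def\<close>)
  \<comment> \<open>The Gauss lemma. The acceleration is orthogonal to the variation field, so the
    product of the latter with \<open>T\<close> has derivative \<open>T \<bullet> Tv t v h\<close>,
    which constant speed evaluates to \<open>v \<bullet> h\<close>; at the start the variation field
    vanishes.\<close>
  have TY: "T t v \<bullet> blinfun_apply (cv t v) h = t * (v \<bullet> h)" if tv: "t \<in> ?I" "v \<in> ?B" for t v h
  proof -
    have "\<bar>(T t v \<bullet> blinfun_apply (cv t v) h - t * (v \<bullet> h)) - (T 0 v \<bullet> blinfun_apply (cv 0 v) h - 0 * (v \<bullet> h))\<bar> \<le> 0"
    proof (rule unit_interval_deriv_bound[OF _ _ tv(1)])
      fix t assume t: "t \<in> ?I"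
      show "((\<lambda>t. T t v \<bullet> blinfun_apply (cv t v) h - t * (v \<bullet> h)) has_vector_derivative
          ((T t v \<bullet> blinfun_apply (Tv t v) h + W t v \<bullet> blinfun_apply (cv t v) h) - 1 * (v \<bullet> h))) (at t within ?I)"
        by (intro has_vector_derivative_diff bounded_bilinear.has_vector_derivative[OF bounded_bilinear_inner Tt[OF t tv(2)] Yt[OF t tv(2)]]
            has_vector_derivative_mult_left has_vector_derivative_id)
      have "W t v \<bullet> blinfun_apply (cv t v) h = 0" by (subst Wn[OF t tv(2)]) (use Yn[OF t tv(2)] in \<open>simp add: inner_commute\<close>)
      then show "\<bar>(T t v \<bullet> blinfun_apply (Tv t v) h + W t v \<bullet> blinfun_apply (cv t v) h) - 1 * (v \<bullet> h)\<bar> \<le> 0" by (simp add: TS[OF t tv(2)])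
    qed
    then show ?thesis by (simp add: Y0[OF tv(2)])
  qed
  \<comment> \<open>Differentiates \<open>W \<bullet> (n \<times> T) = 0\<close> in
    \<open>v\<close>; the term with the variation of \<open>T\<close> drops out because
    \<open>W\<close> is a multiple of \<open>n\<close>.\<close>
  have VW: "blinfun_apply (Wv t v) h \<bullet> cross3 (n t v) (T t v) = - (W t v \<bullet> cross3 (frechet_derivative nrm (at (x t v)) (xv t v h)) (T t v))" if tv: "t \<in> ?I" "v \<in> ?B" for t v h
  proof -
    have z: "W t v \<bullet> cross3 (n t v) w = 0" if "v \<in> ?B" for v w
      by (subst Wn[OF tv(1) that]) (simp add: dot_cross_self)
    have "W t v \<bullet> (cross3 (n t v) (blinfun_apply (Tv t v) h) + cross3 (frechet_derivative nrm (at (x t v)) (xv t v h)) (T t v)) + blinfun_apply (Wv t v) h \<bullet> cross3 (n t v) (T t v) = 0"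
      using constv[OF tv(2) has_derivative_inner[OF Wv(1)[OF tv] bounded_bilinear.FDERIV[OF bounded_bilinear_cross3 nv[OF tv] Tv(1)[OF tv]]], of 0 h] z by simp
    then show ?thesis using z[OF tv(2)] by (simp add: inner_add_right)
  qed
  \<comment> \<open>The signed component of the variation field across the geodesic, multiplied by
    the speed; keeping this factor avoids dividing by the length of \<open>v\<close>.\<close>
  define j where "j = (\<lambda>v h t. blinfun_apply (cv t v) h \<bullet> cross3 (n t v) (T t v))"
  define j1 where "j1 = (\<lambda>v h t. blinfun_apply (Tv t v) h \<bullet> cross3 (n t v) (T t v))"
  have nTt: "((\<lambda>t. cross3 (n t v) (T t v)) has_vector_derivative (cross3 (n t v) (W t v) + cross3 (frechet_derivative nrm (at (x t v)) (p t v)) (T t v))) (at t within ?I)" if tv: "t \<in> ?I" "v \<in> ?B" for t v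
    by (rule bounded_bilinear.has_vector_derivative[OF bounded_bilinear_cross3 nt[OF tv] Tt[OF tv]])
  have jac: "(j v h has_vector_derivative j1 v h t) (at t within ?I)"
    "(j1 v h has_vector_derivative - ((norm v)\<^sup>2 * gcurv (x t v) * j v h t)) (at t within ?I)" if tv: "t \<in> ?I" "v \<in> ?B" for t v h
  proof -
    have K: "cross3 (frechet_derivative nrm (at (x t v)) (p t v)) (frechet_derivative nrm (at (x t v)) (xv t v h)) = gcurv (x t v) *\<^sub>R cross3 (T t v) (blinfun_apply (cv t v) h)"
      unfolding cvDF[OF tv] T_def by (rule cross_Dnrm[OF xD[OF tv]])
    note ja = jacobi_algebra[OF Tn[OF tv] Yn[OF tv] nn[OF tv] Wn[OF tv] VW[OF tv] Sn[OF tv] Wnt[OF tv] nh0[OF tv] nh0[OF tv] K]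
    have "(j v h has_vector_derivative (blinfun_apply (cv t v) h \<bullet> (cross3 (n t v) (W t v) + cross3 (frechet_derivative nrm (at (x t v)) (p t v)) (T t v)) + blinfun_apply (Tv t v) h \<bullet> cross3 (n t v) (T t v))) (at t within ?I)"
      unfolding j_def by (rule bounded_bilinear.has_vector_derivative[OF bounded_bilinear_inner Yt[OF tv] nTt[OF tv]])
    then show "(j v h has_vector_derivative j1 v h t) (at t within ?I)"
      using ja(1) by (simp add: j1_def add.commute)
    have "(j1 v h has_vector_derivative (blinfun_apply (Tv t v) h \<bullet> (cross3 (n t v) (W t v) + cross3 (frechet_derivative nrm (at (x t v)) (p t v)) (T t v)) + blinfun_apply (Wv t v) h \<bullet> cross3 (n t v) (T t v))) (at t within ?I)"
      unfolding j1_def by (rule bounded_bilinear.has_vector_derivative[OF bounded_bilinear_inner St[OF tv] nTt[OF tv]])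
    then show "(j1 v h has_vector_derivative - ((norm v)\<^sup>2 * gcurv (x t v) * j v h t)) (at t within ?I)"
      using ja(2) by (simp add: j_def add.commute TT[OF tv] power2_norm_eq_inner)
  qed
  have T0: "T 0 v = DF x0 (A v)" if "v \<in> ?B" for v using z0[OF that] by (simp add: T_def x_def p_def)
  have lDA: "bounded_linear (\<lambda>v. DF x0 (A v))"
    using linear_compose[OF A linear_DF[OF x0]] by (simp add: o_def linear_conv_bounded_linear)
  have S0: "blinfun_apply (Tv 0 v) h = DF x0 (A h)" if v: "v \<in> ?B" for v h
  proof -
    have "(T 0 has_derivative (\<lambda>h. DF x0 (A h))) (at v)"
      by (rule has_derivative_transform_within_open[OF bounded_linear_imp_has_derivative[OF lDA] open_ball v]) (simp add: T0)
    from has_derivative_unique[OF Tv(1)[OF _ v] this] show ?thesis by simp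
  qed
  define M where "M = \<bar>gcurv x0\<bar>"
  have exp: "\<exists>\<rho>>0. \<forall>v\<in>?B. \<forall>h. 0 < norm v \<and> norm v < \<rho> \<and> v \<bullet> h = 0 \<and> norm h = norm v \<longrightarrow>
       \<bar>norm (blinfun_apply (cv 1 v) h) - (norm v - gcurv x0 * norm v ^ 3 / 6)\<bar> \<le> \<eta> * norm v ^ 3" if \<eta>: "\<eta> > 0" for \<eta>
  proof -
    define e where "e = min 1 (\<eta>/4)"
    have e: "e > 0" "e \<le> 1" "2 * e \<le> \<eta>/2" using \<eta> by (auto simp: e_def)
    obtain d where d: "d > 0" "\<And>y. y \<in> D \<Longrightarrow> dist y x0 < d \<Longrightarrow> dist (gcurv y) (gcurv x0) < e"
      using continuous_gcurv x0 e(1) unfolding continuous_on_iff by metis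
    have M0: "M \<ge> 0" by (simp add: M_def)
    \<comment> \<open>The two bounds give \<open>(M+1) * r^2 \<le> 1/2\<close> and
      \<open>2 * M * (M+1) * r^2 \<le> \<eta>/2\<close>, while \<open>2 * e\<close> takes the other
      half of \<open>\<eta>\<close>. The quotient by \<open>\<bar>C\<bar> + 1\<close> in
      \<open>\<rho>\<close> keeps the geodesic where the curvature is within \<open>e\<close> of its
      central value.\<close>
    define q where "q = min (1/(2*(M+1))) (\<eta> / (4 * (M+1) * (M+1)))"
    have q: "q > 0" unfolding q_def using M0 \<eta> by simp
    define \<rho> where "\<rho> = min (sqrt q) (d / (\<bar>C\<bar> + 1))"
    have \<rho>: "\<rho> > 0" unfolding \<rho>_def using q d(1) by simp
    show ?thesis
    proof (intro exI[of _ \<rho>] conjI ballI allI impI \<rho>)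
      fix v h :: "real^2" assume v: "v \<in> ?B" and "0 < norm v \<and> norm v < \<rho> \<and> v \<bullet> h = 0 \<and> norm h = norm v"
      then have r: "0 < norm v" "norm v < \<rho>" "v \<bullet> h = 0" "norm h = norm v" by auto
      let ?r = "norm v"
      have "?r\<^sup>2 < (sqrt q)\<^sup>2" using r(1,2) by (intro power_strict_mono) (auto simp: \<rho>_def)
      then have rq: "?r\<^sup>2 < q" using q by simp
      have "(M+1) * ?r\<^sup>2 \<le> (M+1) * (1/(2*(M+1)))" using rq M0 by (intro mult_left_mono) (auto simp: q_def)
      also have "\<dots> = 1/2" using M0 by (simp add: field_simps)
      finally have h1: "(M+1) * ?r\<^sup>2 \<le> 1/2" .
      have "2 * M * (M+1) * ?r\<^sup>2 \<le> 2 * (M+1) * (M+1) * ?r\<^sup>2" using M0 by (intro mult_right_mono) auto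
      also have "\<dots> \<le> 2 * (M+1) * (M+1) * (\<eta> / (4 * (M+1) * (M+1)))" using rq M0 by (intro mult_left_mono) (auto simp: q_def)
      also have "\<dots> = \<eta>/2"
      proof -
        have "2 * m * m * (\<eta> / (4 * m * m)) = \<eta>/2" if "m \<noteq> 0" for m :: real using that by (simp add: field_simps)
        from this[of "M + 1"] show ?thesis using M0 by simp
      qed
      finally have h2: "2 * M * (M+1) * ?r\<^sup>2 \<le> \<eta>/2" .
      have near: "\<bar>gcurv (x t v) - gcurv x0\<bar> \<le> e" if t: "t \<in> ?I" for t
      proof -
        have "dist x0 (x t v) \<le> C * ?r" using zC[OF t v] by (simp add: x_def)
        also have "\<dots> \<le> (\<bar>C\<bar> + 1) * ?r" by (intro mult_right_mono) auto
        also have "\<dots> < (\<bar>C\<bar> + 1) * (d / (\<bar>C\<bar> + 1))" using r(2) by (intro mult_strict_left_mono) (auto simp: \<rho>_def)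
        also have "\<dots> = d" by simp
        finally show ?thesis using d(2)[OF xD[OF t v]] by (simp add: dist_commute dist_real_def)
      qed
      have n0: "n 0 v = nrm x0" using z0[OF v] by (simp add: n_def x_def)
      have o: "DF x0 (A v) \<bullet> DF x0 (A h) = 0" using TS[of 0 v h] v r(3) by (simp add: T0 S0)
      have init: "j v h 0 = 0" "\<bar>j1 v h 0\<bar> = ?r\<^sup>2"
        using abs_triple[OF x0 nrm_simps(2)[OF x0] nrm_simps(2)[OF x0] o] r(4)
        by (simp_all add: j_def j1_def Y0[OF v] T0[OF v] S0[OF v] n0 iso power2_eq_square)
      have "\<bar>\<bar>j v h 1\<bar> - (?r\<^sup>2 - gcurv x0 * ?r^4 / 6)\<bar> \<le> ?r^4 * (2 * e + 2 * M * (M + 1) * ?r\<^sup>2)"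
        by (rule jacobi_estimate[OF jac(1)[OF _ v] jac(2)[OF _ v] init near _ e(2) h1]) (auto simp: M_def)
      also have "\<dots> \<le> ?r^4 * \<eta>" using e(3) h2 by (intro mult_left_mono) auto
      \<comment> \<open>By the Gauss lemma the variation field is orthogonal to the velocity of
        length \<open>?r\<close>, so \<open>j\<close> carries this extra factor; cancelling it turns
        the fourth order estimate into one of third order.\<close>
      also have "\<bar>j v h 1\<bar> = ?r * norm (blinfun_apply (cv 1 v) h)"
      proof -
        have "\<bar>blinfun_apply (cv 1 v) h \<bullet> cross3 (nrm (x 1 v)) (T 1 v)\<bar> = norm (T 1 v) * norm (blinfun_apply (cv 1 v) h)"
          by (rule abs_triple) (use xD[of 1 v] Tn[of 1 v] Yn[of 1 v h] TY[of 1 v h] v r(3) in \<open>auto simp: n_def\<close>)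
        moreover have "norm (T 1 v) = ?r" using TT[of 1 v] v by (simp add: norm_eq_sqrt_inner)
        ultimately show ?thesis by (simp add: j_def n_def)
      qed
      also have "?r * norm (blinfun_apply (cv 1 v) h) - (?r\<^sup>2 - gcurv x0 * ?r^4 / 6) = ?r * (norm (blinfun_apply (cv 1 v) h) - (?r - gcurv x0 * ?r^3 / 6))"
        by (simp add: algebra_simps power2_eq_square power3_eq_cube power4_eq_xxxx)
      finally have fin: "\<bar>?r * (norm (blinfun_apply (cv 1 v) h) - (?r - gcurv x0 * ?r^3 / 6))\<bar> \<le> ?r^4 * \<eta>" .
      have "?r^4 * \<eta> = ?r * (\<eta> * ?r^3)" by (simp add: power3_eq_cube power4_eq_xxxx)
      with fin have "?r * \<bar>norm (blinfun_apply (cv 1 v) h) - (?r - gcurv x0 * ?r^3 / 6)\<bar> \<le> ?r * (\<eta> * ?r^3)"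
        unfolding abs_mult abs_norm_cancel by metis
      then show "\<bar>norm (blinfun_apply (cv 1 v) h) - (?r - gcurv x0 * ?r^3 / 6)\<bar> \<le> \<eta> * ?r^3"
        using r(1) by simp
    qed
  qed
  define E' where "E' = (\<lambda>v. Blinfun fst o\<^sub>L zv 1 v)"
  have E'a: "blinfun_apply (E' v) = xv 1 v" for v
    by (simp add: E'_def xv_def bounded_linear_Blinfun_apply[OF bounded_linear_fst] fun_eq_iff)
  have cE': "continuous_on ?B E'"
  proof -
    have "continuous_on ?B (\<lambda>v. (\<lambda>(t,v). zv t v) (1, v))"
      by (rule continuous_on_compose2[OF czv]) (auto intro!: continuous_intros)
    then show ?thesis unfolding E'_def by (intro continuous_intros) simp
  qed
  have cvE: "DF (x 1 v) (blinfun_apply (E' v) h) = blinfun_apply (cv 1 v) h" if "v \<in> ?B" for v h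
    using cvDF[of 1 v h] that by (simp add: E'a)
  have z00: "x 1 0 = x0" using zC[of 1 0] \<delta> by (simp add: x_def)
  show ?thesis
  proof (rule that[of \<delta> E' "x 1" x p "T 1"])
    show "continuous_on ?I (\<lambda>t. p t v)" if "v \<in> ?B" for v
      by (rule continuous_on_vector_derivative[OF pt[OF _ that]])
    show "norm (DF (x t v) (p t v)) = norm v" if "t \<in> ?I" "v \<in> ?B" for t v
      using TT[OF that] by (simp add: T_def norm_eq_sqrt_inner)
    show "norm (T 1 v) = norm v" if "v \<in> ?B" for v
      using TT[of 1 v] that by (simp add: norm_eq_sqrt_inner)
    show "T 1 v \<bullet> DF (x 1 v) (blinfun_apply (E' v) h) = v \<bullet> h" if "v \<in> ?B" for v h
      using TY[of 1 v h] that cvE[OF that] by simp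
    show "(x 1 has_derivative blinfun_apply (E' v)) (at v)" if "v \<in> ?B" for v
      using xvd[of 1 v] that by (simp add: E'a)
    show "\<exists>\<rho>>0. \<forall>v\<in>?B. \<forall>h. 0 < norm v \<and> norm v < \<rho> \<and> v \<bullet> h = 0 \<and> norm h = norm v \<longrightarrow>
       \<bar>norm (DF (x 1 v) (blinfun_apply (E' v) h)) - (norm v - gcurv x0 * norm v ^ 3 / 6)\<bar> \<le> \<eta> * norm v ^ 3" if "\<eta> > 0" for \<eta>
      using exp[OF that] by (simp add: cvE)
    show "x 0 v = x0" if "v \<in> ?B" for v using z0[OF that] by (simp add: x_def)
  qed (use \<delta> cE' xD xt z00 in auto)
qed

end

section \<open>Riemannian distance near a point\<close>

lemma chart_ofD:
  assumes "chart_of X (U, \<phi>)"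
  shows "continuous_map (top_of_set (\<phi> ` U)) X (inv_into U \<phi>)" "inj_on \<phi> U" "openin X U" "open (\<phi> ` U)"
    "continuous_map (subtopology X U) (top_of_set (\<phi> ` U)) \<phi>" "U \<subseteq> topspace X"
proof -
  have o: "openin X U" and h: "homeomorphic_map (subtopology X U) (top_of_set (\<phi> ` U)) \<phi>"
    and op: "open (\<phi> ` U)" using assms by (auto simp: chart_of_def)
  then show "openin X U" "open (\<phi> ` U)" by auto
  show sub: "U \<subseteq> topspace X" using openin_subset[OF o] .
  then have tU: "topspace (subtopology X U) = U" by auto
  show inj: "inj_on \<phi> U" using homeomorphic_imp_injective_map[OF h] tU by simp
  show "continuous_map (subtopology X U) (top_of_set (\<phi> ` U)) \<phi>" by (rule homeomorphic_imp_continuous_map[OF h])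
  obtain g where g: "homeomorphic_maps (subtopology X U) (top_of_set (\<phi> ` U)) \<phi> g"
    using h homeomorphic_map_maps by blast
  then have "continuous_map (top_of_set (\<phi> ` U)) (subtopology X U) g" and gi: "\<And>x. x \<in> U \<Longrightarrow> g (\<phi> x) = x"
    using tU by (auto simp: homeomorphic_maps_def)
  then have "continuous_map (top_of_set (\<phi> ` U)) X g" by (simp add: continuous_map_in_subtopology)
  then show "continuous_map (top_of_set (\<phi> ` U)) X (inv_into U \<phi>)"
    by (rule continuous_map_eq) (use gi inj in auto)
qed

lemma C1_on_interval_cong:
  assumes "\<And>t. t \<in> {a..b} \<Longrightarrow> g t = h t" "C1_on_interval a b g"
  shows "C1_on_interval a b h"
proof -
  obtain D where D: "continuous_on {a..b} D" "\<And>t. t \<in> {a..b} \<Longrightarrow> (g has_vector_derivative D t) (at t within {a..b})"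
    using assms(2) by (auto simp: C1_on_interval_def)
  have "(h has_vector_derivative D t) (at t within {a..b})" if "t \<in> {a..b}" for t
    by (rule has_vector_derivative_transform[OF that _ D(2)[OF that]]) (simp add: assms(1))
  with D(1) show ?thesis by (auto simp: C1_on_interval_def)
qed

lemma C1_on_interval_compose:
  fixes h :: "'b::euclidean_space \<Rightarrow> 'c::real_normed_vector"
  assumes h: "smooth_on W h" and c: "C1_on_interval a b c" and im: "c ` {a..b} \<subseteq> W"
  shows "C1_on_interval a b (\<lambda>t. h (c t))"
proof -
  obtain D where D: "continuous_on {a..b} D" "\<And>t. t \<in> {a..b} \<Longrightarrow> (c has_vector_derivative D t) (at t within {a..b})"
    using c by (auto simp: C1_on_interval_def)
  obtain h' where h': "continuous_on W h'" "\<And>x. x \<in> W \<Longrightarrow> (h has_derivative blinfun_apply (h' x)) (at x)"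
    using smooth_on_C1[OF h] by metis
  have cc: "continuous_on {a..b} c" by (rule continuous_on_vector_derivative[OF D(2)])
  have "continuous_on {a..b} (\<lambda>t. h' (c t))" by (rule continuous_on_compose2[OF h'(1) cc im])
  then have "continuous_on {a..b} (\<lambda>t. blinfun_apply (h' (c t)) (D t))" by (intro continuous_intros D(1))
  moreover have "((\<lambda>t. h (c t)) has_vector_derivative blinfun_apply (h' (c t)) (D t)) (at t within {a..b})" if "t \<in> {a..b}" for t
    by (rule has_vector_derivative_compose[OF D(2)[OF that] h'(2)]) (use that im in blast)
  ultimately show ?thesis unfolding C1_on_interval_def by blast
qed

text \<open>\<open>vector_derivative\<close> at a point is two-sided and may differ from the
  one-sided derivative at the two end points, which integration ignores.\<close>

lemma C1_speed_integrable:
  fixes h :: "real \<Rightarrow> 'b::real_normed_vector"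
  assumes "C1_on_interval a b h"
  shows "(\<lambda>t. norm (vector_derivative h (at t))) integrable_on {a..b}"
proof -
  obtain D where D: "continuous_on {a..b} D" "\<And>t. t \<in> {a..b} \<Longrightarrow> (h has_vector_derivative D t) (at t within {a..b})"
    using assms by (auto simp: C1_on_interval_def)
  have "(\<lambda>t. norm (D t)) integrable_on {a..b}"
    by (intro integrable_continuous_interval continuous_on_norm D(1))
  moreover have "vector_derivative h (at t) = D t" if "t \<in> {a..b} - {a, b}" for t
  proof -
    have t: "t \<in> {a<..<b}" using that by auto
    have "(h has_vector_derivative D t) (at t within {a<..<b})"
      by (rule has_vector_derivative_within_subset[OF D(2)]) (use t in auto)
    then have "(h has_vector_derivative D t) (at t)" using at_within_open[OF t] by simp
    then show ?thesis by (rule vector_derivative_at)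
  qed
  ultimately show ?thesis
    by (intro integrable_spike_finite[of "{a,b}" "{a..b}" "\<lambda>t. norm (vector_derivative h (at t))" "\<lambda>t. norm (D t)"]) auto
qed

lemma partition_mono:
  fixes t :: "nat \<Rightarrow> real"
  assumes "\<And>i. i < n \<Longrightarrow> t i < t (Suc i)" "i \<le> j" "j \<le> n" shows "t i \<le> t j"
  using assms(2,3)
proof (induction j)
  case (Suc j)
  then show ?case using assms(1)[of j] by (cases "i = Suc j") auto
qed auto

lemma partition_interval:
  fixes t :: "nat \<Rightarrow> real"
  assumes "t 0 = 0" "t n = 1" "\<And>i. i < n \<Longrightarrow> t i < t (Suc i)" "x \<in> {0..1}" "x \<notin> t ` {..n}"
  obtains i where "i < n" "t i < x" "x < t (Suc i)"
proof -
  define k where "k = (LEAST i. x \<le> t i)"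
  have ex: "x \<le> t n" using assms by simp
  have k: "x \<le> t k" unfolding k_def by (rule LeastI[of "\<lambda>i. x \<le> t i", OF ex])
  have kn: "k \<le> n" unfolding k_def by (rule Least_le[of "\<lambda>i. x \<le> t i", OF ex])
  have ne: "x \<noteq> t i" if "i \<le> n" for i using assms(5) that by blast
  have "k \<noteq> 0"
  proof
    assume "k = 0"
    then have "x = t 0" using k assms(1,4) by simp
    then show False using ne[of 0] by simp
  qed
  then obtain m where m: "k = Suc m" using not0_implies_Suc by blast
  have "\<not> x \<le> t m" using not_less_Least[of m "\<lambda>i. x \<le> t i"] m by (simp add: k_def[symmetric])
  then show ?thesis using that[of m] m k kn ne[OF kn] by auto
qed

text \<open>Every comparison of lengths rests on this, \<open>integral\<close> being 0 by convention
  for functions that are not integrable.\<close>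

lemma surface_curve_speed_integrable:
  assumes curve: "surface_curve X A \<gamma>" and charts: "\<And>c. c \<in> A \<Longrightarrow> chart_of X c" and smf: "smooth_map A f"
  shows "(\<lambda>t. norm (vector_derivative (f \<circ> \<gamma>) (at t))) integrable_on {0..1}"
proof -
  obtain n t where t: "t 0 = 0" "t n = 1" "\<And>i. i < n \<Longrightarrow> t i < t (Suc i)"
    and pc: "\<And>i. i < n \<Longrightarrow> \<exists>(U, \<phi>)\<in>A. \<gamma> ` {t i..t (Suc i)} \<subseteq> U \<and> C1_on_interval (t i) (t (Suc i)) (\<phi> \<circ> \<gamma>)"
    using curve unfolding surface_curve_def by blast
  let ?L = "\<lambda>t. norm (vector_derivative (f \<circ> \<gamma>) (at t))"
  have piece: "?L integrable_on {t i..t (Suc i)}" if i: "i < n" for i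
  proof -
    obtain V \<psi> where V: "(V, \<psi>) \<in> A" "\<gamma> ` {t i..t (Suc i)} \<subseteq> V" "C1_on_interval (t i) (t (Suc i)) (\<psi> \<circ> \<gamma>)"
      using pc[OF i] by blast
    have inj: "inj_on \<psi> V" by (rule chart_ofD(2)[OF charts[OF V(1)]])
    have "C1_on_interval (t i) (t (Suc i)) (\<lambda>s. (f \<circ> inv_into V \<psi>) ((\<psi> \<circ> \<gamma>) s))"
    proof (rule C1_on_interval_compose[OF _ V(3)])
      show "smooth_on (\<psi> ` V) (f \<circ> inv_into V \<psi>)" using smf V(1) by (auto simp: smooth_map_def)
      show "(\<psi> \<circ> \<gamma>) ` {t i..t (Suc i)} \<subseteq> \<psi> ` V" using V(2) by auto
    qed
    then have "C1_on_interval (t i) (t (Suc i)) (f \<circ> \<gamma>)"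
      by (rule C1_on_interval_cong[rotated]) (use V(2) inj in \<open>auto simp: image_subset_iff\<close>)
    then show ?thesis by (rule C1_speed_integrable)
  qed
  have "?L integrable_on {t 0..t i}" if "i \<le> n" for i
    using that
  proof (induction i)
    case (Suc i)
    have le: "t 0 \<le> t i" by (rule partition_mono[of n t]) (use Suc t(3) in auto)
    have le': "t i \<le> t (Suc i)" using t(3)[of i] Suc by simp
    show ?case
      by (rule Henstock_Kurzweil_Integration.integrable_combine[OF le le' Suc.IH piece]) (use Suc.prems in auto)
  qed (use integrable_on_refl[of _ "t 0"] in simp)
  from this[of n] show ?thesis by (simp add: t)
qed

text \<open>Each piece of the curve is C^1 in a chart of its own, and a smooth transition map
  carries differentiability over to \<open>\<phi>\<close>; the break points make up the exceptional
  set.\<close>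

lemma surface_curve_chart_deriv:
  assumes curve: "surface_curve X A \<gamma>" and charts: "\<And>c. c \<in> A \<Longrightarrow> chart_of X c"
    and trans: "\<And>V \<psi>. (V, \<psi>) \<in> A \<Longrightarrow> smooth_on (\<psi> ` (U \<inter> V)) (\<phi> \<circ> inv_into V \<psi>)"
  obtains T where "finite T" "\<And>t. t \<in> {0<..<1} - T \<Longrightarrow> \<gamma> t \<in> U \<Longrightarrow> \<exists>c. ((\<phi> \<circ> \<gamma>) has_vector_derivative c) (at t)"
proof -
  obtain n t where t: "t 0 = 0" "t n = 1" "\<And>i. i < n \<Longrightarrow> t i < t (Suc i)"
    and pc: "\<And>i. i < n \<Longrightarrow> \<exists>(U, \<phi>)\<in>A. \<gamma> ` {t i..t (Suc i)} \<subseteq> U \<and> C1_on_interval (t i) (t (Suc i)) (\<phi> \<circ> \<gamma>)"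
    using curve unfolding surface_curve_def by blast
  show ?thesis
  proof (rule that[of "t ` {..n}"])
    fix x assume x: "x \<in> {0<..<1} - t ` {..n}" and xU: "\<gamma> x \<in> U"
    obtain i where i: "i < n" "t i < x" "x < t (Suc i)"
      by (rule partition_interval[OF t, of x]) (use x in auto)
    obtain V \<psi> where V: "(V, \<psi>) \<in> A" "\<gamma> ` {t i..t (Suc i)} \<subseteq> V" "C1_on_interval (t i) (t (Suc i)) (\<psi> \<circ> \<gamma>)"
      using pc[OF i(1)] by blast
    have inj: "inj_on \<psi> V" by (rule chart_ofD(2)[OF charts[OF V(1)]])
    obtain D where "((\<psi> \<circ> \<gamma>) has_vector_derivative D x) (at x within {t i..t (Suc i)})"
      using V(3) i(2,3) unfolding C1_on_interval_def by force
    then have "((\<psi> \<circ> \<gamma>) has_vector_derivative D x) (at x within {t i<..<t (Suc i)})"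
      by (rule has_vector_derivative_within_subset) auto
    then have d: "((\<psi> \<circ> \<gamma>) has_vector_derivative D x) (at x)" using i(2,3) by (subst (asm) at_within_open) auto
    have xV: "\<gamma> x \<in> V" using V(2) i by auto
    have "(\<phi> \<circ> inv_into V \<psi> has_derivative frechet_derivative (\<phi> \<circ> inv_into V \<psi>) (at ((\<psi> \<circ> \<gamma>) x))) (at ((\<psi> \<circ> \<gamma>) x))"
      by (rule smooth_on_has_derivative[OF trans[OF V(1)]]) (use xV xU in auto)
    from has_vector_derivative_compose[OF d this]
    have "((\<phi> \<circ> \<gamma>) has_vector_derivative frechet_derivative (\<phi> \<circ> inv_into V \<psi>) (at ((\<psi> \<circ> \<gamma>) x)) (D x)) (at x)"
      by (rule has_vector_derivative_transform_within_open[of _ _ _ "{t i<..<t (Suc i)}"])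
        (use i V(2) inj in \<open>auto simp: image_subset_iff\<close>)
    then show "\<exists>c. ((\<phi> \<circ> \<gamma>) has_vector_derivative c) (at x)" by blast
  qed simp
qed

text \<open>\<open>E\<close> is the exponential map at \<open>p\<close> in the chart \<open>(U, \<phi>)\<close>, with local inverse \<open>g\<close>; \<open>Xr\<close> and \<open>Pr\<close> are
  the radial geodesics and their velocities, and \<open>\<tau> v\<close> is the velocity in space at the end point \<open>E v\<close>.\<close>

locale polar_chart =
  fixes X :: "'a topology" and A :: "'a chart set" and f :: "'a \<Rightarrow> real^3" and U :: "'a set" and \<phi> :: "'a \<Rightarrow> real^2" and p :: 'a
    and E g :: "real^2 \<Rightarrow> real^2" and E' :: "real^2 \<Rightarrow> ((real^2) \<Rightarrow>\<^sub>L (real^2))"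
    and Xr Pr :: "real \<Rightarrow> real^2 \<Rightarrow> real^2" and \<tau> :: "real^2 \<Rightarrow> real^3" and U' V :: "(real^2) set" and s :: real
  assumes haus: "Hausdorff_space X" and charts: "\<And>c. c \<in> A \<Longrightarrow> chart_of X c" and UA: "(U, \<phi>) \<in> A" and pU: "p \<in> U"
    and smf: "smooth_map A f"
    and trans: "\<And>V \<psi>. (V, \<psi>) \<in> A \<Longrightarrow> smooth_on (\<psi> ` (U \<inter> V)) (\<phi> \<circ> inv_into V \<psi>)"
    and U': "open U'" "cball 0 s \<subseteq> U'" "s > 0" and V: "open V" "V \<subseteq> \<phi> ` U"
    and hom: "homeomorphism U' V E g" and E0: "E 0 = \<phi> p"
    and dE: "\<And>v. v \<in> U' \<Longrightarrow> (E has_derivative blinfun_apply (E' v)) (at v)" and cE': "continuous_on U' E'"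
    and dg: "\<And>y. y \<in> V \<Longrightarrow> (g has_derivative inv (blinfun_apply (E' (g y)))) (at y)"
    and bij: "\<And>y. y \<in> V \<Longrightarrow> bij (blinfun_apply (E' (g y)))"
    and X0: "\<And>v. v \<in> U' \<Longrightarrow> Xr 0 v = \<phi> p" and X1: "\<And>v. Xr 1 v = E v"
    and XU: "\<And>t v. t \<in> {0..1} \<Longrightarrow> v \<in> U' \<Longrightarrow> Xr t v \<in> \<phi> ` U"
    and dX: "\<And>t v. t \<in> {0..1} \<Longrightarrow> v \<in> U' \<Longrightarrow> ((\<lambda>t. Xr t v) has_vector_derivative Pr t v) (at t within {0..1})"
    and cP: "\<And>v. v \<in> U' \<Longrightarrow> continuous_on {0..1} (\<lambda>t. Pr t v)"
    and speedX: "\<And>t v. t \<in> {0..1} \<Longrightarrow> v \<in> U' \<Longrightarrow> norm (frechet_derivative (f \<circ> inv_into U \<phi>) (at (Xr t v)) (Pr t v)) = norm v"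
    and norm_\<tau>: "\<And>v. v \<in> U' \<Longrightarrow> norm (\<tau> v) = norm v"
    and gauss: "\<And>v h. v \<in> U' \<Longrightarrow> \<tau> v \<bullet> frechet_derivative (f \<circ> inv_into U \<phi>) (at (E v)) (blinfun_apply (E' v) h) = v \<bullet> h"
begin

section \<open>Normal coordinates and the lower bound on lengths\<close>

abbreviation "F \<equiv> f \<circ> inv_into U \<phi>"
abbreviation "dF x \<equiv> frechet_derivative F (at x)"
text \<open>The exponential map into the surface itself; \<open>w\<close> gives the normal
  coordinates, inverting \<open>\<sigma>\<close> on the image of \<open>U'\<close>.\<close>

definition "\<sigma> v = inv_into U \<phi> (E v)"
definition "w q = g (\<phi> q)"
abbreviation "speed \<gamma> t \<equiv> norm (vector_derivative (f \<circ> \<gamma>) (at t))"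

lemmas chartU = chart_ofD[OF charts[OF UA]]

lemma dF: "x \<in> \<phi> ` U \<Longrightarrow> (F has_derivative dF x) (at x)"
  using smf UA smooth_on_has_derivative[of "\<phi> ` U" F x] by (auto simp: smooth_map_def)

lemma E_in: "v \<in> U' \<Longrightarrow> E v \<in> V" "y \<in> V \<Longrightarrow> g y \<in> U'" "v \<in> U' \<Longrightarrow> g (E v) = v" "y \<in> V \<Longrightarrow> E (g y) = y"
  using hom by (auto simp: homeomorphism_def)

lemma EU: "v \<in> U' \<Longrightarrow> E v \<in> \<phi> ` U" using E_in V by blast

lemma \<sigma>_simps: assumes "v \<in> U'" shows "\<sigma> v \<in> U" "\<phi> (\<sigma> v) = E v" "w (\<sigma> v) = v" "f (\<sigma> v) = F (E v)"
  using EU[OF assms] E_in(3)[OF assms] by (auto simp: \<sigma>_def w_def f_inv_into_f inv_into_into)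

lemma image_\<sigma>_iff: assumes "S \<subseteq> U'" shows "q \<in> \<sigma> ` S \<longleftrightarrow> q \<in> U \<and> \<phi> q \<in> V \<and> w q \<in> S"
proof
  assume "q \<in> \<sigma> ` S"
  then show "q \<in> U \<and> \<phi> q \<in> V \<and> w q \<in> S" using \<sigma>_simps E_in(1) assms by auto
next
  assume q: "q \<in> U \<and> \<phi> q \<in> V \<and> w q \<in> S"
  then have "\<sigma> (w q) = q" using chartU(2) E_in(4) by (simp add: \<sigma>_def w_def)
  then show "q \<in> \<sigma> ` S" using q by (metis imageI)
qed

lemma \<sigma>_w: "q \<in> \<sigma> ` S \<Longrightarrow> S \<subseteq> U' \<Longrightarrow> \<sigma> (w q) = q"
  using \<sigma>_simps(3) by auto

lemma continuous_\<sigma>: "continuous_map (top_of_set U') X \<sigma>"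
proof -
  have "continuous_on U' E" using hom by (simp add: homeomorphism_def)
  then have "continuous_map (top_of_set U') (top_of_set (\<phi> ` U)) E" using EU by (auto simp: continuous_map_in_subtopology)
  from continuous_map_compose[OF this chartU(1)] show ?thesis by (simp add: o_def \<sigma>_def[abs_def])
qed

text \<open>Here the Hausdorff property enters: the image of the closed disc is compact, hence
  closed in the whole surface, so a curve cannot leave it at a limit of points inside.\<close>

lemma closed_\<sigma>: assumes "cball 0 r \<subseteq> U'" shows "closedin X (\<sigma> ` cball 0 r)"
proof (rule compactin_imp_closedin[OF haus])
  have "compactin (top_of_set U') (cball 0 r)" using assms by (simp add: compactin_subtopology)
  then show "compactin X (\<sigma> ` cball 0 r)" by (rule image_compactin[OF _ continuous_\<sigma>])
qed

lemma open_\<sigma>: assumes "ball 0 r \<subseteq> U'" shows "openin X (\<sigma> ` ball 0 r)"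
proof -
  have "continuous_on V g" using hom by (simp add: homeomorphism_def)
  then have o: "open (V \<inter> g -` ball 0 r)" by (rule continuous_open_preimage) (use V in auto)
  then have "openin (top_of_set (\<phi> ` U)) (V \<inter> g -` ball 0 r)" using V(2) by (intro open_subset) auto
  from openin_continuous_map_preimage[OF chartU(5) this]
  have "openin X {x \<in> topspace (subtopology X U). \<phi> x \<in> V \<inter> g -` ball 0 r}"
    by (rule openin_trans_full[OF _ chartU(3)])
  also have "{x \<in> topspace (subtopology X U). \<phi> x \<in> V \<inter> g -` ball 0 r} = \<sigma> ` ball 0 r"
    by (rule set_eqI, simp only: image_\<sigma>_iff[OF assms]) (use chartU(6) in \<open>auto simp: w_def\<close>)
  finally show ?thesis .
qed

lemma balls: "r \<le> s \<Longrightarrow> cball 0 r \<subseteq> U'" "r \<le> s \<Longrightarrow> ball 0 r \<subseteq> U'"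
  using U'(2) by auto

lemma p_\<sigma>: "p = \<sigma> 0" "w p = 0"
proof -
  have 0: "0 \<in> U'" using U' by auto
  show "p = \<sigma> 0" using chartU(2) pU by (simp add: \<sigma>_def E0)
  then show "w p = 0" using \<sigma>_simps(3)[OF 0] by simp
qed

lemma curve_chart_continuous:
  assumes "surface_curve X A \<gamma>" "S \<subseteq> {0..1}" "\<gamma> ` S \<subseteq> U" shows "continuous_on S (\<phi> \<circ> \<gamma>)"
proof -
  have "continuous_map (top_of_set {0..1}) X \<gamma>" using assms(1) by (simp add: surface_curve_def pathin_def)
  then have "continuous_map (top_of_set S) X \<gamma>" by (rule continuous_map_from_subtopology_mono[OF _ assms(2)])
  then have "continuous_map (top_of_set S) (subtopology X U) \<gamma>" by (rule continuous_map_into_subtopology) (use assms(3) in auto)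
  from continuous_map_compose[OF this chartU(5)] show ?thesis by (simp add: continuous_map_in_subtopology)
qed

lemma curve_w_continuous:
  assumes "surface_curve X A \<gamma>" "S \<subseteq> {0..1}" "\<gamma> ` S \<subseteq> \<sigma> ` U'" shows "continuous_on S (\<lambda>t. w (\<gamma> t))"
proof -
  have q: "\<gamma> t \<in> U \<and> \<phi> (\<gamma> t) \<in> V" if "t \<in> S" for t
    using assms(3) that image_\<sigma>_iff[of U'] by blast
  have "continuous_on S (\<phi> \<circ> \<gamma>)" by (rule curve_chart_continuous[OF assms(1,2)]) (use q in auto)
  moreover have "continuous_on V g" using hom by (simp add: homeomorphism_def)
  ultimately show ?thesis unfolding w_def using q continuous_on_compose2[of V g S "\<phi> \<circ> \<gamma>"] by auto
qed

text \<open>Expresses the velocity in space through the differential of the exponential map, the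
  form to which the Gauss lemma applies.\<close>

lemma curve_w_deriv:
  assumes c: "((\<phi> \<circ> \<gamma>) has_vector_derivative c) (at t)" and I: "open I" "t \<in> I" "\<And>t. t \<in> I \<Longrightarrow> \<gamma> t \<in> \<sigma> ` U'"
  obtains w' where "((\<lambda>t. w (\<gamma> t)) has_vector_derivative w') (at t)"
    "vector_derivative (f \<circ> \<gamma>) (at t) = dF (E (w (\<gamma> t))) (blinfun_apply (E' (w (\<gamma> t))) w')"
proof -
  have q: "\<gamma> t \<in> U \<and> \<phi> (\<gamma> t) \<in> V" if "t \<in> I" for t
    using I(3)[OF that] image_\<sigma>_iff[of U'] by blast
  note qt = q[OF I(2)]
  have Ew: "E (w (\<gamma> t)) = \<phi> (\<gamma> t)" using qt E_in(4) by (simp add: w_def)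
  have dgt: "(g has_derivative inv (blinfun_apply (E' (w (\<gamma> t))))) (at ((\<phi> \<circ> \<gamma>) t))" using dg[of "\<phi> (\<gamma> t)"] qt by (simp add: w_def)
  have dFt: "(F has_derivative dF (\<phi> (\<gamma> t))) (at ((\<phi> \<circ> \<gamma>) t))" using dF[of "\<phi> (\<gamma> t)"] qt by simp
  have "((\<lambda>t. F ((\<phi> \<circ> \<gamma>) t)) has_vector_derivative dF (\<phi> (\<gamma> t)) c) (at t)" by (rule has_vector_derivative_compose[OF c dFt])
  then have "((f \<circ> \<gamma>) has_vector_derivative dF (\<phi> (\<gamma> t)) c) (at t)"
    by (rule has_vector_derivative_transform_within_open[OF _ I(1,2)]) (use q chartU(2) in auto)
  then have vd: "vector_derivative (f \<circ> \<gamma>) (at t) = dF (\<phi> (\<gamma> t)) c" by (rule vector_derivative_at)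
  show ?thesis
  proof (rule that)
    show "((\<lambda>t. w (\<gamma> t)) has_vector_derivative inv (blinfun_apply (E' (w (\<gamma> t)))) c) (at t)"
      unfolding w_def using has_vector_derivative_compose[OF c dgt] by (simp add: w_def)
    have "blinfun_apply (E' (w (\<gamma> t))) (inv (blinfun_apply (E' (w (\<gamma> t)))) c) = c"
      using bij[of "\<phi> (\<gamma> t)"] qt by (simp add: w_def bij_is_surj surj_f_inv_f)
    then show "vector_derivative (f \<circ> \<gamma>) (at t) = dF (E (w (\<gamma> t))) (blinfun_apply (E' (w (\<gamma> t))) (inv (blinfun_apply (E' (w (\<gamma> t)))) c))"
      using vd Ew by simp
  qed
qed

lemma curve_chart_deriv:
  assumes "surface_curve X A \<gamma>"
  obtains T where "finite T" "\<And>t. t \<in> {0<..<1} - T \<Longrightarrow> \<gamma> t \<in> U \<Longrightarrow> \<exists>c. ((\<phi> \<circ> \<gamma>) has_vector_derivative c) (at t)"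
  by (rule surface_curve_chart_deriv[OF assms charts trans], assumption, assumption) (rule that)

lemma speed_integrable:
  assumes "surface_curve X A \<gamma>" shows "speed \<gamma> integrable_on {0..1}"
  by (rule surface_curve_speed_integrable[OF assms charts smf])

text \<open>Regularizing the radius to \<open>sqrt (|w|\<^sup>2 + \<epsilon>\<^sup>2)\<close> avoids its singularity at the center.\<close>

lemma radius_le_length:
  assumes \<gamma>: "surface_curve X A \<gamma>" "\<gamma> 0 = p" and b: "b \<in> {0..1}" and N: "\<And>t. t \<in> {0..b} \<Longrightarrow> \<gamma> t \<in> \<sigma> ` U'"
  shows "norm (w (\<gamma> b)) \<le> integral {0..b} (speed \<gamma>)"
proof (rule field_le_epsilon)
  fix e :: real assume e: "e > 0"
  let ?W = "\<lambda>t. w (\<gamma> t)"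
  define h where "h = (\<lambda>t. sqrt (?W t \<bullet> ?W t + e\<^sup>2))"
  have pos: "?W t \<bullet> ?W t + e\<^sup>2 > 0" for t using e by (simp add: add_nonneg_pos)
  have hW: "norm (?W t) \<le> h t" for t
    unfolding h_def norm_eq_sqrt_inner by (rule real_sqrt_le_mono) simp
  have hpos: "h t > 0" for t unfolding h_def using pos by simp
  obtain T where T: "finite T" "\<And>t. t \<in> {0<..<1} - T \<Longrightarrow> \<gamma> t \<in> U \<Longrightarrow> \<exists>c. ((\<phi> \<circ> \<gamma>) has_vector_derivative c) (at t)"
    using curve_chart_deriv[OF \<gamma>(1)] by blast
  have ex: "\<exists>h'. (h has_vector_derivative h') (at t) \<and> h' \<le> speed \<gamma> t" if t: "t \<in> {0<..<b} - T" for t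
  proof -
    have tU: "\<gamma> t \<in> U" using N[of t] t image_\<sigma>_iff[of U'] by auto
    obtain c where c: "((\<phi> \<circ> \<gamma>) has_vector_derivative c) (at t)" using T(2)[of t] t b tU by auto
    obtain w' where w': "(?W has_vector_derivative w') (at t)"
      "vector_derivative (f \<circ> \<gamma>) (at t) = dF (E (?W t)) (blinfun_apply (E' (?W t)) w')"
      by (rule curve_w_deriv[OF c, of "{0<..<b}"]) (use t N in auto)
    have Wt: "?W t \<in> U'" using N[of t] t image_\<sigma>_iff[of U'] by auto
    have "((\<lambda>t. ?W t \<bullet> ?W t + e\<^sup>2) has_real_derivative (?W t \<bullet> w' + w' \<bullet> ?W t)) (at t)"
      using has_vector_derivative_add[OF bounded_bilinear.has_vector_derivative[OF bounded_bilinear_inner w'(1) w'(1)] has_vector_derivative_const[of "e\<^sup>2"]]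
      by (simp add: has_real_derivative_iff_has_vector_derivative)
    from DERIV_chain2[OF DERIV_real_sqrt[OF pos] this]
    have "(h has_real_derivative (inverse (sqrt (?W t \<bullet> ?W t + e\<^sup>2)) / 2) * (?W t \<bullet> w' + w' \<bullet> ?W t)) (at t)"
      unfolding h_def .
    then have d: "(h has_vector_derivative (?W t \<bullet> w') / h t) (at t)"
      by (simp add: has_real_derivative_iff_has_vector_derivative h_def inner_commute field_simps)
    \<comment> \<open>The Gauss lemma turns the radial derivative into a product with
      \<open>\<tau>\<close>, whose length is the radius; Cauchy-Schwarz then bounds the growth of
      the radius by the speed.\<close>
    have "?W t \<bullet> w' = \<tau> (?W t) \<bullet> vector_derivative (f \<circ> \<gamma>) (at t)" using gauss[OF Wt] w'(2) by simp
    also have "\<dots> \<le> norm (?W t) * speed \<gamma> t" using norm_cauchy_schwarz[of "\<tau> (?W t)"] norm_\<tau>[OF Wt] by metis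
    also have "\<dots> \<le> h t * speed \<gamma> t" by (rule mult_right_mono[OF hW]) simp
    finally have "(?W t \<bullet> w') / h t \<le> speed \<gamma> t" using hpos[of t] by (simp add: field_simps)
    with d show ?thesis by blast
  qed
  define S where "S = T \<union> {0, b}"
  \<comment> \<open>At the finitely many exceptional points any value up to the speed will do, and 0
    is one since the speed is a norm; this gives an integrand dominated everywhere on the
    interval.\<close>
  have exS: "\<exists>h'. t \<in> {0..b} \<longrightarrow> (t \<notin> S \<longrightarrow> (h has_vector_derivative h') (at t)) \<and> h' \<le> speed \<gamma> t" for t
  proof (cases "t \<in> {0..b} - S")
    case True
    then have "t \<in> {0<..<b} - T" by (auto simp: S_def)
    then show ?thesis using ex by blast
  next
    case False
    then show ?thesis by (intro exI[of _ 0]) auto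
  qed
  define h' where "h' = (\<lambda>t. SOME h'. t \<in> {0..b} \<longrightarrow> (t \<notin> S \<longrightarrow> (h has_vector_derivative h') (at t)) \<and> h' \<le> speed \<gamma> t)"
  have h': "t \<in> {0..b} \<longrightarrow> (t \<notin> S \<longrightarrow> (h has_vector_derivative h' t) (at t)) \<and> h' t \<le> speed \<gamma> t" for t
    unfolding h'_def by (rule someI_ex[OF exS])
  have "continuous_on {0..b} ?W"
    by (rule curve_w_continuous[OF \<gamma>(1)]) (use b N in auto)
  then have ch: "continuous_on {0..b} h" unfolding h_def by (intro continuous_intros)
  have "(h' has_integral (h b - h 0)) {0..b}"
  proof (rule fundamental_theorem_of_calculus_interior_strong[of S])
    show "finite S" using T by (simp add: S_def)
    show "(h has_vector_derivative h' t) (at t)" if "t \<in> {0<..<b} - S" for t using h'[of t] that by auto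
  qed (use b ch in auto)
  moreover have "speed \<gamma> integrable_on {0..b}"
    by (rule integrable_on_subinterval[OF speed_integrable[OF \<gamma>(1)]]) (use b in auto)
  then have "(speed \<gamma> has_integral (integral {0..b} (speed \<gamma>))) {0..b}" by (rule integrable_integral)
  ultimately have "h b - h 0 \<le> integral {0..b} (speed \<gamma>)"
    by (rule has_integral_le) (use h' in auto)
  moreover have "h 0 = e" unfolding h_def using p_\<sigma>(2) \<gamma>(2) e by simp
  ultimately show "norm (w (\<gamma> b)) \<le> integral {0..b} (speed \<gamma>) + e" using hW[of b] by linarith
qed

text \<open>A curve that stays in the disc is covered by the radius bound. Otherwise, were its
  length below \<open>s\<close>, the radius bound would keep it, up to the first time outside the
  open disc, in the closed disc of radius its length; by closedness it would still be there at that
  time, a contradiction.\<close>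

lemma min_radius_le_length:
  assumes \<gamma>: "surface_curve X A \<gamma>" "\<gamma> 0 = p"
  shows "\<gamma> 1 \<in> \<sigma> ` ball 0 s \<and> norm (w (\<gamma> 1)) \<le> curve_length f \<gamma> \<or> s \<le> curve_length f \<gamma>"
proof (cases "\<forall>t\<in>{0..1}. \<gamma> t \<in> \<sigma> ` ball 0 s")
  case True
  then have "norm (w (\<gamma> 1)) \<le> integral {0..1} (speed \<gamma>)"
    by (intro radius_le_length[OF \<gamma>]) (simp, use balls(2)[of s, OF order_refl] in blast)
  then show ?thesis using True by (simp add: curve_length_def)
next
  case False
  let ?l = "curve_length f \<gamma>"
  have cm: "continuous_map (top_of_set {0..1}) X \<gamma>" using \<gamma>(1) by (simp add: surface_curve_def pathin_def)
  have Xg: "\<gamma> t \<in> topspace X" if "t \<in> {0..1}" for t using continuous_map_image_subset_topspace[OF cm] that by auto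
  define B where "B = {t \<in> {0..1}. \<gamma> t \<notin> \<sigma> ` ball 0 s}"
  have "closedin (top_of_set {0..1}) {t \<in> topspace (top_of_set {0..1}). \<gamma> t \<in> topspace X - \<sigma> ` ball 0 s}"
    by (rule closedin_continuous_map_preimage[OF cm]) (use open_\<sigma>[OF balls(2)[of s]] in auto)
  moreover have "{t \<in> topspace (top_of_set {0..1}). \<gamma> t \<in> topspace X - \<sigma> ` ball 0 s} = B"
    using Xg by (auto simp: B_def)
  ultimately have cB: "closed B" using closedin_closed_eq[of "{0..1::real}" B] by simp
  have Bne: "B \<noteq> {}" using False by (auto simp: B_def)
  have Bb: "bdd_below B" by (rule bdd_belowI[of _ 0]) (auto simp: B_def)
  \<comment> \<open>The first time outside the open disc; it is attained because the image of the
    open disc is open in the surface, which makes \<open>B\<close> closed.\<close>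
  define b where "b = Inf B"
  have bB: "b \<in> B" unfolding b_def by (rule closed_contains_Inf[OF Bne Bb cB])
  then have b01: "b \<in> {0..1}" and bN: "\<gamma> b \<notin> \<sigma> ` ball 0 s" by (auto simp: B_def)
  have before: "\<gamma> t \<in> \<sigma> ` ball 0 s" if "0 \<le> t" "t < b" for t
  proof (rule ccontr)
    assume "\<gamma> t \<notin> \<sigma> ` ball 0 s"
    then have "t \<in> B" using that b01 by (auto simp: B_def)
    then have "b \<le> t" unfolding b_def by (rule cInf_lower[OF _ Bb])
    then show False using that by simp
  qed
  have b0: "b > 0"
  proof (rule ccontr)
    assume "\<not> b > 0"
    then have "b = 0" using b01 by simp
    moreover have "p \<in> \<sigma> ` ball 0 s" using p_\<sigma>(1) U'(3) by auto
    ultimately show False using bN \<gamma>(2) by simp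
  qed
  have "s \<le> ?l"
  proof (rule ccontr)
    assume ls: "\<not> s \<le> ?l"
    have l0: "0 \<le> ?l" unfolding curve_length_def by (rule integral_nonneg[OF speed_integrable[OF \<gamma>(1)]]) simp
    have lt: "\<gamma> t \<in> \<sigma> ` cball 0 ?l" if t: "0 \<le> t" "t < b" for t
    proof -
      have t01: "t \<in> {0..1}" using t b01 by auto
      have "norm (w (\<gamma> t)) \<le> integral {0..t} (speed \<gamma>)"
        by (rule radius_le_length[OF \<gamma> t01]) (use before t balls[of s] in force)
      also have "\<dots> \<le> ?l" unfolding curve_length_def
        by (rule integral_subset_le) (use t01 speed_integrable[OF \<gamma>(1)] in \<open>auto intro: integrable_on_subinterval[OF speed_integrable[OF \<gamma>(1)]]\<close>)
      finally have "w (\<gamma> t) \<in> cball 0 ?l" by simp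
      moreover have "\<sigma> (w (\<gamma> t)) = \<gamma> t" by (rule \<sigma>_w[OF before[OF t]]) (use balls[of s] in auto)
      ultimately show ?thesis by (metis imageI)
    qed
    have "closedin X (\<sigma> ` cball 0 ?l)" by (rule closed_\<sigma>) (use ls balls in auto)
    then have "closedin (top_of_set {0..1}) {t \<in> topspace (top_of_set {0..1}). \<gamma> t \<in> \<sigma> ` cball 0 ?l}"
      by (rule closedin_continuous_map_preimage[OF cm])
    then have "closed {t \<in> {0..1}. \<gamma> t \<in> \<sigma> ` cball 0 ?l}" using closedin_closed_eq[of "{0..1::real}"] by simp
    moreover have "{0..<b} \<subseteq> {t \<in> {0..1}. \<gamma> t \<in> \<sigma> ` cball 0 ?l}" using lt b01 by auto
    ultimately have "closure {0..<b} \<subseteq> {t \<in> {0..1}. \<gamma> t \<in> \<sigma> ` cball 0 ?l}" by (rule closure_minimal[rotated])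
    moreover have "b \<in> closure {0..<b}" using b0 by simp
    ultimately have "\<gamma> b \<in> \<sigma> ` cball 0 ?l" by blast
    moreover have "cball 0 ?l \<subseteq> (ball 0 s :: (real^2) set)" using ls by auto
    ultimately show False using bN by blast
  qed
  then show ?thesis ..
qed

lemma surface_curve_in_chart:
  assumes "C1_on_interval 0 1 c" "c ` {0..1} \<subseteq> \<phi> ` U" shows "surface_curve X A (inv_into U \<phi> \<circ> c)"
proof -
  obtain D where D: "continuous_on {0..1} D" "\<And>t. t \<in> {0..1} \<Longrightarrow> (c has_vector_derivative D t) (at t within {0..1})"
    using assms(1) by (auto simp: C1_on_interval_def)
  have "continuous_on {0..1} c" by (rule continuous_on_vector_derivative[OF D(2)])
  then have "continuous_map (top_of_set {0..1}) (top_of_set (\<phi> ` U)) c" using assms(2) by (auto simp: continuous_map_in_subtopology)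
  from continuous_map_compose[OF this chartU(1)] have "pathin X (inv_into U \<phi> \<circ> c)" by (simp add: pathin_def)
  moreover have "C1_on_interval 0 1 (\<phi> \<circ> (inv_into U \<phi> \<circ> c))"
    by (rule C1_on_interval_cong[OF _ assms(1)]) (use assms(2) in \<open>auto simp: f_inv_into_f image_subset_iff\<close>)
  moreover have "(inv_into U \<phi> \<circ> c) ` {0..1} \<subseteq> U" using assms(2) by (auto intro!: inv_into_into)
  ultimately have "\<exists>n (t::nat \<Rightarrow> real). t 0 = 0 \<and> t n = 1 \<and>
       (\<forall>i<n. t i < t (Suc i) \<and> (\<exists>(V, \<psi>)\<in>A. (inv_into U \<phi> \<circ> c) ` {t i..t (Suc i)} \<subseteq> V \<and> C1_on_interval (t i) (t (Suc i)) (\<psi> \<circ> (inv_into U \<phi> \<circ> c))))"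
    using UA by (intro exI[of _ 1] exI[of _ real]) auto
  with \<open>pathin X _\<close> show ?thesis unfolding surface_curve_def by blast
qed

text \<open>Constant speed \<open>norm v\<close> over unit time: the radial geodesic attains the
  lower bound on length.\<close>

lemma radial_curve:
  assumes v: "v \<in> U'"
  shows "surface_curve X A (inv_into U \<phi> \<circ> (\<lambda>t. Xr t v))" "(inv_into U \<phi> \<circ> (\<lambda>t. Xr t v)) 0 = p"
    "(inv_into U \<phi> \<circ> (\<lambda>t. Xr t v)) 1 = \<sigma> v" "curve_length f (inv_into U \<phi> \<circ> (\<lambda>t. Xr t v)) = norm v"
proof -
  have "C1_on_interval 0 1 (\<lambda>t. Xr t v)"
    unfolding C1_on_interval_def using cP[OF v] dX[OF _ v] by blast
  then show "surface_curve X A (inv_into U \<phi> \<circ> (\<lambda>t. Xr t v))" by (rule surface_curve_in_chart) (use XU[OF _ v] in auto)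
  show "(inv_into U \<phi> \<circ> (\<lambda>t. Xr t v)) 0 = p" using X0[OF v] chartU(2) pU by simp
  show "(inv_into U \<phi> \<circ> (\<lambda>t. Xr t v)) 1 = \<sigma> v" by (simp add: X1 \<sigma>_def)
  let ?c = "f \<circ> (inv_into U \<phi> \<circ> (\<lambda>t. Xr t v))"
  have sp: "norm (vector_derivative ?c (at t)) = norm v" if t: "t \<in> {0..1} - {0,1}" for t
  proof -
    have t': "t \<in> {0<..<1}" using t by auto
    have "((\<lambda>t. Xr t v) has_vector_derivative Pr t v) (at t within {0<..<1})"
      by (rule has_vector_derivative_within_subset[OF dX[OF _ v]]) (use t in auto)
    then have d: "((\<lambda>t. Xr t v) has_vector_derivative Pr t v) (at t)" using at_within_open[OF t'] by simp
    have "((\<lambda>t. F (Xr t v)) has_vector_derivative dF (Xr t v) (Pr t v)) (at t)"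
      by (rule has_vector_derivative_compose[OF d dF[OF XU[OF _ v]]]) (use t in auto)
    then have "vector_derivative ?c (at t) = dF (Xr t v) (Pr t v)" by (intro vector_derivative_at) (simp add: o_def)
    then show ?thesis using speedX[of t v] t v by simp
  qed
  have "((\<lambda>t. norm v) has_integral (1 - 0) *\<^sub>R norm v) {0..1::real}" using has_integral_const_real[of "norm v" 0 1] by simp
  then have "((\<lambda>t. norm (vector_derivative ?c (at t))) has_integral (1 - 0) *\<^sub>R norm v) {0..1::real}"
    by (rule has_integral_spike_finite[of "{0,1}", rotated 2]) (use sp in auto)
  then show "curve_length f (inv_into U \<phi> \<circ> (\<lambda>t. Xr t v)) = norm v"
    unfolding curve_length_def by (simp add: integral_unique)
qed

text \<open>Inside the disc the distance from \<open>p\<close> equals the radius in normal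
  coordinates, attained by radial geodesics; every point outside is at distance at least
  \<open>s > r\<close>, so the level set has no further points.\<close>

lemma geodesic_circle_boundary_eq:
  assumes r: "0 < r" "r < s"
  shows "geodesic_circle_boundary X A f p r = \<sigma> ` sphere 0 r"
proof -
  have inside: "riemannian_dist X A f p (\<sigma> v) = ereal (norm v)" if v: "v \<in> ball 0 s" for v
    unfolding riemannian_dist_def
  proof (rule antisym)
    have vU: "v \<in> U'" using v balls[of s] by blast
    show "(INF \<gamma>\<in>{\<gamma>. surface_curve X A \<gamma> \<and> \<gamma> 0 = p \<and> \<gamma> 1 = \<sigma> v}. ereal (curve_length f \<gamma>)) \<le> ereal (norm v)"
      using radial_curve[OF vU] by (intro INF_lower2[of "inv_into U \<phi> \<circ> (\<lambda>t. Xr t v)"]) auto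
    show "ereal (norm v) \<le> (INF \<gamma>\<in>{\<gamma>. surface_curve X A \<gamma> \<and> \<gamma> 0 = p \<and> \<gamma> 1 = \<sigma> v}. ereal (curve_length f \<gamma>))"
    proof (rule INF_greatest)
      fix \<gamma> assume "\<gamma> \<in> {\<gamma>. surface_curve X A \<gamma> \<and> \<gamma> 0 = p \<and> \<gamma> 1 = \<sigma> v}"
      then have g: "surface_curve X A \<gamma>" "\<gamma> 0 = p" "\<gamma> 1 = \<sigma> v" by auto
      have "norm v \<le> curve_length f \<gamma>" using min_radius_le_length[OF g(1,2)] v by (auto simp: g(3) \<sigma>_simps(3)[OF vU])
      then show "ereal (norm v) \<le> ereal (curve_length f \<gamma>)" by simp
    qed
  qed
  have outside: "ereal s \<le> riemannian_dist X A f p q" if q: "q \<notin> \<sigma> ` ball 0 s" for q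
    unfolding riemannian_dist_def
  proof (rule INF_greatest)
    fix \<gamma> assume "\<gamma> \<in> {\<gamma>. surface_curve X A \<gamma> \<and> \<gamma> 0 = p \<and> \<gamma> 1 = q}"
    then have g: "surface_curve X A \<gamma>" "\<gamma> 0 = p" "\<gamma> 1 = q" by auto
    then show "ereal s \<le> ereal (curve_length f \<gamma>)" using min_radius_le_length[OF g(1,2)] q by auto
  qed
  show ?thesis
  proof (intro set_eqI iffI)
    fix q assume "q \<in> geodesic_circle_boundary X A f p r"
    then have d: "riemannian_dist X A f p q = ereal r" by (simp add: geodesic_circle_boundary_def)
    have "q \<in> \<sigma> ` ball 0 s"
    proof (rule ccontr)
      assume "q \<notin> \<sigma> ` ball 0 s"
      from outside[OF this] show False using d r by simp
    qed
    then obtain v where v: "v \<in> ball 0 s" "q = \<sigma> v" by blast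
    with inside[OF v(1)] d have "norm v = r" by simp
    then show "q \<in> \<sigma> ` sphere 0 r" using v by auto
  next
    fix q assume "q \<in> \<sigma> ` sphere 0 r"
    then obtain v where v: "norm v = r" "q = \<sigma> v" by auto
    have vs: "v \<in> ball 0 s" using v r by simp
    have "q \<in> topspace X" using \<sigma>_simps(1)[of v] chartU(6) vs balls[of s] v(2) by blast
    then show "q \<in> geodesic_circle_boundary X A f p r"
      using inside[OF vs] v by (simp add: geodesic_circle_boundary_def)
  qed
qed

end

section \<open>Length of geodesic circles\<close>

definition circ :: "real \<Rightarrow> real^2" where "circ \<theta> = vector [cos \<theta>, sin \<theta>]"
definition dcirc :: "real \<Rightarrow> real^2" where "dcirc \<theta> = vector [- sin \<theta>, cos \<theta>]"

lemma circ_alt: "circ \<theta> = cos \<theta> *\<^sub>R axis 1 1 + sin \<theta> *\<^sub>R axis 2 1" "dcirc \<theta> = (- sin \<theta>) *\<^sub>R axis 1 1 + cos \<theta> *\<^sub>R axis 2 1"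
  by (simp_all add: circ_def dcirc_def vec_eq_iff forall_2 axis_def)

lemma circ_deriv: "(circ has_vector_derivative dcirc \<theta>) (at \<theta> within S)"
  unfolding circ_alt[abs_def]
  by (auto intro!: derivative_eq_intros has_vector_derivative_scaleR simp: has_real_derivative_iff_has_vector_derivative[symmetric])

lemma continuous_circ: "continuous_on S circ" "continuous_on S dcirc"
  unfolding circ_alt[abs_def] by (intro continuous_intros)+

lemma circ_norm: "norm (circ \<theta>) = 1" "norm (dcirc \<theta>) = 1" "circ \<theta> \<bullet> dcirc \<theta> = 0"
  by (simp_all add: norm_vec_def L2_set_def sum_2 circ_def dcirc_def inner_vec_def algebra_simps)

lemma circ_periodic: "circ (\<theta> + 2 * pi) = circ \<theta>" "dcirc (\<theta> + 2 * pi) = dcirc \<theta>"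
  by (simp_all add: circ_def dcirc_def)

lemma sphere_circ: assumes "norm v = r" obtains \<theta> where "0 \<le> \<theta>" "\<theta> < 2 * pi" "v = r *\<^sub>R circ \<theta>"
proof (cases "r = 0")
  case True
  then show ?thesis using assms that[of 0] by simp
next
  case False
  then have "r > 0" using assms norm_ge_zero[of v] by linarith
  have "(v$1)\<^sup>2 + (v$2)\<^sup>2 = r\<^sup>2" using assms by (auto simp: norm_vec_def L2_set_def sum_2)
  then have "(v$1/r)\<^sup>2 + (v$2/r)\<^sup>2 = 1" using False by (simp add: power_divide add_divide_distrib[symmetric])
  then obtain t where "0 \<le> t" "t < 2*pi" "v$1/r = cos t" "v$2/r = sin t" using sincos_total_2pi by blast
  then show ?thesis using False by (intro that[of t]) (auto simp: circ_def vec_eq_iff forall_2 field_simps)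
qed

text \<open>A monotone function onto an open interval takes values close to each end, and
  monotonicity confines everything beyond such a point. This closes up the angle function at the
  base point of a loop, where the angle has no single value.\<close>

lemma continuous_extend_mono:
  fixes a :: "real \<Rightarrow> real"
  assumes c: "continuous_on {0<..<1} a" and m: "strict_mono_on {0<..<1} a" and im: "a ` {0<..<1} = {l<..<u}" and lu: "l < u"
  shows "continuous_on {0..1} (\<lambda>t. if t \<le> 0 then l else if t \<ge> 1 then u else a t)" (is "continuous_on _ ?b")
  unfolding continuous_on_iff
proof (intro ballI allI impI)
  fix t e :: real assume t: "t \<in> {0..1}" and e: "e > 0"
  have ain: "a x \<in> {l<..<u}" if "x \<in> {0<..<1}" for x using im that by blast
  have mono: "a x < a y" if "x \<in> {0<..<1}" "y \<in> {0<..<1}" "x < y" for x y using strict_mono_onD[OF m that] .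
  consider "t = 0" | "t = 1" | "t \<in> {0<..<1}" using t by force
  then show "\<exists>d>0. \<forall>x\<in>{0..1}. dist x t < d \<longrightarrow> dist (?b x) (?b t) < e"
  proof cases
    case 1
    obtain m where m: "0 < m" "m \<le> u - l" "m \<le> e"
    proof (rule that)
      show "0 < min e (u - l)" "min e (u - l) \<le> u - l" "min e (u - l) \<le> e" using e lu by auto
    qed
    have "l + m / 2 \<in> {l<..<u}" using m by (simp add: field_simps)
    then obtain x1 where x1: "x1 \<in> {0<..<1}" "a x1 = l + m / 2" using im by (metis imageE)
    have "dist (?b x) (?b t) < e" if x: "x \<in> {0..1}" "dist x t < x1" for x
    proof (cases "x = 0")
      case False
      then have "x \<in> {0<..<1}" "x < x1" using x x1 1 by (auto simp: dist_real_def)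
      then have "a x < a x1" "l < a x" using mono x1(1) ain by auto
      then have "\<bar>a x - l\<bar> < e" using x1(2) m by linarith
      then show ?thesis using \<open>x \<in> {0<..<1}\<close> 1 by (auto simp: dist_real_def)
    qed (use 1 e in simp)
    then show ?thesis using x1(1) by (intro exI[of _ x1]) auto
  next
    case 2
    obtain m where m: "0 < m" "m \<le> u - l" "m \<le> e"
    proof (rule that)
      show "0 < min e (u - l)" "min e (u - l) \<le> u - l" "min e (u - l) \<le> e" using e lu by auto
    qed
    have "u - m / 2 \<in> {l<..<u}" using m by (simp add: field_simps)
    then obtain x1 where x1: "x1 \<in> {0<..<1}" "a x1 = u - m / 2" using im by (metis imageE)
    have "dist (?b x) (?b t) < e" if x: "x \<in> {0..1}" "dist x t < 1 - x1" for x
    proof (cases "x = 1")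
      case False
      then have "x \<in> {0<..<1}" "x1 < x" using x x1 2 by (auto simp: dist_real_def)
      then have "a x1 < a x" "a x < u" using mono x1(1) ain by auto
      then have "\<bar>a x - u\<bar> < e" using x1(2) m by linarith
      then show ?thesis using \<open>x \<in> {0<..<1}\<close> 2 by (auto simp: dist_real_def)
    qed (use 2 e in simp)
    then show ?thesis using x1(1) by (intro exI[of _ "1 - x1"]) auto
  next
    case 3
    obtain d where d: "d > 0" "\<And>x. x \<in> {0<..<1} \<Longrightarrow> dist x t < d \<Longrightarrow> dist (a x) (a t) < e"
      using c 3 e unfolding continuous_on_iff by metis
    have "dist (?b x) (?b t) < e" if x: "x \<in> {0..1}" "dist x t < min d (min t (1 - t))" for x
    proof -
      have "x \<in> {0<..<1}" using x 3 by (auto simp: dist_real_def)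
      then show ?thesis using d(2)[of x] x 3 by auto
    qed
    then show ?thesis using d(1) 3 by (intro exI[of _ "min d (min t (1 - t))"]) auto
  qed
qed

text \<open>A simple closed parametrization of the circle is, away from its base point, a strictly
  monotone change of the angle, which makes its weighted length independent of the parametrization.\<close>

lemma circle_parametrization_integral:
  fixes W :: "real \<Rightarrow> real^2" and J L :: "real \<Rightarrow> real"
  assumes r: "r > 0" and cW: "continuous_on {0..1} W" and W01: "W 0 = W 1" and inj: "inj_on W {0..<1}"
    and im: "W ` {0..1} = sphere 0 r" and T: "finite T"
    and dW: "\<And>t. t \<in> {0<..<1} - T \<Longrightarrow> \<exists>w'. (W has_vector_derivative w') (at t)"
    and cJ: "continuous_on UNIV J" and pJ: "\<And>x. J (x + 2 * pi) = J x"
    and L: "\<And>t \<theta> c. t \<in> {0<..<1} - T \<Longrightarrow> W t = r *\<^sub>R circ \<theta> \<Longrightarrow> (W has_vector_derivative c *\<^sub>R r *\<^sub>R dcirc \<theta>) (at t) \<Longrightarrow> L t = \<bar>c\<bar> * J \<theta>"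
  shows "(L has_integral integral {-pi..pi} J) {0..1}"
proof -
  define z where "z = (\<lambda>t. Complex (W t $ 1) (W t $ 2))"
  have zW: "z = (\<lambda>t. of_real (W t $ 1) + \<i> * of_real (W t $ 2))" by (simp add: z_def Complex_eq)
  have nW: "norm (W t) = r" if "t \<in> {0..1}" for t using im that by force
  have nz: "norm (z t) = norm (W t)" for t
    by (simp add: z_def cmod_def norm_vec_def L2_set_def sum_2)
  define z0 where "z0 = z 0"
  have z0: "norm z0 = r" "z0 \<noteq> 0" using nz[of 0] nW[of 0] r by (auto simp: z0_def)
  \<comment> \<open>The rotation takes the base point to -1, so the branch cut of \<open>Ln\<close>
    is met only at the ends of the parameter interval, and angles are measured from the antipode of
    the base point, in direction \<open>\<beta>\<close>.\<close>
  define \<zeta> where "\<zeta> = (\<lambda>t. z t * inverse (- z0))"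
  have n\<zeta>: "norm (\<zeta> t) = 1" if "t \<in> {0..1}" for t
    using nz[of t] nW[OF that] z0 r by (simp add: \<zeta>_def norm_mult norm_inverse)
  have zne: "z t \<noteq> z0" if t: "t \<in> {0<..<1}" for t
  proof
    assume "z t = z0"
    then have "W t = W 0" by (simp add: z_def z0_def vec_eq_iff forall_2)
    then have "t = 0" using inj_onD[OF inj, of t 0] t by auto
    then show False using t by simp
  qed
  have dom: "\<zeta> t \<notin> \<real>\<^sub>\<le>\<^sub>0" if t: "t \<in> {0<..<1}" for t
  proof
    assume n: "\<zeta> t \<in> \<real>\<^sub>\<le>\<^sub>0"
    then obtain x where x: "\<zeta> t = of_real x" "x \<le> 0" by (auto elim: nonpos_Reals_cases)
    then have "x = -1" using n\<zeta>[of t] t by auto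
    then have "z t = z0" using x(1) z0(2) by (simp add: \<zeta>_def field_simps)
    then show False using zne[OF t] by simp
  qed
  define \<beta> where "\<beta> = Arg (- z0)"
  define a where "a = (\<lambda>t. Im (Ln (\<zeta> t)))"
  have Wa: "W t = r *\<^sub>R circ (a t + \<beta>)" if t: "t \<in> {0<..<1}" for t
  proof -
    have z1: "\<zeta> t \<noteq> 0" using n\<zeta>[of t] t by auto
    have "\<zeta> t = cis (a t)" using cis_Arg[OF z1] n\<zeta>[of t] t by (simp add: a_def Arg_eq_Im_Ln[OF z1, symmetric] sgn_div_norm)
    moreover have "- z0 = r * cis \<beta>" using rcis_cmod_Arg[of "- z0"] z0 by (simp add: \<beta>_def rcis_def)
    moreover have "z t = \<zeta> t * (- z0)" using z0 by (simp add: \<zeta>_def)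
    ultimately have "z t = r * cis (a t + \<beta>)" by (simp add: cis_mult[symmetric])
    then show ?thesis by (simp add: z_def circ_def vec_eq_iff forall_2 complex_eq_iff)
  qed
  have arange: "a t \<in> {-pi<..<pi}" if t: "t \<in> {0<..<1}" for t
  proof -
    have z1: "\<zeta> t \<noteq> 0" using n\<zeta>[of t] t by auto
    have "a t \<noteq> pi"
    proof
      assume "a t = pi"
      then have "\<zeta> t = cis pi" using cis_Arg[OF z1] n\<zeta>[of t] t by (simp add: a_def Arg_eq_Im_Ln[OF z1, symmetric] sgn_div_norm)
      then have "\<zeta> t = - 1" by simp
      then show False using dom[OF t] by simp
    qed
    then show ?thesis using mpi_less_Im_Ln[OF z1] Im_Ln_le_pi[OF z1] by (simp add: a_def)
  qed
  have asurj: "\<exists>t\<in>{0<..<1}. a t = x" if x: "x \<in> {-pi<..<pi}" for x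
  proof -
    let ?w = "r *\<^sub>R circ (x + \<beta>)"
    have "?w \<in> sphere 0 r" using r by (simp add: circ_norm)
    then obtain t where t: "t \<in> {0..1}" "W t = ?w" using im by (metis imageE)
    have zt: "z t = r * cis (x + \<beta>)" using t(2) by (simp add: z_def circ_def complex_eq_iff)
    have "- z0 = r * cis \<beta>" using rcis_cmod_Arg[of "- z0"] z0 by (simp add: \<beta>_def rcis_def)
    then have "\<zeta> t = cis x" using zt r by (simp add: \<zeta>_def cis_mult[symmetric] field_simps)
    then have ax: "a t = x" using x by (simp add: a_def cis_conv_exp)
    have "t \<noteq> 0 \<and> t \<noteq> 1"
    proof (rule ccontr)
      assume "\<not> (t \<noteq> 0 \<and> t \<noteq> 1)"
      then have "z t = z0" using W01 by (auto simp: z_def z0_def)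
      then have "\<zeta> t = -1" using z0 by (simp add: \<zeta>_def)
      then have "a t = pi" by (simp add: a_def)
      then show False using ax x by simp
    qed
    then show ?thesis using t(1) ax by (intro bexI[of _ t]) auto
  qed
  have aim: "a ` {0<..<1} = {-pi<..<pi}" using arange asurj by (auto simp: image_iff) metis
  have cz: "continuous_on {0..1} z" unfolding zW by (intro continuous_intros cW)
  have ca: "continuous_on {0<..<1} a" unfolding a_def \<zeta>_def
    by (intro continuous_intros continuous_on_subset[OF cz]) (use dom in \<open>auto simp: \<zeta>_def\<close>)
  have ia: "inj_on a {0<..<1}"
  proof (rule inj_onI)
    fix x y assume xy: "x \<in> {0<..<1}" "y \<in> {0<..<1}" "a x = a y"
    then have "W x = W y" using Wa by simp
    then show "x = y" using inj_onD[OF inj, of x y] xy by auto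
  qed
  have "strict_mono_on {0<..<1} a \<or> strict_antimono_on {0<..<1} a"
    using injective_eq_monotone_map[of "{0<..<1}" a] ca ia by (simp add: is_interval_convex_1)
  \<comment> \<open>A continuous injective angle function is strictly monotone; \<open>k\<close> is
    the orientation of the loop.\<close>
  then obtain k :: real where k: "k = 1 \<or> k = -1" and mono: "strict_mono_on {0<..<1} (\<lambda>t. k * a t)"
  proof
    assume "strict_mono_on {0<..<1} a"
    then show ?thesis by (intro that[of 1]) auto
  next
    assume "strict_antimono_on {0<..<1} a"
    then show ?thesis by (intro that[of "-1"]) (auto simp: monotone_on_def)
  qed
  have kk: "k * k = 1" "\<bar>k\<bar> = 1" using k by auto
  have kim: "(\<lambda>t. k * a t) ` {0<..<1} = {-pi<..<pi}"
  proof -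
    have "(\<lambda>t. k * a t) ` {0<..<1} = (*) k ` {-pi<..<pi}" by (simp add: aim[symmetric] image_image)
    also have "\<dots> = {-pi<..<pi}"
    proof (intro set_eqI iffI)
      fix x assume "x \<in> (*) k ` {-pi<..<pi}"
      then show "x \<in> {-pi<..<pi}" using k by auto
    next
      fix x assume "x \<in> {-pi<..<pi}"
      then have "k * x \<in> {-pi<..<pi}" using k by auto
      then have "k * (k * x) \<in> (*) k ` {-pi<..<pi}" by (rule imageI)
      then show "x \<in> (*) k ` {-pi<..<pi}" using kk by (simp add: mult.assoc[symmetric])
    qed
    finally show ?thesis .
  qed
  define b where "b = (\<lambda>t. if t \<le> 0 then -pi else if t \<ge> 1 then pi else k * a t)"
  have cb: "continuous_on {0..1} b" unfolding b_def
    by (rule continuous_extend_mono[OF _ mono kim]) (auto intro!: continuous_intros ca)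
  have "\<exists>l. \<forall>x::real. (-\<infinity>::ereal) < ereal x \<longrightarrow> ereal x < \<infinity> \<longrightarrow> (l has_vector_derivative J x) (at x)"
    by (rule einterval_antiderivative) (use cJ in \<open>auto simp: continuous_on_eq_continuous_at\<close>)
  then obtain l where l: "\<And>x. (l has_vector_derivative J x) (at x)" by auto
  \<comment> \<open>On the open interval \<open>k * b t\<close> is the angle, as
    \<open>k * k = 1\<close>. At the ends the argument of \<open>l\<close> is
    \<open>\<beta> - pi\<close> and \<open>\<beta> + pi\<close> in the order given by
    \<open>k\<close>, which the outer factor \<open>k\<close> compensates.\<close>
  define P where "P = (\<lambda>t. k * l (k * b t + \<beta>))"
  have cl: "continuous_on UNIV l" by (rule continuous_on_vector_derivative[of UNIV l J]) (use l in simp)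
  have "(L has_integral (P 1 - P 0)) {0..1}"
  proof (rule fundamental_theorem_of_calculus_interior_strong[OF T])
    show "continuous_on {0..1} P" unfolding P_def
      by (intro continuous_on_mult_left continuous_on_compose2[OF cl] continuous_intros cb) auto
    fix t assume t: "t \<in> {0<..<1} - T"
    then have t01: "t \<in> {0<..<1}" by auto
    obtain w' where w': "(W has_vector_derivative w') (at t)" using dW[OF t] by blast
    have "((\<lambda>t. W t $ i) has_vector_derivative w' $ i) (at t)" for i
      using bounded_linear.has_vector_derivative[OF bounded_linear_vec_nth w'] by simp
    then have "((\<lambda>t. of_real (W t $ 1) + \<i> * of_real (W t $ 2)) has_vector_derivative (of_real (w' $ 1) + \<i> * of_real (w' $ 2))) (at t)"
      by (intro has_vector_derivative_add has_vector_derivative_mult_right has_vector_derivative_of_real)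
        (simp_all add: has_real_derivative_iff_has_vector_derivative)
    then have "(\<zeta> has_vector_derivative (of_real (w' $ 1) + \<i> * of_real (w' $ 2)) * inverse (- z0)) (at t)"
      unfolding \<zeta>_def zW[symmetric] by (rule has_vector_derivative_mult_left)
    moreover have "(Ln has_derivative (*) (inverse (\<zeta> t))) (at (\<zeta> t))"
      using has_field_derivative_Ln[OF dom[OF t01]] by (simp add: has_field_derivative_def)
    ultimately have "((\<lambda>t. Ln (\<zeta> t)) has_vector_derivative inverse (\<zeta> t) * ((of_real (w' $ 1) + \<i> * of_real (w' $ 2)) * inverse (- z0))) (at t)"
      by (rule has_vector_derivative_compose)
    from bounded_linear.has_vector_derivative[OF bounded_linear_Im this]
    obtain a' where a': "(a has_vector_derivative a') (at t)" unfolding a_def by blast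
    have "((\<lambda>t. a t + \<beta>) has_vector_derivative a') (at t)" using has_vector_derivative_add[OF a' has_vector_derivative_const[of \<beta>]] by simp
    then have "((\<lambda>t. circ (a t + \<beta>)) has_vector_derivative a' *\<^sub>R dcirc (a t + \<beta>)) (at t)"
      using has_vector_derivative_compose[of "\<lambda>t. a t + \<beta>" a' t UNIV circ "\<lambda>s. s *\<^sub>R dcirc (a t + \<beta>)"] circ_deriv[of "a t + \<beta>" UNIV]
      by (simp add: has_vector_derivative_def)
    then have "((\<lambda>t. r *\<^sub>R circ (a t + \<beta>)) has_vector_derivative a' *\<^sub>R r *\<^sub>R dcirc (a t + \<beta>)) (at t)"
      using bounded_linear.has_vector_derivative[OF bounded_linear_scaleR_right] by (fastforce simp: scaleR_scaleR mult.commute)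
    then have Wd: "(W has_vector_derivative a' *\<^sub>R r *\<^sub>R dcirc (a t + \<beta>)) (at t)"
      by (rule has_vector_derivative_transform_within_open[of _ _ _ "{0<..<1}"]) (use t01 Wa in auto)
    have Lt: "L t = \<bar>a'\<bar> * J (a t + \<beta>)" by (rule L[OF t Wa[OF t01] Wd])
    have kd: "((\<lambda>t. k * a t) has_vector_derivative k * a') (at t)" by (rule has_vector_derivative_mult_right[OF a'])
    have nn: "k * a' \<ge> 0"
    proof (rule mono_on_imp_deriv_nonneg)
      show "mono_on {0<..<1} (\<lambda>t. k * a t)" by (rule strict_mono_on_imp_mono_on[OF mono])
      show "((\<lambda>t. k * a t) has_real_derivative k * a') (at t)" using kd by (simp add: has_real_derivative_iff_has_vector_derivative)
      show "t \<in> interior {0<..<1}" using t01 by (simp add: interior_open)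
    qed
    have "(b has_vector_derivative k * a') (at t)"
      by (rule has_vector_derivative_transform_within_open[OF kd, of "{0<..<1}"]) (use t01 in \<open>auto simp: b_def\<close>)
    then have "((\<lambda>t. k * b t + \<beta>) has_vector_derivative k * (k * a')) (at t)"
      using has_vector_derivative_add[OF has_vector_derivative_mult_right has_vector_derivative_const[of \<beta>]] by fastforce
    then have "((\<lambda>t. l (k * b t + \<beta>)) has_vector_derivative (k * (k * a')) *\<^sub>R J (k * b t + \<beta>)) (at t)"
      using has_vector_derivative_compose[of "\<lambda>t. k * b t + \<beta>" "k * (k * a')" t UNIV l "\<lambda>s. s *\<^sub>R J (k * b t + \<beta>)"] l[of "k * b t + \<beta>"]
      by (simp add: has_vector_derivative_def)
    from has_vector_derivative_mult_right[OF this, of k]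
    have "(P has_vector_derivative k * ((k * (k * a')) *\<^sub>R J (k * b t + \<beta>))) (at t)" by (simp add: P_def)
    then have "(P has_vector_derivative (k * (k * (k * a'))) * J (k * b t + \<beta>)) (at t)" by (simp only: real_scaleR_def mult.assoc)
    moreover have "k * b t = a t" using t01 kk by (simp add: b_def mult.assoc[symmetric])
    moreover have "k * (k * (k * a')) = k * a'" using kk by (simp add: mult.assoc[symmetric])
    moreover have "\<bar>a'\<bar> = k * a'" using nn k by auto
    ultimately show "(P has_vector_derivative L t) (at t)" by (simp only: Lt)
  qed simp
  moreover have "P 1 - P 0 = integral {-pi..pi} J"
  proof -
    \<comment> \<open>By periodicity of \<open>J\<close> its integral over a full period does not
      depend on where the period starts, so the shift by \<open>\<beta>\<close> disappears.\<close>
    have "((\<lambda>x. l (x + 2 * pi) - l x) has_field_derivative 0) (at x within UNIV)" for x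
    proof -
      have "((\<lambda>x. l (x + 2 * pi)) has_field_derivative J (x + 2 * pi)) (at x)"
        using l[of "x + 2 * pi"] DERIV_shift[of l "J (x + 2*pi)" x "2 * pi"] by (simp add: has_real_derivative_iff_has_vector_derivative)
      from DERIV_diff[OF this, of l "J x" ] show ?thesis using l[of x] pJ[of x] by (simp add: has_real_derivative_iff_has_vector_derivative)
    qed
    then obtain c where c: "\<And>x. l (x + 2 * pi) - l x = c"
      using has_field_derivative_zero_constant[OF convex_UNIV, of "\<lambda>x. l (x + 2 * pi) - l x"] by auto
    have "(J has_integral l pi - l (- pi)) {-pi..pi}"
      by (rule fundamental_theorem_of_calculus) (auto intro: has_vector_derivative_at_within l)
    then have "integral {-pi..pi} J = c" using c[of "-pi"] by (simp add: integral_unique)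
    moreover have "P 1 - P 0 = c" using k c[of "\<beta> - pi"] by (auto simp: P_def b_def algebra_simps)
    ultimately show ?thesis by simp
  qed
  ultimately show ?thesis by simp
qed

section \<open>Length density and length of small geodesic circles\<close>

context polar_chart begin

text \<open>The length density, with respect to the angle, of the geodesic circle of radius
  \<open>r\<close>.\<close>

definition "J r \<theta> = norm (dF (E (r *\<^sub>R circ \<theta>)) (blinfun_apply (E' (r *\<^sub>R circ \<theta>)) (r *\<^sub>R dcirc \<theta>)))"

lemma circ_in: "0 < r \<Longrightarrow> r < s \<Longrightarrow> r *\<^sub>R circ \<theta> \<in> U'"
  using U'(2) by (auto simp: circ_norm subset_iff)

lemma continuous_J: assumes "0 < r" "r < s" shows "continuous_on S (J r)"
proof -
  obtain F' where F': "continuous_on (\<phi> ` U) F'" "\<And>x. x \<in> \<phi> ` U \<Longrightarrow> blinfun_apply (F' x) = dF x"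
  proof -
    have "smooth_on (\<phi> ` U) F" using smf UA by (auto simp: smooth_map_def)
    then show ?thesis by (rule smooth_on_C1) (rule that)
  qed
  have cE: "continuous_on U' E" using hom by (simp add: homeomorphism_def)
  have c1: "continuous_on S (\<lambda>\<theta>. r *\<^sub>R circ \<theta>)" by (intro continuous_intros continuous_circ)
  have i1: "(\<lambda>\<theta>. r *\<^sub>R circ \<theta>) ` S \<subseteq> U'" using circ_in[OF assms] by auto
  have c2: "continuous_on S (\<lambda>\<theta>. E (r *\<^sub>R circ \<theta>))" by (rule continuous_on_compose2[OF cE c1 i1])
  have c3: "continuous_on S (\<lambda>\<theta>. E' (r *\<^sub>R circ \<theta>))" by (rule continuous_on_compose2[OF cE' c1 i1])
  have c4: "continuous_on S (\<lambda>\<theta>. F' (E (r *\<^sub>R circ \<theta>)))"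
    by (rule continuous_on_compose2[OF F'(1) c2]) (use EU circ_in[OF assms] in auto)
  have "continuous_on S (\<lambda>\<theta>. norm (blinfun_apply (F' (E (r *\<^sub>R circ \<theta>))) (blinfun_apply (E' (r *\<^sub>R circ \<theta>)) (r *\<^sub>R dcirc \<theta>))))"
    by (intro continuous_intros c3 c4 continuous_circ)
  then show ?thesis
    by (rule continuous_on_eq) (simp add: J_def F'(2)[OF EU[OF circ_in[OF assms]]])
qed

text \<open>In normal coordinates the curve is a simple closed parametrization of a round circle,
  and linearity of the differentials gives it the speed \<open>\<bar>c\<bar> * J r \<theta>\<close>;
  such weighted lengths do not depend on the parametrization.\<close>

lemma circle_curve_length:
  assumes r: "0 < r" "r < s" and \<gamma>: "surface_curve X A \<gamma>" "\<gamma> 0 = \<gamma> 1" "inj_on \<gamma> {0..<1}" "\<gamma> ` {0..1} = \<sigma> ` sphere 0 r"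
  shows "curve_length f \<gamma> = integral {-pi..pi} (J r)"
proof -
  let ?W = "\<lambda>t. w (\<gamma> t)"
  have sU: "sphere 0 r \<subseteq> U'" using U'(2) r by (auto simp: subset_iff)
  have in\<sigma>: "\<gamma> t \<in> \<sigma> ` sphere 0 r" if "t \<in> {0..1}" for t using \<gamma>(4) that by blast
  have in\<sigma>U: "\<gamma> t \<in> \<sigma> ` U'" if "t \<in> {0..1}" for t using in\<sigma>[OF that] sU by blast
  have \<sigma>W: "\<sigma> (?W t) = \<gamma> t" if "t \<in> {0..1}" for t by (rule \<sigma>_w[OF in\<sigma>[OF that] sU])
  obtain T where T: "finite T" "\<And>t. t \<in> {0<..<1} - T \<Longrightarrow> \<gamma> t \<in> U \<Longrightarrow> \<exists>c. ((\<phi> \<circ> \<gamma>) has_vector_derivative c) (at t)"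
    using curve_chart_deriv[OF \<gamma>(1)] by blast
  have dv: "\<exists>w'. (?W has_vector_derivative w') (at t) \<and> vector_derivative (f \<circ> \<gamma>) (at t) = dF (E (?W t)) (blinfun_apply (E' (?W t)) w')"
    if t: "t \<in> {0<..<1} - T" for t
  proof -
    have "\<gamma> t \<in> U" using in\<sigma>U[of t] t image_\<sigma>_iff[of U'] by auto
    then obtain c where c: "((\<phi> \<circ> \<gamma>) has_vector_derivative c) (at t)" using T(2)[OF t] by blast
    obtain w' where "(?W has_vector_derivative w') (at t)" "vector_derivative (f \<circ> \<gamma>) (at t) = dF (E (?W t)) (blinfun_apply (E' (?W t)) w')"
      by (rule curve_w_deriv[OF c, of "{0<..<1}"]) (use t in\<sigma>U in auto)
    then show ?thesis by blast
  qed
  have "(speed \<gamma> has_integral integral {-pi..pi} (J r)) {0..1}"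
  proof (rule circle_parametrization_integral[of r ?W T])
    show "continuous_on {0..1} ?W" by (rule curve_w_continuous[OF \<gamma>(1)]) (use in\<sigma>U in auto)
    show "inj_on ?W {0..<1}"
    proof (rule inj_onI)
      fix x y assume xy: "x \<in> {0..<1}" "y \<in> {0..<1::real}" "?W x = ?W y"
      then have xy': "x \<in> {0..1}" "y \<in> {0..1}" by auto
      have "\<gamma> x = \<gamma> y" using \<sigma>W[OF xy'(1)] \<sigma>W[OF xy'(2)] unfolding xy(3) by (rule HOL.trans[OF sym])
      then show "x = y" using inj_onD[OF \<gamma>(3)] xy by blast
    qed
    have "?W ` {0..1} = w ` \<sigma> ` sphere 0 r" by (simp add: \<gamma>(4)[symmetric] image_image)
    also have "\<dots> = (\<lambda>v. v) ` sphere 0 r" unfolding image_image by (rule image_cong) (use \<sigma>_simps(3) sU in auto)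
    finally show "?W ` {0..1} = sphere 0 r" by simp
    show "\<exists>w'. (?W has_vector_derivative w') (at t)" if "t \<in> {0<..<1} - T" for t using dv[OF that] by blast
    show "J r (x + 2 * pi) = J r x" for x by (simp add: J_def circ_periodic)
    show "continuous_on UNIV (J r)" by (rule continuous_J[OF r])
    fix t \<theta> c assume t: "t \<in> {0<..<1} - T" and W: "?W t = r *\<^sub>R circ \<theta>" and d: "(?W has_vector_derivative c *\<^sub>R r *\<^sub>R dcirc \<theta>) (at t)"
    obtain w' where w': "(?W has_vector_derivative w') (at t)" "vector_derivative (f \<circ> \<gamma>) (at t) = dF (E (?W t)) (blinfun_apply (E' (?W t)) w')"
      using dv[OF t] by blast
    have "w' = c *\<^sub>R r *\<^sub>R dcirc \<theta>" using vector_derivative_unique_at[OF w'(1) d] .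
    then have "speed \<gamma> t = norm (dF (E (?W t)) (c *\<^sub>R blinfun_apply (E' (?W t)) (r *\<^sub>R dcirc \<theta>)))"
      using w'(2) by (simp add: blinfun.scaleR_right)
    also have "linear (dF (E (?W t)))" unfolding W
      by (rule has_derivative_linear[OF dF[OF EU[OF circ_in[OF r]]]])
    then have "dF (E (?W t)) (c *\<^sub>R blinfun_apply (E' (?W t)) (r *\<^sub>R dcirc \<theta>)) = c *\<^sub>R dF (E (?W t)) (blinfun_apply (E' (?W t)) (r *\<^sub>R dcirc \<theta>))"
      by (rule linear_scale)
    finally show "speed \<gamma> t = \<bar>c\<bar> * J r \<theta>" by (simp only: J_def W norm_scaleR)
  qed (use r \<gamma>(2) T(1) in auto)
  then show ?thesis by (simp add: curve_length_def integral_unique)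
qed

text \<open>The uniformly parametrized round circle, carried over by the exponential map. Existence
  is what gives the definite description in \<open>geodesic_circle_length\<close> a value.\<close>

lemma circle_curve_exists:
  assumes r: "0 < r" "r < s"
  obtains \<gamma> where "surface_curve X A \<gamma>" "\<gamma> 0 = \<gamma> 1" "inj_on \<gamma> {0..<1}" "\<gamma> ` {0..1} = \<sigma> ` sphere 0 r"
proof -
  define v where "v = (\<lambda>t. r *\<^sub>R circ (2 * pi * t))"
  have vU: "v t \<in> U'" for t unfolding v_def by (rule circ_in[OF r])
  have d: "(v has_vector_derivative r *\<^sub>R (2 * pi) *\<^sub>R dcirc (2 * pi * t)) (at t within {0..1})" for t
  proof -
    have "((\<lambda>t. 2 * pi * t) has_vector_derivative 2 * pi) (at t within {0..1})" by (auto intro!: derivative_eq_intros)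
    then have "((\<lambda>t. circ (2 * pi * t)) has_vector_derivative (2 * pi) *\<^sub>R dcirc (2 * pi * t)) (at t within {0..1})"
      using has_vector_derivative_compose[of "\<lambda>t. 2 * pi * t" "2 * pi" t "{0..1}" circ "\<lambda>s. s *\<^sub>R dcirc (2 * pi * t)"] circ_deriv[of "2 * pi * t" UNIV]
      by (simp add: has_vector_derivative_def)
    then show ?thesis unfolding v_def by (rule bounded_linear.has_vector_derivative[OF bounded_linear_scaleR_right])
  qed
  have cv: "continuous_on {0..1} v" by (rule continuous_on_vector_derivative[OF d])
  have "C1_on_interval 0 1 (\<lambda>t. E (v t))"
    unfolding C1_on_interval_def
  proof (intro exI conjI ballI)
    show "((\<lambda>t. E (v t)) has_vector_derivative blinfun_apply (E' (v t)) (r *\<^sub>R (2 * pi) *\<^sub>R dcirc (2 * pi * t))) (at t within {0..1})" for t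
      by (rule has_vector_derivative_compose[OF d dE[OF vU]])
    have "continuous_on {0..1} (\<lambda>t. E' (v t))" by (rule continuous_on_compose2[OF cE' cv]) (use vU in auto)
    moreover have "continuous_on {0..1} (\<lambda>t. dcirc (2 * pi * t))"
      by (rule continuous_on_compose2[OF continuous_circ(2)[of UNIV]]) (auto intro!: continuous_intros)
    ultimately show "continuous_on {0..1} (\<lambda>t. blinfun_apply (E' (v t)) (r *\<^sub>R (2 * pi) *\<^sub>R dcirc (2 * pi * t)))"
      by (intro continuous_intros)
  qed
  then have 1: "surface_curve X A (inv_into U \<phi> \<circ> (\<lambda>t. E (v t)))" by (rule surface_curve_in_chart) (use EU vU in auto)
  have eq: "(inv_into U \<phi> \<circ> (\<lambda>t. E (v t))) = (\<lambda>t. \<sigma> (v t))" by (auto simp: \<sigma>_def)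
  have 2: "v 0 = v 1" using circ_periodic(1)[of 0] by (simp add: v_def)
  have 3: "inj_on (\<lambda>t. \<sigma> (v t)) {0..<1}"
  proof (rule inj_onI)
    fix x y :: real assume xy: "x \<in> {0..<1}" "y \<in> {0..<1}" "\<sigma> (v x) = \<sigma> (v y)"
    then have "v x = v y" using \<sigma>_simps(3)[OF vU] by metis
    then have "circ (2 * pi * x) = circ (2 * pi * y)" using r by (simp add: v_def)
    then have "sin (2 * pi * x) = sin (2 * pi * y) \<and> cos (2 * pi * x) = cos (2 * pi * y)"
      by (simp add: circ_def vec_eq_iff forall_2)
    then obtain n :: int where "2 * pi * x = 2 * pi * y + 2 * pi * n" using sin_cos_eq_iff by blast
    then have "2 * pi * (x - y - n) = 0" by (simp add: algebra_simps)
    then have n: "x - y = n" by simp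
    then have "\<bar>real_of_int n\<bar> < 1" using xy by (auto simp: abs_less_iff)
    then have "n = 0" by linarith
    then show "x = y" using n by simp
  qed
  have vs: "v ` {0..1} = sphere 0 r"
  proof (intro set_eqI iffI)
    fix u assume "u \<in> v ` {0..1}"
    then show "u \<in> sphere 0 r" using r by (auto simp: v_def circ_norm)
  next
    fix u :: "real^2" assume "u \<in> sphere 0 r"
    then obtain \<theta> where th: "0 \<le> \<theta>" "\<theta> < 2 * pi" "u = r *\<^sub>R circ \<theta>" using sphere_circ[of u r] by auto
    then have "u = v (\<theta> / (2 * pi))" by (simp add: v_def)
    moreover have "\<theta> / (2 * pi) \<in> {0..1}" using th by (simp add: field_simps)
    ultimately show "u \<in> v ` {0..1}" by blast
  qed
  show ?thesis
  proof (rule that[of "\<lambda>t. \<sigma> (v t)"])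
    show "(\<lambda>t. \<sigma> (v t)) ` {0..1} = \<sigma> ` sphere 0 r" by (simp add: vs[symmetric] image_image)
  qed (use 1 eq 2 3 in auto)
qed

lemma geodesic_circle_length_eq:
  assumes r: "0 < r" "r < s" shows "geodesic_circle_length X A f p r = integral {-pi..pi} (J r)"
  unfolding geodesic_circle_length_def geodesic_circle_boundary_eq[OF r]
proof (rule the_equality)
  obtain \<gamma> where g: "surface_curve X A \<gamma>" "\<gamma> 0 = \<gamma> 1" "inj_on \<gamma> {0..<1}" "\<gamma> ` {0..1} = \<sigma> ` sphere 0 r"
    using circle_curve_exists[OF r] by blast
  with circle_curve_length[OF r g] show "\<exists>\<gamma>. surface_curve X A \<gamma> \<and> \<gamma> 0 = \<gamma> 1 \<and> inj_on \<gamma> {0..<1} \<and> \<gamma> ` {0..1} = \<sigma> ` sphere 0 r \<and> integral {-pi..pi} (J r) = curve_length f \<gamma>"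
    by metis
  show "l = integral {-pi..pi} (J r)" if "\<exists>\<gamma>. surface_curve X A \<gamma> \<and> \<gamma> 0 = \<gamma> 1 \<and> inj_on \<gamma> {0..<1} \<and> \<gamma> ` {0..1} = \<sigma> ` sphere 0 r \<and> l = curve_length f \<gamma>" for l
    using that circle_curve_length[OF r] by metis
qed

text \<open>The density expands as \<open>r - k * r^3 / 6\<close> uniformly in the angle; over the
  full angle this integrates to \<open>2 * pi * r - pi * k * r^3 / 3\<close>.\<close>

lemma geodesic_circle_length_limit:
  assumes exp: "\<And>\<eta>. \<eta> > 0 \<Longrightarrow> \<exists>\<rho>>0. \<forall>v\<in>U'. \<forall>h. 0 < norm v \<and> norm v < \<rho> \<and> v \<bullet> h = 0 \<and> norm h = norm v \<longrightarrow>
       \<bar>norm (dF (E v) (blinfun_apply (E' v) h)) - (norm v - k * norm v ^ 3 / 6)\<bar> \<le> \<eta> * norm v ^ 3"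
  shows "((\<lambda>r. (2 * pi * r - geodesic_circle_length X A f p r) / r ^ 3) \<longlongrightarrow> pi * k / 3) (at_right 0)"
proof (rule tendstoI)
  fix e :: real assume e: "e > 0"
  \<comment> \<open>Integration over an interval of length \<open>2 * pi\<close> turns this into
    \<open>e / 2\<close>, which lies strictly below \<open>e\<close>.\<close>
  define \<eta> where "\<eta> = e / (4 * pi)"
  have \<eta>: "\<eta> > 0" using e by (simp add: \<eta>_def)
  obtain \<rho> where \<rho>: "\<rho> > 0" "\<And>v h. v \<in> U' \<Longrightarrow> 0 < norm v \<Longrightarrow> norm v < \<rho> \<Longrightarrow> v \<bullet> h = 0 \<Longrightarrow> norm h = norm v \<Longrightarrow>
       \<bar>norm (dF (E v) (blinfun_apply (E' v) h)) - (norm v - k * norm v ^ 3 / 6)\<bar> \<le> \<eta> * norm v ^ 3"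
    using exp[OF \<eta>] by blast
  have "eventually (\<lambda>r. r \<in> {0<..<min \<rho> s}) (at_right (0::real))"
    by (rule eventually_at_right_real) (use \<rho>(1) U'(3) in simp)
  then show "eventually (\<lambda>r. dist ((2 * pi * r - geodesic_circle_length X A f p r) / r ^ 3) (pi * k / 3) < e) (at_right 0)"
  proof (rule eventually_mono)
    fix r assume "r \<in> {0<..<min \<rho> s}"
    then have r: "0 < r" "r < s" "r < \<rho>" by auto
    have J: "norm (J r \<theta> - (r - k * r^3 / 6)) \<le> \<eta> * r^3" for \<theta>
      using \<rho>(2)[OF circ_in[OF r(1,2)], of \<theta> "r *\<^sub>R dcirc \<theta>"] r by (simp add: J_def circ_norm)
    have "norm (integral {-pi..pi} (\<lambda>\<theta>. J r \<theta> - (r - k * r^3 / 6))) \<le> \<eta> * r^3 * (pi - (- pi))"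
      by (rule integral_bound) (auto intro!: continuous_intros continuous_J r J[unfolded real_norm_def])
    moreover have "integral {-pi..pi} (\<lambda>\<theta>. J r \<theta> - (r - k * r^3 / 6)) = integral {-pi..pi} (J r) - 2 * pi * (r - k * r^3 / 6)"
      by (subst integral_diff) (auto intro!: integrable_continuous_interval continuous_J r)
    ultimately have b: "\<bar>integral {-pi..pi} (J r) - 2 * pi * (r - k * r^3 / 6)\<bar> \<le> \<eta> * r^3 * (2 * pi)" by simp
    have "(2 * pi * r - geodesic_circle_length X A f p r) / r ^ 3 - pi * k / 3 = - (integral {-pi..pi} (J r) - 2 * pi * (r - k * r^3 / 6)) / r^3"
      using r(1) unfolding geodesic_circle_length_eq[OF r(1,2)] by (simp add: field_simps)
    then have "dist ((2 * pi * r - geodesic_circle_length X A f p r) / r ^ 3) (pi * k / 3) = \<bar>integral {-pi..pi} (J r) - 2 * pi * (r - k * r^3 / 6)\<bar> / r^3"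
      using r(1) by (simp add: dist_real_def)
    also have "\<dots> \<le> (\<eta> * r^3 * (2 * pi)) / r^3" by (rule divide_right_mono[OF b]) (use r in simp)
    also have "\<dots> = e / 2" using r(1) by (simp add: \<eta>_def)
    also have "\<dots> < e" using e by simp
    finally show "dist ((2 * pi * r - geodesic_circle_length X A f p r) / r ^ 3) (pi * k / 3) < e" .
  qed
qed

end

context param_surface begin

text \<open>Gram-Schmidt orthonormalization of \<open>F1 x\<close> and \<open>F2 x\<close>, carried
  out on the parameter vectors \<open>a1\<close> and \<open>a2\<close>.\<close>

lemma isometric_frame: assumes x: "x \<in> D" obtains A where "linear A" "\<And>v. norm (DF x (A v)) = norm (v :: real^2)"
proof -
  define n1 where "n1 = norm (F1 x)"
  have n1: "n1 \<noteq> 0"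
  proof
    assume "n1 = 0"
    then have "gdet x = 0" by (simp add: n1_def gdet_def)
    then show False using gdet_pos[OF x] by simp
  qed
  define c where "c = (F1 x \<bullet> F2 x) / (n1 * n1)"
  define a1 where "a1 = (1 / n1) *\<^sub>R (axis 1 1 :: real^2)"
  define u where "u = F2 x - c *\<^sub>R F1 x"
  have lD: "linear (DF x)" by (rule linear_DF[OF x])
  have uD: "u = DF x (axis 2 1 - c *\<^sub>R axis 1 1)" by (simp add: linear_diff[OF lD] linear_scale[OF lD] DF_axis u_def)
  have u: "norm u \<noteq> 0"
  proof
    assume "norm u = 0"
    then have "DF x (axis 2 1 - c *\<^sub>R axis 1 1) = 0" using uD by simp
    then have "axis 2 1 - c *\<^sub>R axis 1 1 = (0 :: real^2)" by (rule DF_eq_0[OF x])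
    then have "(axis 2 1 - c *\<^sub>R axis 1 1 :: real^2) $ 2 = (0 :: real^2) $ 2" by (simp only:)
    then show False by (simp add: axis_def)
  qed
  define a2 where "a2 = (1 / norm u) *\<^sub>R (axis 2 1 - c *\<^sub>R axis 1 1 :: real^2)"
  have D1: "DF x a1 = (1 / n1) *\<^sub>R F1 x" by (simp add: a1_def linear_scale[OF lD] DF_axis)
  have D2: "DF x a2 = (1 / norm u) *\<^sub>R u" unfolding a2_def uD by (simp only: linear_scale[OF lD])
  have F11: "F1 x \<bullet> F1 x = n1 * n1" by (simp add: n1_def dot_square_norm power2_eq_square)
  have o: "F1 x \<bullet> u = 0" using n1 by (simp add: u_def inner_diff_right F11 c_def)
  define A where "A = (\<lambda>v :: real^2. (v $ 1) *\<^sub>R a1 + (v $ 2) *\<^sub>R a2)"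
  have "linear A" unfolding A_def by (auto simp: linear_iff algebra_simps)
  moreover have "norm (DF x (A v)) = norm v" for v
  proof -
    have "DF x (A v) = (v $ 1) *\<^sub>R DF x a1 + (v $ 2) *\<^sub>R DF x a2" by (simp add: A_def linear_add[OF lD] linear_scale[OF lD])
    then have "DF x (A v) \<bullet> DF x (A v) = (v$1)\<^sup>2 * (DF x a1 \<bullet> DF x a1) + 2 * (v$1) * (v$2) * (DF x a1 \<bullet> DF x a2) + (v$2)\<^sup>2 * (DF x a2 \<bullet> DF x a2)"
      by (simp add: inner_add_left inner_add_right inner_commute[of "DF x a2" "DF x a1"] power2_eq_square algebra_simps)
    moreover have "DF x a1 \<bullet> DF x a1 = 1" using n1 by (simp add: D1 F11)
    moreover have "DF x a1 \<bullet> DF x a2 = 0" by (simp add: D1 D2 o)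
    moreover have "DF x a2 \<bullet> DF x a2 = 1" using u by (simp add: D2 dot_square_norm power2_eq_square)
    ultimately have "DF x (A v) \<bullet> DF x (A v) = (v$1)\<^sup>2 + (v$2)\<^sup>2" by simp
    also have "\<dots> = v \<bullet> v" by (simp add: inner_vec_def sum_2 power2_eq_square)
    finally show ?thesis by (simp add: norm_eq_sqrt_inner)
  qed
  ultimately show ?thesis by (rule that)
qed

end

text \<open>Smoothness is asked of the transitions into the one chart at \<open>p\<close>; in this
  form the statement covers both the atlas of the immersed surface and the regular parametrizations
  of the unit sphere seen from one explicit chart. The inverse function theorem at the center
  supplies normal coordinates.\<close>

theorem local_bertrand_puiseux:
  fixes X :: "'a topology" and A :: "'a chart set" and f :: "'a \<Rightarrow> real^3"
  assumes haus: "Hausdorff_space X" and charts: "\<And>c. c \<in> A \<Longrightarrow> chart_of X c" and UA: "(U, \<phi>) \<in> A" and pU: "p \<in> U"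
    and smf: "smooth_map A f" and ps: "param_surface (f \<circ> inv_into U \<phi>) (\<phi> ` U)"
    and trans: "\<And>V \<psi>. (V, \<psi>) \<in> A \<Longrightarrow> smooth_on (\<psi> ` (U \<inter> V)) (\<phi> \<circ> inv_into V \<psi>)"
  shows "((\<lambda>r. (2 * pi * r - geodesic_circle_length X A f p r) / r ^ 3) \<longlongrightarrow>
     pi * param_surface.gcurv (f \<circ> inv_into U \<phi>) (\<phi> p) / 3) (at_right 0)"
proof -
  interpret S: param_surface "f \<circ> inv_into U \<phi>" "\<phi> ` U" by (rule ps)
  have x0: "\<phi> p \<in> \<phi> ` U" using pU by simp
  obtain L :: "real^2 \<Rightarrow> real^2" where L: "linear L" "\<And>v. norm (S.DF (\<phi> p) (L v)) = norm v"
    by (rule S.isometric_frame[OF x0]) (rule that)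
  obtain \<delta> and E :: "real^2 \<Rightarrow> real^2" and E' :: "real^2 \<Rightarrow> ((real^2) \<Rightarrow>\<^sub>L (real^2))"
    and Xr Pr :: "real \<Rightarrow> real^2 \<Rightarrow> real^2" and \<tau> :: "real^2 \<Rightarrow> real^3"
    where \<delta>: "\<delta> > 0" and cE': "continuous_on (ball 0 \<delta>) E'" and dE: "\<And>v. v \<in> ball 0 \<delta> \<Longrightarrow> (E has_derivative blinfun_apply (E' v)) (at v)"
    and ED: "\<And>v. v \<in> ball 0 \<delta> \<Longrightarrow> E v \<in> \<phi> ` U" and E0: "E 0 = \<phi> p"
    and X0: "\<And>v. v \<in> ball 0 \<delta> \<Longrightarrow> Xr 0 v = \<phi> p" and X1: "\<And>v. Xr 1 v = E v"
    and XU: "\<And>t v. t \<in> {0..1} \<Longrightarrow> v \<in> ball 0 \<delta> \<Longrightarrow> Xr t v \<in> \<phi> ` U"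
    and dX: "\<And>t v. t \<in> {0..1} \<Longrightarrow> v \<in> ball 0 \<delta> \<Longrightarrow> ((\<lambda>t. Xr t v) has_vector_derivative Pr t v) (at t within {0..1})"
    and cP: "\<And>v. v \<in> ball 0 \<delta> \<Longrightarrow> continuous_on {0..1} (\<lambda>t. Pr t v)"
    and sp: "\<And>t v. t \<in> {0..1} \<Longrightarrow> v \<in> ball 0 \<delta> \<Longrightarrow> norm (S.DF (Xr t v) (Pr t v)) = norm v"
    and n\<tau>: "\<And>v. v \<in> ball 0 \<delta> \<Longrightarrow> norm (\<tau> v) = norm v"
    and ga: "\<And>v h. v \<in> ball 0 \<delta> \<Longrightarrow> \<tau> v \<bullet> S.DF (E v) (blinfun_apply (E' v) h) = v \<bullet> h"
    and exp: "\<And>\<eta>. \<eta> > 0 \<Longrightarrow> \<exists>\<rho>>0. \<forall>v\<in>ball 0 \<delta>. \<forall>h. 0 < norm v \<and> norm v < \<rho> \<and> v \<bullet> h = 0 \<and> norm h = norm v \<longrightarrow>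
       \<bar>norm (S.DF (E v) (blinfun_apply (E' v) h)) - (norm v - S.gcurv (\<phi> p) * norm v ^ 3 / 6)\<bar> \<le> \<eta> * norm v ^ 3"
    by (rule S.geodesic_polar[OF x0 L]) (rule that)
  have b0: "0 \<in> ball (0 :: real^2) \<delta>" using \<delta> by simp
  obtain F' where F': "continuous_on (\<phi> ` U) F'" "\<And>x. x \<in> \<phi> ` U \<Longrightarrow> blinfun_apply (F' x) = frechet_derivative (f \<circ> inv_into U \<phi>) (at x)"
    using smooth_on_C1[OF S.smF] by metis
  text \<open>The Gauss lemma away from the center forces the differential of the exponential map to be
    expanding at the center as well.\<close>
  have expand: "norm h \<le> norm (S.DF (\<phi> p) (blinfun_apply (E' 0) h))" for h
  proof -
    have contE: "continuous_on (ball 0 \<delta>) E"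
      by (rule has_derivative_continuous_on[OF has_derivative_at_withinI[OF dE]])
    have cont: "continuous_on (ball 0 \<delta>) (\<lambda>v. norm (blinfun_apply (F' (E v)) (blinfun_apply (E' v) h)))"
      by (intro continuous_intros cE' continuous_on_compose2[OF F'(1) contE]) (use ED in auto)
    have lim: "((\<lambda>t. t *\<^sub>R h) \<longlongrightarrow> 0) (at_right 0)"
      using tendsto_scaleR[OF tendsto_ident_at[of 0 "{0<..}"] tendsto_const[of h]] by simp
    have ev: "eventually (\<lambda>t. t *\<^sub>R h \<in> ball 0 \<delta>) (at_right 0)"
      using topological_tendstoD[OF lim open_ball b0] .
    have "isCont (\<lambda>v. norm (blinfun_apply (F' (E v)) (blinfun_apply (E' v) h))) 0"
      using cont continuous_on_eq_continuous_at[OF open_ball] b0 by blast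
    then have lim2: "((\<lambda>t. norm (blinfun_apply (F' (E (t *\<^sub>R h))) (blinfun_apply (E' (t *\<^sub>R h)) h))) \<longlongrightarrow> norm (blinfun_apply (F' (E 0)) (blinfun_apply (E' 0) h))) (at_right 0)"
      by (rule isCont_tendsto_compose[OF _ lim])
    have "eventually (\<lambda>t. norm h \<le> norm (blinfun_apply (F' (E (t *\<^sub>R h))) (blinfun_apply (E' (t *\<^sub>R h)) h))) (at_right 0)"
      using ev eventually_at_right_less[of 0]
    proof eventually_elim
      case (elim t)
      let ?v = "t *\<^sub>R h" and ?d = "S.DF (E (t *\<^sub>R h)) (blinfun_apply (E' (t *\<^sub>R h)) h)"
      have "?v \<bullet> h \<le> norm (\<tau> ?v) * norm ?d" using norm_cauchy_schwarz[of "\<tau> ?v" ?d] ga[OF elim(1)] by simp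
      then have "t * (norm h * norm h) \<le> t * (norm h * norm ?d)"
        using n\<tau>[OF elim(1)] elim(2) by (simp add: dot_square_norm power2_eq_square mult.assoc)
      then have "norm h * norm h \<le> norm h * norm ?d" using elim(2) by simp
      then have "norm h \<le> norm ?d" by (cases "h = 0") auto
      then show ?case using F'(2)[OF ED[OF elim(1)]] S.DF[OF ED[OF elim(1)]] by simp
    qed
    then have "norm h \<le> norm (blinfun_apply (F' (E 0)) (blinfun_apply (E' 0) h))"
      by (intro tendsto_lowerbound[OF lim2]) auto
    then show ?thesis using F'(2)[OF x0] S.DF[OF x0] E0 by simp
  qed
  have "inj (blinfun_apply (E' 0))"
  proof -
    have "h = 0" if "blinfun_apply (E' 0) h = 0" for h
      using expand[of h] that linear_0[OF S.linear_DF[OF x0]] by simp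
    then show ?thesis using linear_injective_0[OF bounded_linear.linear[OF blinfun.bounded_linear_right[of "E' 0"]]] by blast
  qed
  then obtain inve where inve: "linear inve" "inve \<circ> blinfun_apply (E' 0) = id"
    using linear_injective_left_inverse[OF bounded_linear.linear[OF blinfun.bounded_linear_right[of "E' 0"]]] by blast
  have "bounded_linear inve" using inve(1) by (simp add: linear_conv_bounded_linear)
  then have "Blinfun inve o\<^sub>L E' 0 = id_blinfun"
    using inve(2) by (intro blinfun_eqI) (simp add: bounded_linear_Blinfun_apply fun_eq_iff)
  then obtain U' V g g' where iv: "open U'" "U' \<subseteq> ball 0 \<delta>" "0 \<in> U'" "open V" "E 0 \<in> V" "homeomorphism U' V E g"
    "\<And>y. y \<in> V \<Longrightarrow> (g has_derivative (g' y)) (at y)"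
    "\<And>y. y \<in> V \<Longrightarrow> g' y = inv (blinfun_apply (E'(g y)))"
    "\<And>y. y \<in> V \<Longrightarrow> bij (blinfun_apply (E'(g y)))"
    using inverse_function_theorem[OF open_ball dE cE' b0] by metis
  obtain s where s: "s > 0" "cball 0 s \<subseteq> U'" using iv(1,3) open_contains_cball by blast
  have sub: "v \<in> ball 0 \<delta>" if "v \<in> U'" for v using that iv(2) by blast
  have VU: "V \<subseteq> \<phi> ` U" using iv(6) ED sub by (auto simp: homeomorphism_def)
  interpret P: polar_chart X A f U \<phi> p E g E' Xr Pr \<tau> U' V s
  proof
    show "norm (frechet_derivative (f \<circ> inv_into U \<phi>) (at (Xr t v)) (Pr t v)) = norm v" if "t \<in> {0..1}" "v \<in> U'" for t v
      using sp[OF that(1) sub[OF that(2)]] S.DF[OF XU[OF that(1) sub[OF that(2)]]] by simp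
    show "\<tau> v \<bullet> frechet_derivative (f \<circ> inv_into U \<phi>) (at (E v)) (blinfun_apply (E' v) h) = v \<bullet> h" if "v \<in> U'" for v h
      using ga[OF sub[OF that]] S.DF[OF ED[OF sub[OF that]]] by simp
    show "continuous_on U' E'" by (rule continuous_on_subset[OF cE' iv(2)])
    show "(g has_derivative inv (blinfun_apply (E' (g y)))) (at y)" if "y \<in> V" for y using iv(7,8)[OF that] by simp
  qed (use haus charts UA pU smf trans iv s VU E0 X1 in \<open>auto intro: dE X0 XU dX cP n\<tau> sub\<close>)
  show ?thesis
  proof (rule P.geodesic_circle_length_limit)
    fix \<eta> :: real assume "\<eta> > 0"
    from exp[OF this] obtain \<rho> where \<rho>: "\<rho> > 0" "\<And>v h. v \<in> ball 0 \<delta> \<Longrightarrow> 0 < norm v \<and> norm v < \<rho> \<and> v \<bullet> h = 0 \<and> norm h = norm v \<Longrightarrow>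
       \<bar>norm (S.DF (E v) (blinfun_apply (E' v) h)) - (norm v - S.gcurv (\<phi> p) * norm v ^ 3 / 6)\<bar> \<le> \<eta> * norm v ^ 3" by blast
    show "\<exists>\<rho>>0. \<forall>v\<in>U'. \<forall>h. 0 < norm v \<and> norm v < \<rho> \<and> v \<bullet> h = 0 \<and> norm h = norm v \<longrightarrow>
       \<bar>norm (P.dF (E v) (blinfun_apply (E' v) h)) - (norm v - S.gcurv (\<phi> p) * norm v ^ 3 / 6)\<bar> \<le> \<eta> * norm v ^ 3"
    proof (intro exI[of _ \<rho>] conjI ballI allI impI \<rho>(1))
      fix v h assume v: "v \<in> U'" and h: "0 < norm v \<and> norm v < \<rho> \<and> v \<bullet> h = 0 \<and> norm h = norm v"
      show "\<bar>norm (P.dF (E v) (blinfun_apply (E' v) h)) - (norm v - S.gcurv (\<phi> p) * norm v ^ 3 / 6)\<bar> \<le> \<eta> * norm v ^ 3"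
        using \<rho>(2)[OF sub[OF v] h] S.DF[OF ED[OF sub[OF v]]] by simp
    qed
  qed
qed

section \<open>Curvature of the unit sphere and the Birkhoff-Gauss map\<close>

lemma Basis_real2: "(Basis :: (real^2) set) = {axis 1 1, axis 2 1}"
  by (auto simp: Basis_vec_def UNIV_2)

text \<open>By injectivity the range has dimension two; it lies in the hyperplane, which has
  dimension two as well.\<close>

lemma linear_inj_hyperplane:
  fixes l :: "real^2 \<Rightarrow> real^3"
  assumes l: "linear l" "inj l" and g: "g \<noteq> 0" "\<And>v. g \<bullet> l v = 0"
  shows "range l = {w. g \<bullet> w = 0}"
proof (rule subspace_dim_equal)
  show "subspace (range l)" using linear_subspace_image[OF l(1) subspace_UNIV] .
  show "subspace {w. g \<bullet> w = 0}" by (rule subspace_hyperplane)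
  show "range l \<subseteq> {w. g \<bullet> w = 0}" using g(2) by auto
  have "dim (range l) = 2" using dim_image_eq[OF l(1), of UNIV] l(2) by (simp add: dim_UNIV)
  then show "dim {w. g \<bullet> w = 0} \<le> dim (range l)" using dim_hyperplane[OF g(1)] by simp
qed

text \<open>Replaces the determinant in a basis by the factor between two cross products. In this
  form it can be evaluated on any pair of tangent vectors, and composed differentials multiply their
  factors.\<close>

lemma plane_det_cross3:
  fixes l m :: "real^2 \<Rightarrow> real^3"
  assumes l: "linear l" "inj l" and m: "linear m" "range m \<subseteq> range l" and L: "\<And>v. L (l v) = m v"
  shows "cross3 (m (axis 1 1)) (m (axis 2 1)) = plane_det (range l) L *\<^sub>R cross3 (l (axis 1 1)) (l (axis 2 1))"
proof -
  let ?b1 = "l (axis 1 1)" and ?b2 = "l (axis 2 1)"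
  have "\<exists>u. m v = l u" for v using m(2) by blast
  then obtain u1 u2 where u: "m (axis 1 1) = l u1" "m (axis 2 1) = l u2" by metis
  define d where "d = u1$1 * u2$2 - u1$2 * u2$1"
  have md: "cross3 (m (axis 1 1)) (m (axis 2 1)) = d *\<^sub>R cross3 ?b1 ?b2"
    unfolding u d_def by (rule cross3_linear_image[OF l(1)])
  have ind: "independent {?b1, ?b2}"
    using linear_independent_injective_image[OF l(1) independent_Basis] l(2) by (simp add: Basis_real2 inj_on_subset)
  have ne: "?b1 \<noteq> ?b2" using l(2) by (auto simp: inj_eq axis_eq_axis)
  have span: "span {?b1, ?b2} = range l"
    using linear_span_image[OF l(1), of Basis] by (simp add: Basis_real2 span_Basis[where 'a="real^2", unfolded Basis_real2])
  have cross_ne: "cross3 x y \<noteq> 0" if "x \<noteq> y" "independent {x, y}" for x y :: "real^3"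
  proof
    assume "cross3 x y = 0"
    then have "collinear {0, x, y}" by (simp add: cross_eq_0)
    moreover have "x \<noteq> 0" "y \<noteq> 0" using that(2) dependent_zero by auto
    ultimately obtain c where c: "y = c *\<^sub>R x" by (auto simp: collinear_lemma)
    have "y \<in> span {x}" unfolding c by (intro span_scale span_base) simp
    moreover have "{x, y} - {y} = {x}" using that(1) by auto
    ultimately have "dependent {x, y}" unfolding dependent_def by (intro bexI[of _ y]) auto
    then show False using that(2) by simp
  qed
  have c0: "cross3 ?b1 ?b2 \<noteq> 0" by (rule cross_ne[OF ne ind])
  \<comment> \<open>A change of basis multiplies both cross products by the same nonzero
    determinant, so every admissible basis yields the same scalar and the definite description is
    justified.\<close>
  have uniq: "d' = d" if "b1 \<noteq> b2" "independent {b1, b2}" "span {b1, b2} = range l"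
     "L b1 = a11 *\<^sub>R b1 + a21 *\<^sub>R b2" "L b2 = a12 *\<^sub>R b1 + a22 *\<^sub>R b2" "d' = a11 * a22 - a12 * a21" for d' b1 b2 and a11 a12 a21 a22 :: real
  proof -
    have "b1 \<in> range l" "b2 \<in> range l" using that(3) span_base[of _ "{b1,b2}"] by auto
    then obtain v1 v2 where v: "b1 = l v1" "b2 = l v2" by auto
    have "cross3 (a11 *\<^sub>R b1 + a21 *\<^sub>R b2) (a12 *\<^sub>R b1 + a22 *\<^sub>R b2) = (a11 * a22 - a12 * a21) *\<^sub>R cross3 b1 b2"
      by (simp add: cross3_simps)
    then have "cross3 (m v1) (m v2) = d' *\<^sub>R cross3 b1 b2"
      using that(4,5,6) unfolding v L by simp
    then have "(v1$1 * v2$2 - v1$2 * v2$1) *\<^sub>R d *\<^sub>R cross3 ?b1 ?b2 = d' *\<^sub>R (v1$1 * v2$2 - v1$2 * v2$1) *\<^sub>R cross3 ?b1 ?b2"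
      unfolding v cross3_linear_image[OF m(1), of v1 v2] cross3_linear_image[OF l(1), of v1 v2] md .
    moreover have "v1$1 * v2$2 - v1$2 * v2$1 \<noteq> 0"
      using cross_ne[OF that(1,2)] unfolding v cross3_linear_image[OF l(1), of v1 v2] by auto
    ultimately show ?thesis using c0 by simp
  qed
  have "plane_det (range l) L = d"
    unfolding plane_det_def
  proof (rule the_equality)
    have "L ?b1 = u1$1 *\<^sub>R ?b1 + u1$2 *\<^sub>R ?b2" "L ?b2 = u2$1 *\<^sub>R ?b1 + u2$2 *\<^sub>R ?b2"
      unfolding L u by (rule linear_real2[OF l(1)])+
    moreover have "d = u1$1 * u2$2 - u2$1 * u1$2" by (simp add: d_def)
    ultimately show "\<exists>b1 b2 a11 a12 a21 a22. b1 \<noteq> b2 \<and> independent {b1, b2} \<and> span {b1, b2} = range l \<and>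
       L b1 = a11 *\<^sub>R b1 + a21 *\<^sub>R b2 \<and> L b2 = a12 *\<^sub>R b1 + a22 *\<^sub>R b2 \<and> d = a11 * a22 - a12 * a21"
      using ne ind span by blast
  qed (use uniq in blast)
  then show ?thesis using md by simp
qed

text \<open>The compatibility assumption \<open>ch\<close> makes \<open>surf_differential\<close>
  well defined: in every chart a tangent vector and its image come from one and the same vector of
  \<open>c0\<close>.\<close>

lemma gauss_map_curvature_cross3:
  assumes c0: "c0 \<in> A" "p \<in> fst c0" and l: "linear (chart_deriv c0 f p)" "inj (chart_deriv c0 f p)"
    and m: "linear (chart_deriv c0 h p)" "range (chart_deriv c0 h p) \<subseteq> range (chart_deriv c0 f p)"
    and ch: "\<And>c v. c \<in> A \<Longrightarrow> p \<in> fst c \<Longrightarrow> \<exists>u. chart_deriv c f p v = chart_deriv c0 f p u \<and> chart_deriv c h p v = chart_deriv c0 h p u"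
  shows "tangent_plane A f p = range (chart_deriv c0 f p)"
    and "cross3 (chart_deriv c0 h p (axis 1 1)) (chart_deriv c0 h p (axis 2 1))
      = gauss_map_curvature A f h p *\<^sub>R cross3 (chart_deriv c0 f p (axis 1 1)) (chart_deriv c0 f p (axis 2 1))"
proof -
  show t: "tangent_plane A f p = range (chart_deriv c0 f p)"
  proof
    show "tangent_plane A f p \<subseteq> range (chart_deriv c0 f p)" unfolding tangent_plane_def using ch by blast
    show "range (chart_deriv c0 f p) \<subseteq> tangent_plane A f p" unfolding tangent_plane_def using c0 by blast
  qed
  have L: "surf_differential A f h p (chart_deriv c0 f p v) = chart_deriv c0 h p v" for v
    unfolding surf_differential_def
  proof (rule the_equality)
    show "\<exists>c\<in>A. p \<in> fst c \<and> (\<exists>va. chart_deriv c0 f p v = chart_deriv c f p va \<and> chart_deriv c0 h p v = chart_deriv c h p va)"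
      using c0 by blast
    fix z assume "\<exists>c\<in>A. p \<in> fst c \<and> (\<exists>va. chart_deriv c0 f p v = chart_deriv c f p va \<and> z = chart_deriv c h p va)"
    then obtain c va where c: "c \<in> A" "p \<in> fst c" "chart_deriv c0 f p v = chart_deriv c f p va" "z = chart_deriv c h p va" by blast
    obtain u where u: "chart_deriv c f p va = chart_deriv c0 f p u" "chart_deriv c h p va = chart_deriv c0 h p u" using ch[OF c(1,2)] by blast
    have "v = u" using c(3) u(1) l(2) by (simp add: inj_eq)
    then show "z = chart_deriv c0 h p v" using c(4) u(2) by simp
  qed
  show "cross3 (chart_deriv c0 h p (axis 1 1)) (chart_deriv c0 h p (axis 2 1))
      = gauss_map_curvature A f h p *\<^sub>R cross3 (chart_deriv c0 f p (axis 1 1)) (chart_deriv c0 f p (axis 2 1))"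
    unfolding gauss_map_curvature_def t by (rule plane_det_cross3[OF l m L])
qed

lemma chart_image_Int_open:
  assumes "chart_of X (U, \<phi>)" "chart_of X (V, \<psi>)" shows "open (\<psi> ` (U \<inter> V))"
proof -
  have h: "homeomorphic_map (subtopology X V) (top_of_set (\<psi> ` V)) \<psi>" using assms(2) by (auto simp: chart_of_def)
  have "openin (subtopology X V) (U \<inter> V)" using chart_ofD(3)[OF assms(1)] by (auto simp: openin_subtopology)
  then have "openin (top_of_set (\<psi> ` V)) (\<psi> ` (U \<inter> V))" using homeomorphic_imp_open_map[OF h] by (auto simp: open_map_def)
  then show ?thesis using openin_open_trans chart_ofD(4)[OF assms(2)] by blast
qed

text \<open>The vector on the right depends on the transition map alone and not on \<open>h\<close>;
  the same one therefore serves for the immersion and for the Gauss map at once.\<close>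

lemma chart_deriv_change:
  assumes ch: "chart_of X (U, \<phi>)" "chart_of X (V, \<psi>)" and p: "p \<in> U" "p \<in> V"
    and h: "smooth_on (\<phi> ` U) (h \<circ> inv_into U \<phi>)" and tr: "smooth_on (\<psi> ` (U \<inter> V)) (\<phi> \<circ> inv_into V \<psi>)"
  shows "chart_deriv (V, \<psi>) h p v = chart_deriv (U, \<phi>) h p (frechet_derivative (\<phi> \<circ> inv_into V \<psi>) (at (\<psi> p)) v)"
proof -
  note iU = chart_ofD(2)[OF ch(1)] and iV = chart_ofD(2)[OF ch(2)]
  have x: "\<psi> p \<in> \<psi> ` (U \<inter> V)" using p by blast
  have t: "(\<phi> \<circ> inv_into V \<psi>) (\<psi> p) = \<phi> p" using iV p by simp
  have d1: "((\<phi> \<circ> inv_into V \<psi>) has_derivative frechet_derivative (\<phi> \<circ> inv_into V \<psi>) (at (\<psi> p))) (at (\<psi> p))"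
    by (rule smooth_on_has_derivative[OF tr x])
  have d2: "((h \<circ> inv_into U \<phi>) has_derivative chart_deriv (U, \<phi>) h p) (at ((\<phi> \<circ> inv_into V \<psi>) (\<psi> p)))"
    unfolding t chart_deriv_def using smooth_on_has_derivative[OF h, of "\<phi> p"] p by simp
  have "((\<lambda>x. (h \<circ> inv_into U \<phi>) ((\<phi> \<circ> inv_into V \<psi>) x)) has_derivative (\<lambda>v. chart_deriv (U, \<phi>) h p (frechet_derivative (\<phi> \<circ> inv_into V \<psi>) (at (\<psi> p)) v))) (at (\<psi> p))"
    by (rule has_derivative_compose[OF d1 d2])
  then have "((h \<circ> inv_into V \<psi>) has_derivative (\<lambda>v. chart_deriv (U, \<phi>) h p (frechet_derivative (\<phi> \<circ> inv_into V \<psi>) (at (\<psi> p)) v))) (at (\<psi> p))"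
    by (rule has_derivative_transform_within_open[OF _ chart_image_Int_open[OF ch] x]) (use iU iV in auto)
  from fun_cong[OF frechet_derivative_at[OF this], of v] show ?thesis by (simp add: chart_deriv_def)
qed

context param_surface begin

text \<open>A continuous unit normal field is \<open>nrm\<close> up to a sign that is constant near
  \<open>x\<close>, and two factors of the normal cancel the sign. This allows the normal of the
  unit sphere, transported by \<open>\<eta>\<close>, to compute the curvature of the
  surface.\<close>

lemma gcurv_via_normal:
  assumes x: "x \<in> D" and d: "(\<mu> has_derivative \<mu>') (at x)" and c: "continuous_on D \<mu>"
    and u: "\<And>y. y \<in> D \<Longrightarrow> norm (\<mu> y) = 1" and o: "\<And>y v. y \<in> D \<Longrightarrow> \<mu> y \<bullet> DF y v = 0"
    and k: "cross3 (\<mu>' (axis 1 1)) (\<mu>' (axis 2 1)) = k *\<^sub>R cross3 (F1 x) (F2 x)"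
  shows "gcurv x = k"
proof -
  define s where "s = (\<lambda>y. \<mu> y \<bullet> nrm y)"
  have ms: "\<mu> y = s y *\<^sub>R nrm y" if y: "y \<in> D" for y
    unfolding s_def by (rule orth_DF_imp_nrm[OF y o[OF y]])
  have s1: "s y * s y = 1" if y: "y \<in> D" for y
  proof -
    have "\<mu> y \<bullet> \<mu> y = 1" using u[OF y] by (simp add: dot_square_norm)
    then show ?thesis using nrm_simps(1)[OF y] by (subst (asm) (1 2) ms[OF y]) simp
  qed
  have "continuous_on D s" unfolding s_def by (intro continuous_intros c smooth_on_continuous[OF smooth_nrm])
  \<comment> \<open>The open set on which the sign agrees with the one at \<open>x\<close>.\<close>
  then have "open (D \<inter> (\<lambda>y. s y * s x) -` {0<..})" by (intro continuous_open_preimage continuous_intros openD) auto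
  moreover have "x \<in> D \<inter> (\<lambda>y. s y * s x) -` {0<..}" using x s1[OF x] by simp
  moreover have "nrm y = s x *\<^sub>R \<mu> y" if y: "y \<in> D \<inter> (\<lambda>y. s y * s x) -` {0<..}" for y
  proof -
    have "(s y * s x) * (s y * s x) = 1" using s1[OF x] s1[of y] y by (simp add: algebra_simps)
    then have "s y * s x = 1" using y by (auto simp: square_eq_1_iff)
    then show ?thesis using ms[of y] y by (simp add: mult.commute)
  qed
  ultimately have "(nrm has_derivative (\<lambda>v. s x *\<^sub>R \<mu>' v)) (at x)"
    using has_derivative_transform_within_open[OF has_derivative_scaleR_right[OF d, of "s x"], of "D \<inter> (\<lambda>y. s y * s x) -` {0<..}" nrm] by simp
  then have n: "frechet_derivative nrm (at x) = (\<lambda>v. s x *\<^sub>R \<mu>' v)" by (rule frechet_derivative_at[symmetric])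
  show ?thesis
  proof (rule gcurv_unique[OF x])
    have "cross3 (s x *\<^sub>R \<mu>' (axis 1 1)) (s x *\<^sub>R \<mu>' (axis 2 1)) = (s x * s x) *\<^sub>R cross3 (\<mu>' (axis 1 1)) (\<mu>' (axis 2 1))"
      by (simp add: cross_mult_left cross_mult_right)
    then show "cross3 (frechet_derivative nrm (at x) (axis 1 1)) (frechet_derivative nrm (at x) (axis 2 1)) = k *\<^sub>R cross3 (F1 x) (F2 x)"
      unfolding n s1[OF x] using k by simp
  qed
qed

end

section \<open>Gradient, normal and charts of the unit sphere of a smooth norm\<close>

locale smooth_norm_space =
  fixes N :: "real^3 \<Rightarrow> real"
  assumes isN: "is_norm N" and smN: "smooth_norm N"
begin

abbreviation "S \<equiv> unit_sphere N"
definition "grad x = (\<Sum>b\<in>Basis. frechet_derivative N (at x) b *\<^sub>R b)"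
text \<open>The outward unit normal, extended to all of space away from the origin, so that it is
  differentiated as a map of space and composed with \<open>\<eta>\<close> by the ordinary chain
  rule.\<close>

definition "normal x = inverse (sqrt (grad x \<bullet> grad x)) *\<^sub>R grad x"

lemma N_simps: "0 \<le> N x" "N x = 0 \<longleftrightarrow> x = 0" "N (c *\<^sub>R x) = \<bar>c\<bar> * N x"
  using isN by (auto simp: is_norm_def)

lemma S_nonzero: "x \<in> S \<Longrightarrow> x \<noteq> 0" using N_simps(2)[of x] by (auto simp: unit_sphere_def)

lemma open_nonzero: "open (- {0 :: real^3})" by (simp add: open_Compl)

lemma smN': "smooth_on (- {0}) N" using smN by (simp add: smooth_norm_def)

lemma N_deriv: assumes "x \<noteq> 0" shows "(N has_derivative (\<lambda>h. grad x \<bullet> h)) (at x)"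
proof -
  have d: "(N has_derivative frechet_derivative N (at x)) (at x)" using smooth_on_has_derivative[OF smN'] assms by auto
  then have l: "linear (frechet_derivative N (at x))" by (rule has_derivative_linear)
  have "frechet_derivative N (at x) h = grad x \<bullet> h" for h
  proof -
    have "frechet_derivative N (at x) (\<Sum>b\<in>Basis. (h \<bullet> b) *\<^sub>R b) = (\<Sum>b\<in>Basis. (h \<bullet> b) * frechet_derivative N (at x) b)"
      by (simp add: linear_sum[OF l] linear_scale[OF l])
    then have "frechet_derivative N (at x) h = (\<Sum>b\<in>Basis. (h \<bullet> b) * frechet_derivative N (at x) b)" by (simp add: euclidean_representation)
    also have "\<dots> = grad x \<bullet> h" unfolding grad_def inner_sum_left inner_scaleR_left
      by (intro sum.cong refl) (metis inner_commute mult.commute)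
    finally show ?thesis .
  qed
  then have "frechet_derivative N (at x) = (\<lambda>h. grad x \<bullet> h)" by (rule ext)
  then show ?thesis using d by simp
qed

text \<open>Euler's identity for functions homogeneous of degree one. It shows that the gradient
  vanishes nowhere and points outward.\<close>

lemma grad_self: assumes "x \<noteq> 0" shows "grad x \<bullet> x = N x"
proof -
  have "((\<lambda>t. t *\<^sub>R x) has_derivative (\<lambda>t. t *\<^sub>R x)) (at (1::real))" by (auto intro!: derivative_eq_intros)
  moreover have "(N has_derivative (\<lambda>h. grad x \<bullet> h)) (at ((1::real) *\<^sub>R x))" using N_deriv[OF assms] by simp
  ultimately have "((\<lambda>t. N (t *\<^sub>R x)) has_derivative (\<lambda>t. grad x \<bullet> (t *\<^sub>R x))) (at (1::real))" by (rule has_derivative_compose)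
  moreover have "((\<lambda>t. N (t *\<^sub>R x)) has_derivative (\<lambda>t. t * N x)) (at (1::real))"
  proof (rule has_derivative_transform_within_open[of "\<lambda>t. t * N x" _ _ _ "{0<..}"])
    show "((\<lambda>t. t * N x) has_derivative (\<lambda>t. t * N x)) (at (1::real))" by (auto intro!: derivative_eq_intros)
  qed (auto simp: N_simps(3))
  ultimately have "(\<lambda>t. grad x \<bullet> (t *\<^sub>R x)) = (\<lambda>t. t * N x)" by (rule has_derivative_unique)
  from fun_cong[OF this, of 1] show ?thesis by simp
qed

lemma grad_nonzero: "x \<noteq> 0 \<Longrightarrow> grad x \<noteq> 0"
  using grad_self[of x] N_simps(2)[of x] by auto

lemma smooth_grad: "smooth_on (- {0}) grad"
  unfolding grad_def[abs_def]
  by (intro smooth_on_sum[OF open_nonzero] smooth_on_scaleR[OF open_nonzero] smooth_on_frechet_derivative smN' smooth_on_const) simp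

lemma smooth_normal: "smooth_on (- {0}) normal"
  unfolding normal_def[abs_def]
  by (intro smooth_on_scaleR[OF open_nonzero] smooth_on_inverse_sqrt[OF open_nonzero] smooth_on_inner[OF open_nonzero] smooth_grad)
    (use grad_nonzero in auto)

lemma normal_simps: assumes "x \<noteq> 0" shows "norm (normal x) = 1" "normal x \<bullet> x > 0 \<or> N x = 0"
  "normal x \<bullet> w = 0 \<longleftrightarrow> grad x \<bullet> w = 0"
proof -
  have g: "grad x \<bullet> grad x > 0" using grad_nonzero[OF assms] by simp
  show "norm (normal x) = 1" using g by (simp add: normal_def norm_eq_sqrt_inner[of "grad x", symmetric])
  show "normal x \<bullet> w = 0 \<longleftrightarrow> grad x \<bullet> w = 0" using g by (simp add: normal_def)
  show "normal x \<bullet> x > 0 \<or> N x = 0" using g grad_self[OF assms] N_simps(1,2)[of x] assms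
    by (simp add: normal_def order_le_less)
qed

text \<open>Differentiates the constant \<open>N (P y) = 1\<close>; applied both to parametrizations
  of the sphere and to \<open>\<eta>\<close> in a chart.\<close>

lemma tangent_of_map_into_sphere:
  fixes P :: "real^2 \<Rightarrow> real^3"
  assumes "open D" "y \<in> D" "\<And>y. y \<in> D \<Longrightarrow> P y \<in> S" "(P has_derivative P') (at y)"
  shows "grad (P y) \<bullet> P' v = 0"
proof -
  have "((\<lambda>y. N (P y)) has_derivative (\<lambda>v. grad (P y) \<bullet> P' v)) (at y)"
    by (rule has_derivative_compose[OF assms(4) N_deriv]) (use S_nonzero assms in auto)
  moreover have "((\<lambda>y. N (P y)) has_derivative (\<lambda>v. 0)) (at y)"
    by (rule has_derivative_transform_within_open[OF has_derivative_const[of 1] assms(1,2)]) (use assms(3) in \<open>simp add: unit_sphere_def\<close>)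
  ultimately have "(\<lambda>v. grad (P y) \<bullet> P' v) = (\<lambda>v. 0)" by (rule has_derivative_unique)
  from fun_cong[OF this] show ?thesis .
qed

lemma regular_chartD:
  assumes "(V, \<psi>) \<in> regular_atlas S"
  shows "chart_of (top_of_set S) (V, \<psi>)" "smooth_on (\<psi> ` V) (inv_into V \<psi>)" "V \<subseteq> S" "inj_on \<psi> V" "open (\<psi> ` V)"
    "\<And>x. x \<in> \<psi> ` V \<Longrightarrow> inj (frechet_derivative (inv_into V \<psi>) (at x))" "\<And>x. x \<in> \<psi> ` V \<Longrightarrow> inv_into V \<psi> x \<in> S"
proof -
  show c: "chart_of (top_of_set S) (V, \<psi>)" "smooth_on (\<psi> ` V) (inv_into V \<psi>)"
     "\<And>x. x \<in> \<psi> ` V \<Longrightarrow> inj (frechet_derivative (inv_into V \<psi>) (at x))" using assms by (auto simp: regular_atlas_def)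
  show V: "V \<subseteq> S" "inj_on \<psi> V" "open (\<psi> ` V)" using chart_ofD[OF c(1)] by auto
  show "\<And>x. x \<in> \<psi> ` V \<Longrightarrow> inv_into V \<psi> x \<in> S" using V(1) by (meson inv_into_into subsetD)
qed

lemma regular_chart_deriv:
  assumes c: "(V, \<psi>) \<in> regular_atlas S" and x: "x \<in> V"
  shows "linear (chart_deriv (V, \<psi>) id x)" "inj (chart_deriv (V, \<psi>) id x)" "range (chart_deriv (V, \<psi>) id x) = {w. grad x \<bullet> w = 0}"
    "((\<lambda>y. inv_into V \<psi> y) has_derivative chart_deriv (V, \<psi>) id x) (at (\<psi> x))"
proof -
  note r = regular_chartD[OF c]
  have px: "\<psi> x \<in> \<psi> ` V" using x by blast
  have e: "chart_deriv (V, \<psi>) id x = frechet_derivative (inv_into V \<psi>) (at (\<psi> x))" by (simp add: chart_deriv_def)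
  show d: "((\<lambda>y. inv_into V \<psi> y) has_derivative chart_deriv (V, \<psi>) id x) (at (\<psi> x))"
    unfolding e by (rule smooth_on_has_derivative[OF r(2) px])
  show l: "linear (chart_deriv (V, \<psi>) id x)" by (rule has_derivative_linear[OF d])
  show i: "inj (chart_deriv (V, \<psi>) id x)" unfolding e by (rule r(6)[OF px])
  have xv: "inv_into V \<psi> (\<psi> x) = x" using r(4) x by simp
  have x0: "x \<noteq> 0" using r(3) x S_nonzero by blast
  show "range (chart_deriv (V, \<psi>) id x) = {w. grad x \<bullet> w = 0}"
    by (rule linear_inj_hyperplane[OF l i grad_nonzero[OF x0]])
      (use tangent_of_map_into_sphere[OF r(5) px r(7) d] xv in simp)
qed

text \<open>Central projection onto the tangent plane at \<open>x\<^sub>0\<close> is a chart of the unit sphere whose inverse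
  is explicit, which makes the implicit function theorem unnecessary.\<close>

lemma gnomonic_chart:
  assumes x0: "x0 \<in> S"
  obtains U \<phi> where "(U, \<phi>) \<in> regular_atlas S" "x0 \<in> U"
    "\<And>V \<psi>. (V, \<psi>) \<in> regular_atlas S \<Longrightarrow> smooth_on (\<psi> ` (U \<inter> V)) (\<phi> \<circ> inv_into V \<psi>)"
proof -
  let ?g = "grad x0"
  have x00: "x0 \<noteq> 0" by (rule S_nonzero[OF x0])
  have g0: "?g \<noteq> 0" by (rule grad_nonzero[OF x00])
  have gx: "?g \<bullet> x0 = 1" using grad_self[OF x00] x0 by (simp add: unit_sphere_def)
  \<comment> \<open>\<open>a\<close> and \<open>b\<close> become an orthonormal basis of the tangent
    plane at \<open>x0\<close>, the second vector coming from the cross product with the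
    gradient.\<close>
  obtain a0 :: "real^3" where a0: "a0 \<noteq> 0" "orthogonal ?g a0" using orthogonal_to_vector_exists[of ?g] by auto
  define a where "a = (1 / norm a0) *\<^sub>R a0"
  have aa: "a \<bullet> a = 1" "?g \<bullet> a = 0" using a0 by (auto simp: a_def orthogonal_def dot_square_norm power2_eq_square)
  define b where "b = (1 / norm ?g) *\<^sub>R cross3 ?g a"
  have bb: "b \<bullet> b = 1" "?g \<bullet> b = 0" "a \<bullet> b = 0"
  proof -
    have "norm (cross3 ?g a) = norm ?g"
    proof (rule power2_eq_imp_eq)
      show "(norm (cross3 ?g a))\<^sup>2 = (norm ?g)\<^sup>2" using norm_cross_dot[of ?g a] aa by (simp add: power_mult_distrib dot_square_norm)
    qed auto
    then have "norm b = 1" using g0 by (simp add: b_def)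
    then show "b \<bullet> b = 1" by (simp add: dot_square_norm)
    show "?g \<bullet> b = 0" "a \<bullet> b = 0" by (simp_all add: b_def dot_cross_self)
  qed
  define l where "l = (\<lambda>u :: real^2. (u$1) *\<^sub>R a + (u$2) *\<^sub>R b)"
  have ll: "linear l" unfolding l_def by (auto simp: linear_iff algebra_simps)
  have la: "l u \<bullet> a = u$1" "l u \<bullet> b = u$2" "?g \<bullet> l u = 0" for u
    using aa bb by (simp_all add: l_def inner_add_left inner_add_right inner_commute[of b a])
  have li: "inj l"
  proof (rule injI)
    fix u v assume "l u = l v"
    then have "u$1 = v$1" "u$2 = v$2" using la(1,2)[of u] la(1,2)[of v] by metis+
    then show "u = v" by (simp add: vec_eq_iff forall_2)
  qed
  have lrep: "l (vector [w \<bullet> a, w \<bullet> b]) = w" if "?g \<bullet> w = 0" for w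
  proof -
    have "w \<in> range l" using linear_inj_hyperplane[OF ll li g0 la(3)] that by blast
    then obtain u where "w = l u" by blast
    then show ?thesis using la(1,2)[of u] by (simp add: l_def)
  qed
  define Lf where "Lf = (\<lambda>u. x0 + l u)"
  have gL: "?g \<bullet> Lf u = 1" for u by (simp add: Lf_def inner_add_right gx la)
  have L0: "Lf u \<noteq> 0" for u using gL[of u] by auto
  have NL: "N (Lf u) > 0" for u using N_simps(1)[of "Lf u"] N_simps(2)[of "Lf u"] L0[of u] by linarith
  \<comment> \<open>\<open>P\<close> scales a point of the affine tangent plane to norm one;
    \<open>\<Phi>\<close> scales a point of the sphere into the affine plane
    \<open>?g \<bullet> y = 1\<close> and reads off its coordinates.\<close>
  define P where "P = (\<lambda>u. inverse (N (Lf u)) *\<^sub>R Lf u)"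
  define \<Phi> where "\<Phi> = (\<lambda>y. (((inverse (?g \<bullet> y) *\<^sub>R y - x0) \<bullet> a) *\<^sub>R axis 1 1 + ((inverse (?g \<bullet> y) *\<^sub>R y - x0) \<bullet> b) *\<^sub>R axis 2 1 :: real^2))"
  have \<Phi>v: "\<Phi> y = vector [(inverse (?g \<bullet> y) *\<^sub>R y - x0) \<bullet> a, (inverse (?g \<bullet> y) *\<^sub>R y - x0) \<bullet> b]" for y
    by (simp add: \<Phi>_def vec_eq_iff forall_2 axis_def)
  define H where "H = {y. ?g \<bullet> y > 0}"
  have oH: "open H" unfolding H_def by (rule open_halfspace_gt)
  define U where "U = S \<inter> H"
  have PU: "P u \<in> U" for u
    using NL[of u] gL[of u] by (simp add: P_def U_def H_def unit_sphere_def N_simps(3))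
  have \<Phi>P: "\<Phi> (P u) = u" for u
  proof -
    have e: "inverse (?g \<bullet> P u) *\<^sub>R P u = Lf u" using NL[of u] gL[of u] by (simp add: P_def)
    show ?thesis unfolding \<Phi>v e by (simp add: Lf_def la vec_eq_iff forall_2)
  qed
  have P\<Phi>: "P (\<Phi> y) = y" if y: "y \<in> U" for y
  proof -
    have gy: "?g \<bullet> y > 0" and Ny: "N y = 1" using y by (auto simp: U_def H_def unit_sphere_def)
    have "Lf (\<Phi> y) = x0 + (inverse (?g \<bullet> y) *\<^sub>R y - x0)"
      unfolding Lf_def \<Phi>v by (subst lrep) (use gy in \<open>auto simp: inner_diff_right gx\<close>)
    then have "Lf (\<Phi> y) = inverse (?g \<bullet> y) *\<^sub>R y" by simp
    then show ?thesis using gy by (simp add: P_def N_simps(3) Ny)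
  qed
  have smP: "smooth_on UNIV P"
  proof -
    have bl: "bounded_linear l" using ll by (simp add: linear_conv_bounded_linear)
    have sL: "smooth_on UNIV Lf" unfolding Lf_def
      by (intro smooth_on_add[OF open_UNIV] smooth_on_const smooth_on_linear_comp[OF open_UNIV bl smooth_on_ident[OF open_UNIV]])
    have "smooth_on UNIV (\<lambda>u. N (Lf u))"
      by (rule smooth_on_compose[OF open_UNIV _ sL smN']) (use L0 in auto)
    then show ?thesis unfolding P_def
      by (intro smooth_on_scaleR[OF open_UNIV] smooth_on_inverse[OF open_UNIV] sL) (use NL in \<open>auto simp: less_imp_neq[symmetric]\<close>)
  qed
  have sm\<Phi>: "smooth_on H \<Phi>" unfolding \<Phi>_def
    by (intro smooth_on_add[OF oH] smooth_on_scaleR[OF oH] smooth_on_inner[OF oH] smooth_on_diff[OF oH] smooth_on_inverse[OF oH]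
        smooth_on_const smooth_on_ident[OF oH]) (auto simp: H_def)
  have im: "\<Phi> ` U = UNIV" using \<Phi>P PU by (metis UNIV_eq_I imageI)
  have inj: "inj_on \<Phi> U" using P\<Phi> by (metis inj_onI)
  have inv: "inv_into U \<Phi> = P" using \<Phi>P PU inj by (metis inv_into_f_f ext)
  have "homeomorphic_maps (subtopology (top_of_set S) U) (top_of_set (\<Phi> ` U)) \<Phi> P"
  proof -
    have "continuous_on U \<Phi>" by (rule continuous_on_subset[OF smooth_on_continuous[OF sm\<Phi>]]) (auto simp: U_def)
    moreover have "continuous_on UNIV P" by (rule smooth_on_continuous[OF smP])
    moreover have "subtopology (top_of_set S) U = top_of_set U" by (simp add: subtopology_subtopology U_def Int_assoc[symmetric])
    ultimately show ?thesis unfolding im homeomorphic_maps_def using PU P\<Phi> \<Phi>P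
      by (auto simp: continuous_map_in_subtopology)
  qed
  then have hm: "homeomorphic_map (subtopology (top_of_set S) U) (top_of_set (\<Phi> ` U)) \<Phi>" using homeomorphic_map_maps by blast
  have oU: "openin (top_of_set S) U" unfolding U_def using oH by (simp add: openin_open_Int)
  have cU: "chart_of (top_of_set S) (U, \<Phi>)" using hm oU im by (simp add: chart_of_def)
  \<comment> \<open>\<open>\<Phi>\<close> is a smooth left inverse of \<open>P\<close> defined on an
    open subset of space, so the chain rule provides a left inverse of the differential.\<close>
  have injP: "inj (frechet_derivative P (at u))" for u
  proof -
    have "((\<lambda>u. \<Phi> (P u)) has_derivative (\<lambda>v. frechet_derivative \<Phi> (at (P u)) (frechet_derivative P (at u) v))) (at u)"
      by (rule has_derivative_compose[OF smooth_on_has_derivative[OF smP] smooth_on_has_derivative[OF sm\<Phi>]]) (use PU in \<open>auto simp: U_def\<close>)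
    moreover have "((\<lambda>u. \<Phi> (P u)) has_derivative (\<lambda>v. v)) (at u)" unfolding \<Phi>P by (rule has_derivative_ident)
    ultimately have "(\<lambda>v. frechet_derivative \<Phi> (at (P u)) (frechet_derivative P (at u) v)) = (\<lambda>v. v)" by (rule has_derivative_unique)
    then show ?thesis by (metis injI)
  qed
  show ?thesis
  proof (rule that)
    show "(U, \<Phi>) \<in> regular_atlas S" using cU smP injP by (simp add: regular_atlas_def inv im)
    show "x0 \<in> U" using x0 gx by (simp add: U_def H_def)
    fix V \<psi> assume c: "(V, \<psi>) \<in> regular_atlas S"
    note r = regular_chartD[OF c]
    \<comment> \<open>Smoothness of \<open>\<Phi>\<close> on an open half space, not just along the
      sphere, makes this transition a composition of smooth maps of Euclidean spaces.\<close>
    have "smooth_on (\<psi> ` (U \<inter> V)) (\<lambda>x. \<Phi> (inv_into V \<psi> x))"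
    proof (rule smooth_on_compose[OF chart_image_Int_open[OF cU r(1)] _ _ sm\<Phi>])
      show "inv_into V \<psi> ` \<psi> ` (U \<inter> V) \<subseteq> H" using r(4) by (auto simp: U_def)
      show "smooth_on (\<psi> ` (U \<inter> V)) (inv_into V \<psi>)" by (rule smooth_on_subset[OF r(2)]) auto
    qed
    then show "smooth_on (\<psi> ` (U \<inter> V)) (\<Phi> \<circ> inv_into V \<psi>)" by (simp add: o_def)
  qed
qed

lemma tangent_plane_sphere: assumes x: "x \<in> S" shows "tangent_plane (regular_atlas S) id x = {w. grad x \<bullet> w = 0}"
proof -
  obtain U \<phi> where U: "(U, \<phi>) \<in> regular_atlas S" "x \<in> U" using gnomonic_chart[OF x] by metis
  have r: "range (chart_deriv c id x) = {w. grad x \<bullet> w = 0}" if "c \<in> regular_atlas S" "x \<in> fst c" for c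
    using regular_chart_deriv(3)[of "fst c" "snd c" x] that by simp
  show ?thesis
  proof (intro set_eqI iffI)
    fix w assume "w \<in> tangent_plane (regular_atlas S) id x"
    then show "w \<in> {w. grad x \<bullet> w = 0}" unfolding tangent_plane_def using r by blast
  next
    fix w assume "w \<in> {w. grad x \<bullet> w = 0}"
    then show "w \<in> tangent_plane (regular_atlas S) id x" unfolding tangent_plane_def using r[OF U(1)] U by fastforce
  qed
qed

text \<open>A unit vector orthogonal to the tangent plane is \<open>normal x\<close> up to sign, and
  Euler's identity fixes the sign by the product with \<open>x\<close>.\<close>

lemma sphere_normal_eq: assumes x: "x \<in> S" shows "sphere_normal N x = normal x"
proof -
  have x0: "x \<noteq> 0" by (rule S_nonzero[OF x])
  have gx: "grad x \<bullet> x = 1" using grad_self[OF x0] x by (simp add: unit_sphere_def)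
  have pos: "normal x \<bullet> x > 0" using normal_simps(2)[OF x0] x by (simp add: unit_sphere_def)
  show ?thesis unfolding sphere_normal_def tangent_plane_sphere[OF x]
  proof (rule the_equality)
    show "norm (normal x) = 1 \<and> (\<forall>w\<in>{w. grad x \<bullet> w = 0}. normal x \<bullet> w = 0) \<and> 0 < normal x \<bullet> x"
      using normal_simps[OF x0] pos by auto
    fix u assume u: "norm u = 1 \<and> (\<forall>w\<in>{w. grad x \<bullet> w = 0}. u \<bullet> w = 0) \<and> 0 < u \<bullet> x"
    let ?n = "normal x"
    have nn: "?n \<bullet> ?n = 1" using normal_simps(1)[OF x0] by (simp add: dot_square_norm)
    define w where "w = u - (u \<bullet> ?n) *\<^sub>R ?n"
    have "?n \<bullet> w = 0" using nn by (simp add: w_def inner_diff_right inner_commute)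
    then have "u \<bullet> w = 0" using u normal_simps(3)[OF x0] by blast
    then have "w \<bullet> w = 0" using \<open>?n \<bullet> w = 0\<close> by (simp add: w_def inner_diff_left)
    then have e: "u = (u \<bullet> ?n) *\<^sub>R ?n" by (simp add: w_def)
    have "norm u = norm ((u \<bullet> ?n) *\<^sub>R ?n)" using e by simp
    also have "\<dots> = \<bar>u \<bullet> ?n\<bar>" using normal_simps(1)[OF x0] by simp
    finally have "\<bar>u \<bullet> ?n\<bar> = 1" using u by simp
    moreover have "u \<bullet> x = (u \<bullet> ?n) * (?n \<bullet> x)" by (subst e) simp
    then have "u \<bullet> ?n > 0" using u pos by (simp add: zero_less_mult_iff)
    ultimately show "u = ?n" using e by simp
  qed
qed

text \<open>Evaluates the curvature of the sphere on arbitrary tangent vectors instead of a chart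
  basis, so that the image vectors of the differential of \<open>\<eta>\<close> can be
  inserted.\<close>

lemma sphere_curvature_cross3:
  assumes x: "x \<in> S" and w: "grad x \<bullet> w1 = 0" "grad x \<bullet> w2 = 0"
  shows "cross3 (frechet_derivative normal (at x) w1) (frechet_derivative normal (at x) w2) = sphere_gauss_curvature N x *\<^sub>R cross3 w1 w2"
proof -
  obtain U \<phi> where U: "(U, \<phi>) \<in> regular_atlas S" "x \<in> U" using gnomonic_chart[OF x] by metis
  have x0: "x \<noteq> 0" by (rule S_nonzero[OF x])
  let ?B = "frechet_derivative normal (at x)"
  have dn: "(normal has_derivative ?B) (at x)" by (rule smooth_on_has_derivative[OF smooth_normal]) (use x0 in simp)
  have cd: "chart_deriv (V, \<psi>) (sphere_normal N) x v = ?B (chart_deriv (V, \<psi>) id x v)" if c: "(V, \<psi>) \<in> regular_atlas S" "x \<in> V" for V \<psi> v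
  proof -
    note r = regular_chartD[OF c(1)]
    have xv: "inv_into V \<psi> (\<psi> x) = x" using r(4) c(2) by simp
    have "((\<lambda>y. normal (inv_into V \<psi> y)) has_derivative (\<lambda>v. ?B (chart_deriv (V, \<psi>) id x v))) (at (\<psi> x))"
      by (rule has_derivative_compose[OF regular_chart_deriv(4)[OF c]]) (use dn xv in simp)
    then have "((sphere_normal N \<circ> inv_into V \<psi>) has_derivative (\<lambda>v. ?B (chart_deriv (V, \<psi>) id x v))) (at (\<psi> x))"
      by (rule has_derivative_transform_within_open[OF _ r(5)]) (use c(2) r(7) sphere_normal_eq in auto)
    from fun_cong[OF frechet_derivative_at[OF this], of v] show ?thesis by (simp add: chart_deriv_def)
  qed
  note rc = regular_chart_deriv[OF U]
  let ?l = "chart_deriv (U, \<phi>) id x"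
  have lB: "linear ?B" by (rule has_derivative_linear[OF dn])
  have m: "chart_deriv (U, \<phi>) (sphere_normal N) x = (\<lambda>v. ?B (?l v))" using cd[OF U] by (rule ext)
  have tang: "grad x \<bullet> ?B w = 0" if "w \<in> range ?l" for w
  proof -
    have "?B w \<bullet> normal x = 0"
      by (rule unit_derivative_orth[OF open_nonzero _ _ dn]) (use x0 normal_simps(1) in \<open>auto simp: dot_square_norm\<close>)
    then have "normal x \<bullet> ?B w = 0" by (simp add: inner_commute)
    then show ?thesis using normal_simps(3)[OF x0] by blast
  qed
  have main: "cross3 (chart_deriv (U, \<phi>) (sphere_normal N) x (axis 1 1)) (chart_deriv (U, \<phi>) (sphere_normal N) x (axis 2 1))
      = gauss_map_curvature (regular_atlas S) id (sphere_normal N) x *\<^sub>R cross3 (?l (axis 1 1)) (?l (axis 2 1))"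
  proof (rule gauss_map_curvature_cross3(2)[OF U(1) _ rc(1,2)])
    show "x \<in> fst (U, \<phi>)" using U by simp
    show "linear (chart_deriv (U, \<phi>) (sphere_normal N) x)" unfolding m using linear_compose[OF rc(1) lB] by (simp add: o_def)
    show "range (chart_deriv (U, \<phi>) (sphere_normal N) x) \<subseteq> range ?l" unfolding m rc(3) using tang by auto
    fix c v assume c: "c \<in> regular_atlas S" "x \<in> fst c"
    obtain V \<psi> where V: "c = (V, \<psi>)" by force
    have cV: "(V, \<psi>) \<in> regular_atlas S" "x \<in> V" using c V by auto
    have "chart_deriv c id x v \<in> range ?l" unfolding V rc(3) regular_chart_deriv(3)[OF cV, symmetric] by blast
    then obtain u where u: "chart_deriv c id x v = ?l u" by blast
    then show "\<exists>u. chart_deriv c id x v = ?l u \<and> chart_deriv c (sphere_normal N) x v = chart_deriv (U, \<phi>) (sphere_normal N) x u"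
      using cd[OF cV] cd[OF U] V by auto
  qed
  have "w1 \<in> range ?l" "w2 \<in> range ?l" unfolding rc(3) using w by simp_all
  then obtain v1 v2 where v: "w1 = ?l v1" "w2 = ?l v2" by blast
  have "cross3 (?B w1) (?B w2) = (v1$1 * v2$2 - v1$2 * v2$1) *\<^sub>R cross3 (?B (?l (axis 1 1))) (?B (?l (axis 2 1)))"
    unfolding v using cross3_linear_image[OF linear_compose[OF rc(1) lB], of v1 v2] by (simp add: o_def)
  also have "\<dots> = sphere_gauss_curvature N x *\<^sub>R (v1$1 * v2$2 - v1$2 * v2$1) *\<^sub>R cross3 (?l (axis 1 1)) (?l (axis 2 1))"
    using main unfolding m by (simp add: sphere_gauss_curvature_def mult.commute)
  also have "\<dots> = sphere_gauss_curvature N x *\<^sub>R cross3 w1 w2"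
    unfolding v using cross3_linear_image[OF rc(1), of v1 v2] by simp
  finally show ?thesis .
qed

text \<open>The sphere is treated as a surface immersed by \<open>id\<close>; \<open>normal\<close>
  along a chart is a unit normal field and identifies the curvature of the parametrization.\<close>

lemma sphere_circle_limit:
  assumes x: "x \<in> S"
  shows "((\<lambda>r. (2 * pi * r - unit_sphere_circle_length N x r) / r ^ 3) \<longlongrightarrow> pi * sphere_gauss_curvature N x / 3) (at_right 0)"
proof -
  obtain U \<phi> where U: "(U, \<phi>) \<in> regular_atlas S" "x \<in> U"
    and tr: "\<And>V \<psi>. (V, \<psi>) \<in> regular_atlas S \<Longrightarrow> smooth_on (\<psi> ` (U \<inter> V)) (\<phi> \<circ> inv_into V \<psi>)"
    using gnomonic_chart[OF x] by metis
  note r = regular_chartD[OF U(1)]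
  have ps: "param_surface (id \<circ> inv_into U \<phi>) (\<phi> ` U)" using r by unfold_locales auto
  interpret P: param_surface "id \<circ> inv_into U \<phi>" "\<phi> ` U" by (rule ps)
  have px: "\<phi> x \<in> \<phi> ` U" using U by blast
  have xv: "inv_into U \<phi> (\<phi> x) = x" using r(4) U by simp
  have x0: "x \<noteq> 0" by (rule S_nonzero[OF x])
  let ?B = "frechet_derivative normal (at x)" and ?l = "chart_deriv (U, \<phi>) id x"
  have dn: "(normal has_derivative ?B) (at x)" by (rule smooth_on_has_derivative[OF smooth_normal]) (use x0 in simp)
  note rc = regular_chart_deriv[OF U]
  have lD: "P.DF (\<phi> x) = ?l" using P.DF[OF px] by (simp add: chart_deriv_def)
  have "P.gcurv (\<phi> x) = sphere_gauss_curvature N x"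
  proof (rule P.gcurv_via_normal[OF px])
    show "((\<lambda>y. normal (inv_into U \<phi> y)) has_derivative (\<lambda>v. ?B (?l v))) (at (\<phi> x))"
      by (rule has_derivative_compose[OF rc(4)]) (use dn xv in simp)
    show "continuous_on (\<phi> ` U) (\<lambda>y. normal (inv_into U \<phi> y))"
      by (rule continuous_on_compose2[OF smooth_on_continuous[OF smooth_normal] smooth_on_continuous[OF r(2)]]) (use r(7) S_nonzero in auto)
    fix y assume y: "y \<in> \<phi> ` U"
    show "norm (normal (inv_into U \<phi> y)) = 1" using normal_simps(1) S_nonzero[OF r(7)[OF y]] by blast
    show "normal (inv_into U \<phi> y) \<bullet> P.DF y v = 0" for v
      using tangent_of_map_into_sphere[OF r(5) y r(7) P.F_has_derivative[OF y, simplified]] normal_simps(3)[OF S_nonzero[OF r(7)[OF y]]] by simp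
  next
    have "grad x \<bullet> ?l v = 0" for v using rc(3) by blast
    then show "cross3 (?B (?l (axis 1 1))) (?B (?l (axis 2 1))) = sphere_gauss_curvature N x *\<^sub>R cross3 (P.F1 (\<phi> x)) (P.F2 (\<phi> x))"
      unfolding P.DF_axis[symmetric] lD by (intro sphere_curvature_cross3[OF x])
  qed
  moreover have "((\<lambda>r. (2 * pi * r - geodesic_circle_length (top_of_set S) (regular_atlas S) id x r) / r ^ 3) \<longlongrightarrow> pi * P.gcurv (\<phi> x) / 3) (at_right 0)"
  proof (rule local_bertrand_puiseux[OF _ _ U _ ps tr])
    show "Hausdorff_space (top_of_set S)" by (simp add: Hausdorff_space_subtopology)
    show "chart_of (top_of_set S) c" if "c \<in> regular_atlas S" for c using regular_chartD(1)[of "fst c" "snd c"] that by simp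
    show "smooth_map (regular_atlas S) id" unfolding smooth_map_def using regular_chartD(2) by auto
  qed
  ultimately show ?thesis by (simp add: unit_sphere_circle_length_def)
qed

end

theorem theorem6p1:
  fixes N :: "real^3 \<Rightarrow> real"
    and X :: "'a topology" and A :: "'a chart set"
    and f \<eta> :: "'a \<Rightarrow> real^3" and p :: 'a
  assumes "is_norm N" and "smooth_norm N" and "strictly_convex_norm N"
    and "\<And>x. x \<in> unit_sphere N \<Longrightarrow> sphere_gauss_curvature N x \<noteq> 0"
    and "smooth_surface X A" and "orientable_surface X A"
    and "immersion A f"
    and "birkhoff_gauss_map N X A f \<eta>"
    and "p \<in> topspace X"
  shows "((\<lambda>r. (2 * pi * r - geodesic_circle_length X A f p r) /
                (2 * pi * r - unit_sphere_circle_length N (\<eta> p) r))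
          \<longlongrightarrow> minkowski_curvature A f \<eta> p) (at_right 0)"
proof -
  interpret N: smooth_norm_space N using assms by unfold_locales
  have at: "smooth_atlas X A" and haus: "Hausdorff_space X" using assms(5) by (auto simp: smooth_surface_def)
  have charts: "chart_of X c" if "c \<in> A" for c using at that by (auto simp: smooth_atlas_def)
  have tr: "smooth_on (\<phi> ` (U \<inter> V)) (\<psi> \<circ> inv_into U \<phi>)" if "(U, \<phi>) \<in> A" "(V, \<psi>) \<in> A" for U \<phi> V \<psi>
    using at that by (fastforce simp: smooth_atlas_def)
  have smf: "smooth_map A f" and imm: "\<And>c p. c \<in> A \<Longrightarrow> p \<in> fst c \<Longrightarrow> inj (chart_deriv c f p)" using assms(7) by (auto simp: immersion_def)
  have sm\<eta>: "smooth_map A \<eta>" and \<eta>S: "\<And>q. q \<in> topspace X \<Longrightarrow> \<eta> q \<in> unit_sphere N"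
    and bo: "\<And>q. q \<in> topspace X \<Longrightarrow> birkhoff_orthogonal N (\<eta> q) (tangent_plane A f q)"
    using assms(8) by (auto simp: birkhoff_gauss_map_def)
  have "p \<in> (\<Union>c\<in>A. fst c)" using at assms(9) by (simp add: smooth_atlas_def)
  then obtain U \<phi> where U: "(U, \<phi>) \<in> A" "p \<in> U" by auto
  note cU = chart_ofD[OF charts[OF U(1)]]
  have sF: "smooth_on (\<phi> ` U) (f \<circ> inv_into U \<phi>)" "smooth_on (\<phi> ` U) (\<eta> \<circ> inv_into U \<phi>)" using smf sm\<eta> U by (auto simp: smooth_map_def)
  have injF: "inj (frechet_derivative (f \<circ> inv_into U \<phi>) (at x))" if x: "x \<in> \<phi> ` U" for x
  proof -
    obtain q where q: "q \<in> U" "x = \<phi> q" using x by blast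
    then show ?thesis using imm[OF U(1), of q] by (simp add: chart_deriv_def)
  qed
  have ps: "param_surface (f \<circ> inv_into U \<phi>) (\<phi> ` U)" using cU(4) sF(1) injF by unfold_locales auto
  interpret P: param_surface "f \<circ> inv_into U \<phi>" "\<phi> ` U" by (rule ps)
  let ?E = "\<eta> \<circ> inv_into U \<phi>" and ?x = "\<phi> p"
  have px: "?x \<in> \<phi> ` U" using U by blast
  have pv: "inv_into U \<phi> ?x = p" using cU(2) U by simp
  have ES: "?E y \<in> unit_sphere N" if "y \<in> \<phi> ` U" for y
    using \<eta>S cU(6) inv_into_into[OF that] by auto
  \<comment> \<open>Birkhoff orthogonality says that along each tangent line the norm is minimal at
    \<open>\<eta> q\<close>, so its derivative vanishes there: the gradient of the norm at
    \<open>\<eta> q\<close> is normal to the surface.\<close>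
  have orth: "N.grad (?E y) \<bullet> P.DF y v = 0" if y: "y \<in> \<phi> ` U" for y v
  proof -
    obtain q where q: "q \<in> U" "y = \<phi> q" using y by blast
    have e: "?E y = \<eta> q" using q cU(2) by simp
    have qX: "q \<in> topspace X" using q cU(6) by blast
    have "P.DF y v = chart_deriv (U, \<phi>) f q v" using P.DF[OF y] q by (simp add: chart_deriv_def)
    then have "P.DF y v \<in> tangent_plane A f q" unfolding tangent_plane_def using U(1) q(1) by fastforce
    then have min: "N (\<eta> q) \<le> N (\<eta> q + t *\<^sub>R P.DF y v)" for t using bo[OF qX] unfolding birkhoff_orthogonal_def by blast
    have "((\<lambda>t. \<eta> q + t *\<^sub>R P.DF y v) has_derivative (\<lambda>t. t *\<^sub>R P.DF y v)) (at (0::real))" by (auto intro!: derivative_eq_intros)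
    moreover have "(N has_derivative (\<lambda>h. N.grad (\<eta> q) \<bullet> h)) (at (\<eta> q + (0::real) *\<^sub>R P.DF y v))"
      using N.N_deriv[OF N.S_nonzero[OF \<eta>S[OF qX]]] by simp
    ultimately have "((\<lambda>t. N (\<eta> q + t *\<^sub>R P.DF y v)) has_derivative (\<lambda>t. N.grad (\<eta> q) \<bullet> (t *\<^sub>R P.DF y v))) (at (0::real))"
      by (rule has_derivative_compose)
    then have d: "((\<lambda>t. N (\<eta> q + t *\<^sub>R P.DF y v)) has_real_derivative (N.grad (\<eta> q) \<bullet> P.DF y v)) (at 0)"
      by (simp add: has_field_derivative_def mult.commute[of _ "N.grad (\<eta> q) \<bullet> P.DF y v"] mult_commute_abs)
    have "N.grad (\<eta> q) \<bullet> P.DF y v = 0" by (rule DERIV_local_min[OF d zero_less_one]) (use min in simp)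
    then show ?thesis using e by simp
  qed
  have \<eta>p: "\<eta> p \<in> unit_sphere N" by (rule \<eta>S[OF assms(9)])
  have \<eta>0: "\<eta> p \<noteq> 0" by (rule N.S_nonzero[OF \<eta>p])
  have Ex: "?E ?x = \<eta> p" using pv by simp
  let ?l = "chart_deriv (U, \<phi>) f p" and ?m = "chart_deriv (U, \<phi>) \<eta> p"
  have l: "?l = P.DF ?x" using P.DF[OF px] by (simp add: chart_deriv_def)
  have dm: "(?E has_derivative ?m) (at ?x)" using smooth_on_has_derivative[OF sF(2) px] by (simp add: chart_deriv_def)
  have ll: "linear ?l" unfolding l by (rule P.linear_DF[OF px])
  have li: "inj ?l" using imm[OF U(1)] U(2) by simp
  \<comment> \<open>The two tangent planes coincide as subspaces, which makes the differential of
    \<open>\<eta>\<close> an endomorphism.\<close>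
  have lr: "range ?l = {w. N.grad (\<eta> p) \<bullet> w = 0}"
    by (rule linear_inj_hyperplane[OF ll li N.grad_nonzero[OF \<eta>0]]) (use orth[OF px] Ex l in simp)
  have mt: "N.grad (\<eta> p) \<bullet> ?m v = 0" for v
    using N.tangent_of_map_into_sphere[OF cU(4) px ES dm] Ex by simp
  let ?K = "minkowski_curvature A f \<eta> p" and ?KS = "sphere_gauss_curvature N (\<eta> p)"
  have K: "cross3 (?m (axis 1 1)) (?m (axis 2 1)) = ?K *\<^sub>R cross3 (?l (axis 1 1)) (?l (axis 2 1))"
    unfolding minkowski_curvature_def
  proof (rule gauss_map_curvature_cross3(2)[OF U(1) _ ll li])
    show "p \<in> fst (U, \<phi>)" using U by simp
    show "linear ?m" by (rule has_derivative_linear[OF dm])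
    show "range ?m \<subseteq> range ?l" unfolding lr using mt by auto
    fix c v assume c: "c \<in> A" "p \<in> fst c"
    obtain V \<psi> where V: "c = (V, \<psi>)" by force
    have cV: "(V, \<psi>) \<in> A" "p \<in> V" using c V by auto
    have t: "smooth_on (\<psi> ` (U \<inter> V)) (\<phi> \<circ> inv_into V \<psi>)" using tr[OF cV(1) U(1)] by (simp add: Int_commute)
    show "\<exists>u. chart_deriv c f p v = ?l u \<and> chart_deriv c \<eta> p v = ?m u"
      unfolding V using chart_deriv_change[OF charts[OF U(1)] charts[OF cV(1)] U(2) cV(2) sF(1) t]
        chart_deriv_change[OF charts[OF U(1)] charts[OF cV(1)] U(2) cV(2) sF(2) t] by blast
  qed
  let ?B = "frechet_derivative N.normal (at (\<eta> p))"
  have dn: "(N.normal has_derivative ?B) (at (?E ?x))"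
    unfolding Ex by (rule smooth_on_has_derivative[OF N.smooth_normal]) (use \<eta>0 in simp)
  \<comment> \<open>\<open>N.normal\<close> after \<open>\<eta>\<close> is a unit normal field of
    the surface. Its differential multiplies cross products by \<open>?K\<close> through
    \<open>\<eta>\<close> and then by \<open>?KS\<close> through the normal of the sphere.\<close>
  have gc: "P.gcurv ?x = ?KS * ?K"
  proof (rule P.gcurv_via_normal[OF px])
    show "((\<lambda>y. N.normal (?E y)) has_derivative (\<lambda>v. ?B (?m v))) (at ?x)"
      by (rule has_derivative_compose[OF dm dn])
    have "?E ` \<phi> ` U \<subseteq> - {0}"
    proof (rule image_subsetI)
      show "?E y \<in> - {0}" if "y \<in> \<phi> ` U" for y using N.S_nonzero[OF ES[OF that]] by simp
    qed
    then show "continuous_on (\<phi> ` U) (\<lambda>y. N.normal (?E y))"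
      by (rule continuous_on_compose2[OF smooth_on_continuous[OF N.smooth_normal] smooth_on_continuous[OF sF(2)]])
    show "norm (N.normal (?E y)) = 1" if "y \<in> \<phi> ` U" for y by (rule N.normal_simps(1)[OF N.S_nonzero[OF ES[OF that]]])
    show "N.normal (?E y) \<bullet> P.DF y v = 0" if "y \<in> \<phi> ` U" for y v
      using N.normal_simps(3)[OF N.S_nonzero[OF ES[OF that]]] orth[OF that] by blast
    have "cross3 (?B (?m (axis 1 1))) (?B (?m (axis 2 1))) = ?KS *\<^sub>R cross3 (?m (axis 1 1)) (?m (axis 2 1))"
      by (rule N.sphere_curvature_cross3[OF \<eta>p mt mt])
    then show "cross3 (?B (?m (axis 1 1))) (?B (?m (axis 2 1))) = (?KS * ?K) *\<^sub>R cross3 (P.F1 ?x) (P.F2 ?x)"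
      unfolding P.DF_axis[symmetric] l[symmetric] by (simp add: K)
  qed
  have lM: "((\<lambda>r. (2 * pi * r - geodesic_circle_length X A f p r) / r ^ 3) \<longlongrightarrow> pi * (?KS * ?K) / 3) (at_right 0)"
    using local_bertrand_puiseux[OF haus charts U smf ps] tr U(1) unfolding gc by (simp add: Int_commute)
  have lS: "((\<lambda>r. (2 * pi * r - unit_sphere_circle_length N (\<eta> p) r) / r ^ 3) \<longlongrightarrow> pi * ?KS / 3) (at_right 0)"
    by (rule N.sphere_circle_limit[OF \<eta>p])
  have KS: "?KS \<noteq> 0" by (rule assms(4)[OF \<eta>p])
  \<comment> \<open>The nonvanishing curvature of the sphere makes the limit of the denominators
    nonzero, so the quotient of limits exists.\<close>
  have q: "((\<lambda>r. ((2 * pi * r - geodesic_circle_length X A f p r) / r ^ 3) / ((2 * pi * r - unit_sphere_circle_length N (\<eta> p) r) / r ^ 3))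
      \<longlongrightarrow> (pi * (?KS * ?K) / 3) / (pi * ?KS / 3)) (at_right 0)"
    by (rule tendsto_divide[OF lM lS]) (use KS in simp)
  have e: "(pi * (?KS * ?K) / 3) / (pi * ?KS / 3) = ?K" using KS by simp
  have "eventually (\<lambda>r. ((2 * pi * r - geodesic_circle_length X A f p r) / r ^ 3) / ((2 * pi * r - unit_sphere_circle_length N (\<eta> p) r) / r ^ 3)
     = (2 * pi * r - geodesic_circle_length X A f p r) / (2 * pi * r - unit_sphere_circle_length N (\<eta> p) r)) (at_right 0)"
    using eventually_at_right_less[of "0::real"] by eventually_elim simp
  from Lim_transform_eventually[OF q this] show ?thesis unfolding e .
qed

end
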